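(* Let $\Omega\subset\mathbb{C}^m$ be a bounded domain. If $K_1,K_2:\Omega\times\Omega\to\mathbb{C}$ are generalized Bergman kernels, then for every integer $k\ge 0$ the kernel $J_k(K_1,K_2)_{|\mathrm{res}\,\Delta}$ is also a generalized Bergman kernel.
   Context: Kernels are sesqui-analytic: holomorphic in the first and anti-holomorphic in the second set of $m$ variables. A kernel $K:\Omega\times\Omega\to\mathcal{M}_n(\mathbb{C})$ is positive definite if for all distinct $z_1,\dots,z_N\in\Omega$ and all $\eta_1,\dots,\eta_N\in\mathbb{C}^n$, not all zero, $\sum_{p,q}\langle K(z_p,z_q)\eta_q,\eta_p\rangle>0$. $(\mathcal{H},K)$ is the associated reproducing kernel Hilbert space of $\mathbb{C}^n$-valued holomorphic functions on $\Omega$, with $\langle f,K(\cdot,w)\eta\rangle=\langle f(w),\eta\rangle$. For a commuting tuple $\boldsymbol{T}=(T_1,\dots,T_m)$ of bounded operators on a Hilbert space $\mathcal{H}$, $D_{\boldsymbol{T}}:\mathcal{H}\to\mathcal{H}\oplus\cdots\oplus\mathcal{H}$ is $D_{\boldsymbol{T}}x=(T_1x,\dots,T_mx)$. A positive definite kernel $K:\Omega\times\Omega\to\mathcal{M}_n(\mathbb{C})$ is sharp if (i) the multiplication operator $M_{z_i}$ is bounded on $(\mathcal{H},K)$ for $i=1,\dots,m$, and (ii) $\ker D_{(\boldsymbol{M}_z-w)^*}=\mathrm{ran}\,K(\cdot,w):=\{K(\cdot,w)\eta:\eta\in\mathbb{C}^n\}$ for all $w\in\Omega$, where $(\boldsymbol{M}_z-w)^*=((M_{z_1}-w_1)^*,\dots,(M_{z_m}-w_m)^*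 )$. If moreover $\mathrm{ran}\,D_{(\boldsymbol{M}_z-w)^*}$ is closed for all $w\in\Omega$, $K$ is a generalized Bergman kernel. For scalar non-negative definite kernels $K_1,K_2$ on $\Omega\times\Omega$ and $k\ge0$, with $d=\binom{m+k}{m}$, $J_k(K_1,K_2)_{|\mathrm{res}\,\Delta}:\Omega\times\Omega\to\mathcal{M}_d(\mathbb{C})$ is the kernel $$J_k(K_1,K_2)_{|\mathrm{res}\,\Delta}(z,w)=\big(K_1(z,w)\,\partial^{\boldsymbol{i}}\bar\partial^{\boldsymbol{j}}K_2(z,w)\big)_{\boldsymbol{i},\boldsymbol{j}},$$ where the rows and columns are indexed by the multi-indices $\boldsymbol{i},\boldsymbol{j}\in\mathbb{Z}_+^m$ with $|\boldsymbol{i}|,|\boldsymbol{j}|\le k$, $\partial^{\boldsymbol{i}}=\prod_l(\partial/\partial z_l)^{i_l}$ and $\bar\partial^{\boldsymbol{j}}=\prod_l(\partial/\partial\bar w_l)^{j_l}$. *)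

theory Defs
  imports "HOL-Complex_Analysis.Complex_Analysis" "HOL-Library.Function_Algebras"
begin

(* A C^n-valued function on a subset of C^m is a map complex^'m => 'i => complex, where the
   coordinates of C^n are indexed by an explicit finite set I :: 'i set (the size of the matrices
   J_k depends on k, so it cannot be a type).  Values of vectors and matrices at indices outside I
   are irrelevant; elements of function spaces on Omega are normalised to be 0 at points outside
   Omega and at indices outside I, so that equality of functions is equality on Omega.
   The vector space operations are the pointwise ones of Function_Algebras. *)

section \<open>Holomorphy in several variables\<close>

definition holomorphic_cn :: "(complex ^ 'm) set \<Rightarrow> (complex ^ 'm \<Rightarrow> complex) \<Rightarrow> bool" where
  "holomorphic_cn \<Omega> f \<longleftrightarrow>
     (\<forall>z\<in>\<Omega>. \<exists>D. (f has_derivative D) (at z) \<and> (\<forall>c h. D (c *s h) = c * D h))"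

(* Joint (Frechet) differentiability on Omega x Omega, complex linear in the first and conjugate
   linear in the second set of variables; that is, K z (cnj w) is holomorphic in (z, w). *)
definition sesqui_analytic ::
    "(complex ^ 'm) set \<Rightarrow> (complex ^ 'm \<Rightarrow> complex ^ 'm \<Rightarrow> complex) \<Rightarrow> bool" where
  "sesqui_analytic \<Omega> K \<longleftrightarrow>
     (\<forall>z\<in>\<Omega>. \<forall>w\<in>\<Omega>. \<exists>D. ((\<lambda>(x, y). K x y) has_derivative D) (at (z, w)) \<and>
        (\<forall>c h. D (c *s h, 0) = c * D (h, 0)) \<and>
        (\<forall>c h. D (0, c *s h) = cnj c * D (0, h)))"

definition coord_upd :: "complex ^ 'm \<Rightarrow> 'm \<Rightarrow> complex \<Rightarrow> complex ^ 'm" where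
  "coord_upd z l \<zeta> = (\<chi> j. if j = l then \<zeta> else z $ j)"

definition cpartial :: "'m::finite \<Rightarrow> (complex ^ 'm \<Rightarrow> complex) \<Rightarrow> (complex ^ 'm \<Rightarrow> complex)" where
  "cpartial l f = (\<lambda>z. deriv (\<lambda>\<zeta>. f (coord_upd z l \<zeta>)) (z $ l))"

(* For g anti-holomorphic in w_l: the complex derivative of g as a function of cnj w_l. *)
definition cpartial_bar :: "'m::finite \<Rightarrow> (complex ^ 'm \<Rightarrow> complex) \<Rightarrow> (complex ^ 'm \<Rightarrow> complex)" where
  "cpartial_bar l g = (\<lambda>w. deriv (\<lambda>\<zeta>. g (coord_upd w l (cnj \<zeta>))) (cnj (w $ l)))"

(* The partial derivatives are composed in the order of an arbitrarily chosen enumeration of the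
   coordinates; on (anti-)holomorphic functions they commute, so the choice is immaterial. *)
definition coord_enum :: "'m::finite list" where
  "coord_enum = (SOME ls. distinct ls \<and> set ls = UNIV)"

definition multi_power :: "('m::finite \<Rightarrow> 'f \<Rightarrow> 'f) \<Rightarrow> ('m \<Rightarrow> nat) \<Rightarrow> 'f \<Rightarrow> 'f" where
  "multi_power P \<alpha> = foldr (\<lambda>l. (P l ^^ \<alpha> l)) coord_enum"

definition mixed_partial ::
    "('m::finite \<Rightarrow> nat) \<Rightarrow> ('m \<Rightarrow> nat) \<Rightarrow> (complex ^ 'm \<Rightarrow> complex ^ 'm \<Rightarrow> complex)
      \<Rightarrow> (complex ^ 'm \<Rightarrow> complex ^ 'm \<Rightarrow> complex)" where
  "mixed_partial \<alpha> \<beta> K z w =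
     multi_power cpartial \<alpha> (\<lambda>x. multi_power cpartial_bar \<beta> (K x) w) z"

section \<open>Hilbert spaces of functions\<close>

definition fscale :: "complex \<Rightarrow> ('a \<Rightarrow> 'i \<Rightarrow> complex) \<Rightarrow> ('a \<Rightarrow> 'i \<Rightarrow> complex)" where
  "fscale c f = (\<lambda>z i. c * f z i)"

definition hnorm :: "('v \<Rightarrow> 'v \<Rightarrow> complex) \<Rightarrow> 'v \<Rightarrow> real" where
  "hnorm ip f = sqrt (Re (ip f f))"

definition hilbert_function_space ::
    "('a \<Rightarrow> 'i \<Rightarrow> complex) set
      \<Rightarrow> (('a \<Rightarrow> 'i \<Rightarrow> complex) \<Rightarrow> ('a \<Rightarrow> 'i \<Rightarrow> complex) \<Rightarrow> complex) \<Rightarrow> bool" where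
  "hilbert_function_space H ip \<longleftrightarrow>
     0 \<in> H \<and>
     (\<forall>f\<in>H. \<forall>g\<in>H. f + g \<in> H) \<and>
     (\<forall>c. \<forall>f\<in>H. fscale c f \<in> H) \<and>
     (\<forall>f\<in>H. \<forall>g\<in>H. \<forall>h\<in>H. ip (f + g) h = ip f h + ip g h) \<and>
     (\<forall>c. \<forall>f\<in>H. \<forall>g\<in>H. ip (fscale c f) g = c * ip f g) \<and>
     (\<forall>f\<in>H. \<forall>g\<in>H. ip g f = cnj (ip f g)) \<and>
     (\<forall>f\<in>H. f \<noteq> 0 \<longrightarrow> Re (ip f f) > 0) \<and>
     (\<forall>X. (\<forall>n::nat. X n \<in> H) \<and>
          (\<forall>e>0. \<exists>N. \<forall>p\<ge>N. \<forall>q\<ge>N. hnorm ip (X p - X q) < e) \<longrightarrow>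
          (\<exists>f\<in>H. (\<lambda>n. hnorm ip (X n - f)) \<longlonglongrightarrow> 0))"

definition bounded_operator ::
    "('a \<Rightarrow> 'i \<Rightarrow> complex) set
      \<Rightarrow> (('a \<Rightarrow> 'i \<Rightarrow> complex) \<Rightarrow> ('a \<Rightarrow> 'i \<Rightarrow> complex) \<Rightarrow> complex)
      \<Rightarrow> (('a \<Rightarrow> 'i \<Rightarrow> complex) \<Rightarrow> ('a \<Rightarrow> 'i \<Rightarrow> complex)) \<Rightarrow> bool" where
  "bounded_operator H ip T \<longleftrightarrow>
     (\<forall>f\<in>H. T f \<in> H) \<and>
     (\<forall>f\<in>H. \<forall>g\<in>H. T (f + g) = T f + T g) \<and>
     (\<forall>c. \<forall>f\<in>H. T (fscale c f) = fscale c (T f)) \<and>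
     (\<exists>C. \<forall>f\<in>H. hnorm ip (T f) \<le> C * hnorm ip f)"

(* Well-defined (by Riesz) for bounded operators on a Hilbert space. *)
definition hadjoint :: "'v set \<Rightarrow> ('v \<Rightarrow> 'v \<Rightarrow> complex) \<Rightarrow> ('v \<Rightarrow> 'v) \<Rightarrow> 'v \<Rightarrow> 'v" where
  "hadjoint H ip T f = (THE g. g \<in> H \<and> (\<forall>h\<in>H. ip (T h) f = ip h g))"

definition hclosed :: "'v::minus set \<Rightarrow> ('v \<Rightarrow> 'v \<Rightarrow> complex) \<Rightarrow> 'v set \<Rightarrow> bool" where
  "hclosed H ip S \<longleftrightarrow>
     (\<forall>X y. (\<forall>n::nat. X n \<in> S) \<and> y \<in> H \<and> (\<lambda>n. hnorm ip (X n - y)) \<longlonglongrightarrow> 0 \<longrightarrow> y \<in> S)"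

definition dsum_space :: "'v set \<Rightarrow> ('m \<Rightarrow> 'v) set" where
  "dsum_space H = {x. \<forall>l. x l \<in> H}"

definition dsum_inner ::
    "('v \<Rightarrow> 'v \<Rightarrow> complex) \<Rightarrow> ('m::finite \<Rightarrow> 'v) \<Rightarrow> ('m \<Rightarrow> 'v) \<Rightarrow> complex" where
  "dsum_inner ip x y = (\<Sum>l\<in>UNIV. ip (x l) (y l))"

definition D_tuple :: "('m \<Rightarrow> 'v \<Rightarrow> 'v) \<Rightarrow> 'v \<Rightarrow> ('m \<Rightarrow> 'v)" where
  "D_tuple T x = (\<lambda>l. T l x)"

section \<open>Kernels\<close>

type_synonym ('m, 'i) mkernel = "complex ^ 'm \<Rightarrow> complex ^ 'm \<Rightarrow> 'i \<Rightarrow> 'i \<Rightarrow> complex"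

definition positive_definite_kernel :: "(complex ^ 'm) set \<Rightarrow> 'i set \<Rightarrow> ('m, 'i) mkernel \<Rightarrow> bool" where
  "positive_definite_kernel \<Omega> I K \<longleftrightarrow>
     (\<forall>S \<eta>. finite S \<and> S \<subseteq> \<Omega> \<and> (\<exists>z\<in>S. \<exists>i\<in>I. \<eta> z i \<noteq> 0) \<longrightarrow>
        (let s = (\<Sum>z\<in>S. \<Sum>w\<in>S. \<Sum>i\<in>I. (\<Sum>j\<in>I. K z w i j * \<eta> w j) * cnj (\<eta> z i))
         in Im s = 0 \<and> Re s > 0))"

definition kernel_section ::
    "(complex ^ 'm) set \<Rightarrow> 'i set \<Rightarrow> ('m, 'i) mkernel \<Rightarrow> complex ^ 'm \<Rightarrow> ('i \<Rightarrow> complex)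
      \<Rightarrow> (complex ^ 'm \<Rightarrow> 'i \<Rightarrow> complex)" where
  "kernel_section \<Omega> I K w \<eta> =
     (\<lambda>z i. if z \<in> \<Omega> \<and> i \<in> I then (\<Sum>j\<in>I. K z w i j * \<eta> j) else 0)"

definition is_rkhs ::
    "(complex ^ 'm) set \<Rightarrow> 'i set \<Rightarrow> ('m, 'i) mkernel \<Rightarrow> (complex ^ 'm \<Rightarrow> 'i \<Rightarrow> complex) set
      \<Rightarrow> ((complex ^ 'm \<Rightarrow> 'i \<Rightarrow> complex) \<Rightarrow> (complex ^ 'm \<Rightarrow> 'i \<Rightarrow> complex) \<Rightarrow> complex) \<Rightarrow> bool" where
  "is_rkhs \<Omega> I K H ip \<longleftrightarrow>
     hilbert_function_space H ip \<and>
     (\<forall>f\<in>H. (\<forall>z i. z \<notin> \<Omega> \<or> i \<notin> I \<longrightarrow> f z i = 0) \<and> (\<forall>i\<in>I. holomorphic_cn \<Omega> (\<lambda>z. f z i))) \<and>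
     (\<forall>w\<in>\<Omega>. \<forall>\<eta>. kernel_section \<Omega> I K w \<eta> \<in> H \<and>
        (\<forall>f\<in>H. ip f (kernel_section \<Omega> I K w \<eta>) = (\<Sum>i\<in>I. f w i * cnj (\<eta> i))))"

(* M_{z_l} - w_l; the multiplication operator M_{z_l} is the case w = 0. *)
definition mult_shift ::
    "complex ^ 'm \<Rightarrow> 'm \<Rightarrow> (complex ^ 'm \<Rightarrow> 'i \<Rightarrow> complex) \<Rightarrow> (complex ^ 'm \<Rightarrow> 'i \<Rightarrow> complex)" where
  "mult_shift w l f = (\<lambda>z i. (z $ l - w $ l) * f z i)"

definition D_mult_adj ::
    "(complex ^ 'm \<Rightarrow> 'i \<Rightarrow> complex) set
      \<Rightarrow> ((complex ^ 'm \<Rightarrow> 'i \<Rightarrow> complex) \<Rightarrow> (complex ^ 'm \<Rightarrow> 'i \<Rightarrow> complex) \<Rightarrow> complex)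
      \<Rightarrow> complex ^ 'm \<Rightarrow> (complex ^ 'm \<Rightarrow> 'i \<Rightarrow> complex) \<Rightarrow> ('m \<Rightarrow> complex ^ 'm \<Rightarrow> 'i \<Rightarrow> complex)" where
  "D_mult_adj H ip w = D_tuple (\<lambda>l. hadjoint H ip (mult_shift w l))"

definition sharp_on ::
    "(complex ^ 'm) set \<Rightarrow> 'i set \<Rightarrow> ('m, 'i) mkernel \<Rightarrow> (complex ^ 'm \<Rightarrow> 'i \<Rightarrow> complex) set
      \<Rightarrow> ((complex ^ 'm \<Rightarrow> 'i \<Rightarrow> complex) \<Rightarrow> (complex ^ 'm \<Rightarrow> 'i \<Rightarrow> complex) \<Rightarrow> complex) \<Rightarrow> bool" where
  "sharp_on \<Omega> I K H ip \<longleftrightarrow>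
     (\<forall>l. bounded_operator H ip (mult_shift 0 l)) \<and>
     (\<forall>w\<in>\<Omega>. {f \<in> H. D_mult_adj H ip w f = 0} = range (kernel_section \<Omega> I K w))"

(* A positive definite kernel has exactly one reproducing kernel Hilbert space (Moore-Aronszajn),
   the inner product being determined on H, so the quantifier over (H, ip) only names it. *)
definition generalized_bergman_kernel ::
    "(complex ^ 'm) set \<Rightarrow> 'i set \<Rightarrow> ('m, 'i) mkernel \<Rightarrow> bool" where
  "generalized_bergman_kernel \<Omega> I K \<longleftrightarrow>
     (\<forall>i\<in>I. \<forall>j\<in>I. sesqui_analytic \<Omega> (\<lambda>z w. K z w i j)) \<and>
     positive_definite_kernel \<Omega> I K \<and>
     (\<exists>H ip. is_rkhs \<Omega> I K H ip \<and> sharp_on \<Omega> I K H ip \<and>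
        (\<forall>w\<in>\<Omega>. hclosed (dsum_space H) (dsum_inner ip) (D_mult_adj H ip w ` H)))"

definition scalar_kernel ::
    "(complex ^ 'm \<Rightarrow> complex ^ 'm \<Rightarrow> complex) \<Rightarrow> ('m, unit) mkernel" where
  "scalar_kernel K = (\<lambda>z w i j. K z w)"

definition multi_indices :: "nat \<Rightarrow> ('m::finite \<Rightarrow> nat) set" where
  "multi_indices k = {\<alpha>. (\<Sum>l\<in>UNIV. \<alpha> l) \<le> k}"

(* The size k enters only through the index set multi_indices k of the matrix. *)
definition J_res ::
    "(complex ^ 'm \<Rightarrow> complex ^ 'm \<Rightarrow> complex) \<Rightarrow> (complex ^ 'm \<Rightarrow> complex ^ 'm \<Rightarrow> complex)
      \<Rightarrow> ('m::finite, 'm \<Rightarrow> nat) mkernel" where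
  "J_res K1 K2 = (\<lambda>z w \<alpha> \<beta>. K1 z w * mixed_partial \<alpha> \<beta> K2 z w)"

end

theory Submission
  imports Defs
begin

text \<open>Call a reproducing kernel Hilbert space of holomorphic functions divisible at \<open>w\<close> if every member
  vanishing at \<open>w\<close> is of the form \<open>\<Sum>l. (z\<^sub>l - w\<^sub>l) f\<^sub>l\<close> with members \<open>f\<^sub>l\<close>. By the closed range theorem
  a kernel with bounded multiplication operators is a generalized Bergman kernel iff its space is
  divisible at every point, and then the \<open>f\<^sub>l\<close> can be chosen with norms controlled by that of the dividend.

  The space of \<open>J\<^sub>k(K\<^sub>1, K\<^sub>2)\<close> is the quotient of \<open>H\<^sub>1 \<otimes> H\<^sub>2\<close> under the map sending \<open>f(z, \<zeta>)\<close> to the jet of order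
  \<open>k\<close> in \<open>\<zeta>\<close> along the diagonal. If the image of \<open>f\<close> vanishes at \<open>w\<close>, then \<open>f(w, \<cdot>)\<close> vanishes to order \<open>k + 1\<close>
  at \<open>w\<close>, so iterated division in \<open>H\<^sub>2\<close> gives \<open>f(w, \<zeta>) = \<Sum>\<gamma>. (\<zeta> - w)\<^sup>\<gamma> g\<^sub>\<gamma>(\<zeta>)\<close> over the multi-indices of degree
  \<open>k + 1\<close>. With \<open>h \<in> H\<^sub>1\<close> and \<open>h(w) = 1\<close>, the function \<open>u(z, \<zeta>) = h(z) \<Sum>\<gamma>. (\<zeta> - z)\<^sup>\<gamma> g\<^sub>\<gamma>(\<zeta>)\<close> has zero image, and
  \<open>f - u\<close> vanishes on \<open>z = w\<close>; division in \<open>H\<^sub>1\<close>, applied to the coordinates with respect to an orthonormal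
  basis of \<open>H\<^sub>2\<close>, writes it as \<open>\<Sum>l. (z\<^sub>l - w\<^sub>l) f\<^sub>l\<close>.\<close>

section \<open>Hilbert spaces on a carrier\<close>

text \<open>The vanishing of the image of f at w constrains only the jet of f(w, .) at the single
  point w, whereas division in the first variable needs f(w, .) to vanish identically. Subtracting u
  closes this gap: u has to agree with f on the slice z = w and yet be invisible to the jets at
  every point of the diagonal, which is why the centre of the powers moves from w to z. Moving it
  stays within tensors because the factor \<zeta>_l - z_l is a difference of two multiplication
  operators, each acting on one factor and bounded there. The norm control serves the infinitely
  many coordinates of f - u: one constant for all of them makes their quotients square summable.
  Multiplication by z acts on jets as a scalar, since all derivatives fall on \<zeta>. Positive
  definiteness is a separate matter: it amounts to the independence of kernel sections tensored with
  derivative functionals. Hilbert spaces are carriers inside ambient groups of functions, so that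
  Hilbert sums, orthogonal complements and quotients of the given function spaces are instances of
  one locale.\<close>

locale hilbert =
  fixes scl :: "complex \<Rightarrow> 'v::ab_group_add \<Rightarrow> 'v" and H :: "'v set"
    and ip :: "'v \<Rightarrow> 'v \<Rightarrow> complex"
  assumes scl_add_right: "scl c (x + y) = scl c x + scl c y"
    and scl_add_left: "scl (c + d) x = scl c x + scl d x"
    and scl_scl [simp]: "scl c (scl d x) = scl (c * d) x"
    and scl_one [simp]: "scl 1 x = x"
    and zero_mem [simp]: "0 \<in> H"
    and add_mem: "f \<in> H \<Longrightarrow> g \<in> H \<Longrightarrow> f + g \<in> H"
    and scl_mem: "f \<in> H \<Longrightarrow> scl c f \<in> H"
    and ip_add_left: "f \<in> H \<Longrightarrow> g \<in> H \<Longrightarrow> h \<in> H \<Longrightarrow> ip (f + g) h = ip f h + ip g h"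
    and ip_scl_left: "f \<in> H \<Longrightarrow> g \<in> H \<Longrightarrow> ip (scl c f) g = c * ip f g"
    and ip_cnj: "f \<in> H \<Longrightarrow> g \<in> H \<Longrightarrow> ip g f = cnj (ip f g)"
    and ip_pos: "f \<in> H \<Longrightarrow> f \<noteq> 0 \<Longrightarrow> Re (ip f f) > 0"
    and complete: "(\<And>n::nat. X n \<in> H) \<Longrightarrow>
      (\<And>e. e > 0 \<Longrightarrow> \<exists>N. \<forall>p\<ge>N. \<forall>q\<ge>N. hnorm ip (X p - X q) < e) \<Longrightarrow>
      \<exists>f\<in>H. (\<lambda>n. hnorm ip (X n - f)) \<longlonglongrightarrow> 0"
begin

abbreviation nrm :: "'v \<Rightarrow> real" where "nrm \<equiv> hnorm ip"

lemma scl_zero_left [simp]: "scl 0 x = 0"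
  using scl_add_left[of 0 0 x] by simp

lemma scl_zero_right [simp]: "scl c 0 = 0"
  using scl_add_right[of c 0 0] by simp

lemma scl_minus_one: "scl (-1) x = - x"
proof -
  have "scl (-1) x + scl 1 x = scl (-1 + 1) x" by (simp only: scl_add_left)
  then show ?thesis by (simp add: eq_neg_iff_add_eq_0)
qed

lemma scl_minus_right: "scl c (- x) = - scl c x"
  by (metis mult.commute scl_minus_one scl_scl)

lemma scl_diff_right: "scl c (x - y) = scl c x - scl c y"
  using scl_add_right[of c x "- y"] by (simp add: scl_minus_right)

lemma minus_mem: "f \<in> H \<Longrightarrow> - f \<in> H"
  using scl_mem[of f "-1"] by (simp add: scl_minus_one)

lemma diff_mem: "f \<in> H \<Longrightarrow> g \<in> H \<Longrightarrow> f - g \<in> H"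
  using add_mem[of f "- g"] by (simp add: minus_mem)

lemma sum_mem: "(\<And>i. i \<in> I \<Longrightarrow> f i \<in> H) \<Longrightarrow> (\<Sum>i\<in>I. f i) \<in> H"
  by (induction I rule: infinite_finite_induct) (auto simp: add_mem)

lemmas mems = zero_mem add_mem scl_mem minus_mem diff_mem sum_mem

lemma ip_zero_left [simp]: "g \<in> H \<Longrightarrow> ip 0 g = 0"
  using ip_add_left[of 0 0 g] by simp

lemma ip_zero_right [simp]: "g \<in> H \<Longrightarrow> ip g 0 = 0"
  using ip_cnj[of 0 g] by simp

lemma ip_minus_left: "f \<in> H \<Longrightarrow> g \<in> H \<Longrightarrow> ip (- f) g = - ip f g"
  using ip_scl_left[of f g "-1"] by (simp add: scl_minus_one)

lemma ip_diff_left: "f \<in> H \<Longrightarrow> g \<in> H \<Longrightarrow> h \<in> H \<Longrightarrow> ip (f - g) h = ip f h - ip g h"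
  using ip_add_left[of f "- g" h] by (simp add: minus_mem ip_minus_left)

lemma ip_add_right: "f \<in> H \<Longrightarrow> g \<in> H \<Longrightarrow> h \<in> H \<Longrightarrow> ip h (f + g) = ip h f + ip h g"
  by (metis add_mem complex_cnj_add ip_add_left ip_cnj)

lemma ip_scl_right: "f \<in> H \<Longrightarrow> g \<in> H \<Longrightarrow> ip f (scl c g) = cnj c * ip f g"
  by (metis complex_cnj_mult ip_cnj ip_scl_left scl_mem)

lemma ip_minus_right: "f \<in> H \<Longrightarrow> g \<in> H \<Longrightarrow> ip f (- g) = - ip f g"
  using ip_scl_right[of f g "-1"] by (simp add: scl_minus_one)

lemma ip_diff_right: "f \<in> H \<Longrightarrow> g \<in> H \<Longrightarrow> h \<in> H \<Longrightarrow> ip h (f - g) = ip h f - ip h g"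
  using ip_add_right[of f "- g" h] by (simp add: minus_mem ip_minus_right)

lemma ip_sum_left: "(\<And>i. i \<in> I \<Longrightarrow> f i \<in> H) \<Longrightarrow> g \<in> H \<Longrightarrow> ip (\<Sum>i\<in>I. f i) g = (\<Sum>i\<in>I. ip (f i) g)"
  by (induction I rule: infinite_finite_induct) (auto simp: ip_add_left mems)

lemma ip_sum_right: "(\<And>i. i \<in> I \<Longrightarrow> f i \<in> H) \<Longrightarrow> g \<in> H \<Longrightarrow> ip g (\<Sum>i\<in>I. f i) = (\<Sum>i\<in>I. ip g (f i))"
  by (induction I rule: infinite_finite_induct) (auto simp: ip_add_right mems)

lemmas ip_simps = ip_add_left ip_add_right ip_scl_left ip_scl_right ip_minus_left ip_minus_right
  ip_diff_left ip_diff_right ip_sum_left ip_sum_right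

lemma Re_ip_self_ge0: "f \<in> H \<Longrightarrow> Re (ip f f) \<ge> 0"
  using ip_pos[of f] by (cases "f = 0") auto

lemma nrm_ge0 [simp]: "f \<in> H \<Longrightarrow> nrm f \<ge> 0"
  by (simp add: hnorm_def Re_ip_self_ge0)

lemma nrm_sq: "f \<in> H \<Longrightarrow> (nrm f)\<^sup>2 = Re (ip f f)"
  by (simp add: hnorm_def Re_ip_self_ge0)

lemma ip_self: "f \<in> H \<Longrightarrow> ip f f = of_real ((nrm f)\<^sup>2)"
proof -
  assume f: "f \<in> H"
  have "ip f f = cnj (ip f f)" using ip_cnj[OF f f] .
  then have "Im (ip f f) = 0" by (simp add: complex_eq_iff)
  then show ?thesis using nrm_sq[OF f] by (simp add: complex_eq_iff)
qed

lemma nrm_zero [simp]: "nrm 0 = 0"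
  by (simp add: hnorm_def)

lemma nrm_eq0: "f \<in> H \<Longrightarrow> nrm f = 0 \<longleftrightarrow> f = 0"
  using ip_pos[of f] by (cases "f = 0") (auto simp: hnorm_def)

lemma nrm_scl: "f \<in> H \<Longrightarrow> nrm (scl c f) = cmod c * nrm f"
proof -
  assume f: "f \<in> H"
  have "(nrm (scl c f))\<^sup>2 = Re (c * cnj c * ip f f)"
    using f by (simp only: nrm_sq ip_scl_left ip_scl_right scl_mem mult.assoc mult.left_commute)
  also have "\<dots> = (cmod c * nrm f)\<^sup>2"
    unfolding ip_self[OF f] complex_norm_square[symmetric] of_real_mult[symmetric] Re_complex_of_real
    by (simp add: power_mult_distrib)
  finally show ?thesis using f by (simp add: scl_mem power2_eq_iff_nonneg)
qed

lemma nrm_minus: "f \<in> H \<Longrightarrow> nrm (- f) = nrm f"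
  using nrm_scl[of f "-1"] by (simp add: scl_minus_one)

lemma nrm_minus_commute: "f \<in> H \<Longrightarrow> g \<in> H \<Longrightarrow> nrm (f - g) = nrm (g - f)"
  using nrm_minus[of "f - g"] by (simp add: mems)

lemma nrm_sq_add: "f \<in> H \<Longrightarrow> g \<in> H \<Longrightarrow> (nrm (f + g))\<^sup>2 = (nrm f)\<^sup>2 + (nrm g)\<^sup>2 + 2 * Re (ip f g)"
  using ip_cnj[of f g] by (simp add: nrm_sq ip_simps mems)

lemma nrm_sq_diff: "f \<in> H \<Longrightarrow> g \<in> H \<Longrightarrow> (nrm (f - g))\<^sup>2 = (nrm f)\<^sup>2 + (nrm g)\<^sup>2 - 2 * Re (ip f g)"
  using ip_cnj[of f g] by (simp add: nrm_sq ip_simps mems)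

lemma cauchy_schwarz: assumes f: "f \<in> H" and g: "g \<in> H" shows "cmod (ip f g) \<le> nrm f * nrm g"
proof (cases "g = 0")
  case True then show ?thesis using f by simp
next
  case False
  then have pos: "nrm g > 0" using g nrm_eq0[OF g] nrm_ge0[OF g] by linarith
  define c where "c = ip f g / of_real ((nrm g)\<^sup>2)"
  have "0 \<le> (nrm (f - scl c g))\<^sup>2" by simp
  also have "\<dots> = (nrm f)\<^sup>2 + (cmod c * nrm g)\<^sup>2 - 2 * Re (cnj c * ip f g)"
    using f g by (simp add: nrm_sq_diff mems nrm_scl ip_simps)
  also have "cnj c * ip f g = of_real ((cmod (ip f g))\<^sup>2 / (nrm g)\<^sup>2)"
    unfolding c_def of_real_divide complex_norm_square by (simp add: mult.commute)
  also have "cmod c * nrm g = cmod (ip f g) / nrm g"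
    using pos unfolding c_def norm_divide norm_of_real by (simp add: power2_eq_square)
  finally have "(cmod (ip f g))\<^sup>2 / (nrm g)\<^sup>2 \<le> (nrm f)\<^sup>2"
    by (simp add: power_divide)
  then have "(cmod (ip f g))\<^sup>2 \<le> (nrm f * nrm g)\<^sup>2"
    using pos by (simp add: field_simps power_mult_distrib)
  then show ?thesis by (rule power2_le_imp_le) (use f g in simp)
qed

lemma nrm_triangle: assumes f: "f \<in> H" and g: "g \<in> H" shows "nrm (f + g) \<le> nrm f + nrm g"
proof -
  have "Re (ip f g) \<le> nrm f * nrm g"
    using cauchy_schwarz[OF f g] complex_Re_le_cmod order_trans by blast
  then have "(nrm (f + g))\<^sup>2 \<le> (nrm f + nrm g)\<^sup>2"
    using f g by (simp add: nrm_sq_add power2_sum)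
  then show ?thesis by (rule power2_le_imp_le) (use f g in simp)
qed

lemma nrm_triangle_diff: "f \<in> H \<Longrightarrow> g \<in> H \<Longrightarrow> nrm (f - g) \<le> nrm f + nrm g"
  using nrm_triangle[of f "- g"] by (simp add: minus_mem nrm_minus)

lemma nrm_triangle3: "f \<in> H \<Longrightarrow> g \<in> H \<Longrightarrow> h \<in> H \<Longrightarrow> nrm (f - h) \<le> nrm (f - g) + nrm (g - h)"
  using nrm_triangle[of "f - g" "g - h"] by (simp add: diff_mem)

lemma nrm_leI: assumes f: "f \<in> H" and C: "0 \<le> C" and le: "\<And>g. g \<in> H \<Longrightarrow> cmod (ip g f) \<le> C * nrm g"
  shows "nrm f \<le> C"
proof (cases "nrm f = 0")
  case False
  then have "nrm f > 0" using nrm_ge0[OF f] by linarith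
  moreover have "nrm f * nrm f \<le> C * nrm f"
    using le[OF f] by (simp add: ip_self[OF f] norm_mult power2_eq_square)
  ultimately show ?thesis by simp
qed (use C in simp)

lemma eq_if_ip_eq: assumes f: "f \<in> H" and g: "g \<in> H" and eq: "\<And>h. h \<in> H \<Longrightarrow> ip h f = ip h g"
  shows "f = g"
proof -
  have "ip (f - g) (f - g) = 0"
    using eq[of "f - g"] f g by (simp add: ip_diff_right mems)
  then show ?thesis using ip_pos[of "f - g"] f g by (auto simp: diff_mem)
qed

lemma ip_tendsto:
  assumes X: "\<And>n::nat. X n \<in> H" and f: "f \<in> H" and g: "g \<in> H"
    and lim: "(\<lambda>n. nrm (X n - f)) \<longlonglongrightarrow> 0"
  shows "(\<lambda>n. ip (X n) g) \<longlonglongrightarrow> ip f g"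
proof -
  have "(\<lambda>n. ip (X n) g - ip f g) \<longlonglongrightarrow> 0"
  proof (rule Lim_null_comparison)
    show "\<forall>\<^sub>F n in sequentially. norm (ip (X n) g - ip f g) \<le> nrm (X n - f) * nrm g"
      using cauchy_schwarz[OF diff_mem[OF X f] g] X f g by (simp add: ip_diff_left)
    show "(\<lambda>n. nrm (X n - f) * nrm g) \<longlonglongrightarrow> 0"
      using tendsto_mult_left_zero[OF lim] by simp
  qed
  then show ?thesis by (simp add: LIM_zero_iff)
qed

lemma nrm_lim_unique:
  assumes X: "\<And>n::nat. X n \<in> H" and f: "f \<in> H" and g: "g \<in> H"
    and "(\<lambda>n. nrm (X n - f)) \<longlonglongrightarrow> 0" "(\<lambda>n. nrm (X n - g)) \<longlonglongrightarrow> 0"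
  shows "f = g"
proof (rule eq_if_ip_eq[OF f g])
  fix h assume h: "h \<in> H"
  have "ip f h = ip g h" 
    using LIMSEQ_unique[OF ip_tendsto[of X, OF X f h] ip_tendsto[of X, OF X g h]] assms by blast
  then show "ip h f = ip h g" using ip_cnj f g h by metis
qed

lemma cauchyI_of_tendsto:
  assumes X: "\<And>n::nat. X n \<in> H" and f: "f \<in> H" and lim: "(\<lambda>n. nrm (X n - f)) \<longlonglongrightarrow> 0" and e: "e > 0"
  shows "\<exists>N. \<forall>p\<ge>N. \<forall>q\<ge>N. nrm (X p - X q) < e"
proof -
  from lim e obtain N where N: "\<And>n. n \<ge> N \<Longrightarrow> nrm (X n - f) < e / 2"
    using LIMSEQ_D[OF lim, of "e/2"] by fastforce
  have "nrm (X p - X q) < e" if "p \<ge> N" "q \<ge> N" for p q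
    using nrm_triangle3[OF X f X, of p q] N[OF that(1)] N[OF that(2)] nrm_minus_commute[OF X f, of q]
    by linarith
  then show ?thesis by blast
qed

section \<open>Closed subspaces, orthogonal projection, Riesz representation and uniform
  boundedness\<close>

definition closed_subspace :: "'v set \<Rightarrow> bool" where
  "closed_subspace S \<longleftrightarrow> S \<subseteq> H \<and> 0 \<in> S \<and> (\<forall>x\<in>S. \<forall>y\<in>S. x + y \<in> S) \<and> (\<forall>c. \<forall>x\<in>S. scl c x \<in> S) \<and>
     hclosed H ip S"

lemma hilbert_closed_subspace: assumes "closed_subspace S" shows "hilbert scl S ip"
proof
  have SH: "x \<in> S \<Longrightarrow> x \<in> H" for x using assms by (auto simp: closed_subspace_def)
  fix X assume X: "\<And>n::nat. X n \<in> S" and C: "\<And>e. e > 0 \<Longrightarrow> \<exists>N. \<forall>p\<ge>N. \<forall>q\<ge>N. hnorm ip (X p - X q) < e"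
  obtain f where "f \<in> H" "(\<lambda>n. nrm (X n - f)) \<longlonglongrightarrow> 0" using complete[of X] SH X C by blast
  moreover then have "f \<in> S" using assms X unfolding closed_subspace_def hclosed_def by blast
  ultimately show "\<exists>f\<in>S. (\<lambda>n. nrm (X n - f)) \<longlonglongrightarrow> 0" by blast
qed (use assms in \<open>auto simp: closed_subspace_def scl_add_left scl_add_right subset_iff
       intro: ip_cnj ip_pos ip_add_left ip_scl_left\<close>)

definition orth :: "'v set \<Rightarrow> 'v set" where
  "orth S = {x\<in>H. \<forall>s\<in>S. ip x s = 0}"

lemma closed_subspace_orth: assumes "S \<subseteq> H" shows "closed_subspace (orth S)"
  unfolding closed_subspace_def hclosed_def
proof (intro conjI allI impI ballI)
  fix X y assume *: "(\<forall>n. X n \<in> orth S) \<and> y \<in> H \<and> (\<lambda>n. nrm (X n - y)) \<longlonglongrightarrow> 0"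
  have "ip y s = 0" if "s \<in> S" for s
  proof -
    have "(\<lambda>n. ip (X n) s) \<longlonglongrightarrow> ip y s"
      using * that assms by (intro ip_tendsto) (auto simp: orth_def)
    moreover have "ip (X n) s = 0" for n using * that by (auto simp: orth_def)
    ultimately show ?thesis by (simp add: LIMSEQ_const_iff)
  qed
  then show "y \<in> orth S" using * by (simp add: orth_def)
qed (use assms in \<open>auto simp: orth_def ip_simps mems subset_iff\<close>)

text \<open>The parallelogram identity makes a minimizing sequence Cauchy, so the distance from
  \<open>x\<close> to \<open>S\<close> is attained at some \<open>p\<close>; a nonzero inner product
  of \<open>x - p\<close> with some \<open>s\<close> in \<open>S\<close> would allow a shorter
  distance along \<open>s\<close>.\<close>

theorem projection:
  assumes S: "closed_subspace S" and x: "x \<in> H"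
  obtains p where "p \<in> S" "\<And>s. s \<in> S \<Longrightarrow> ip (x - p) s = 0"
proof -
  have SH: "s \<in> S \<Longrightarrow> s \<in> H" for s using S by (auto simp: closed_subspace_def)
  have S0: "0 \<in> S" and Sadd: "s \<in> S \<Longrightarrow> t \<in> S \<Longrightarrow> s + t \<in> S" and Sscl: "s \<in> S \<Longrightarrow> scl c s \<in> S"
    for s t c using S by (auto simp: closed_subspace_def)
  define N where "N = (\<lambda>s. (nrm (x - s))\<^sup>2) ` S"
  define d where "d = Inf N"
  have ne: "N \<noteq> {}" and bdd: "bdd_below N"
    using S0 by (auto simp: N_def intro!: bdd_belowI[of _ 0])
  have dle: "d \<le> (nrm (x - s))\<^sup>2" if "s \<in> S" for s
    unfolding d_def using that bdd by (intro cInf_lower) (auto simp: N_def)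
  have "\<exists>s\<in>S. (nrm (x - s))\<^sup>2 < d + inverse (real (Suc n))" for n
    using cInf_lessD[OF ne, of "d + inverse (real (Suc n))"] by (auto simp: d_def N_def)
  then obtain X where X: "\<And>n. X n \<in> S" and Xd: "\<And>n. (nrm (x - X n))\<^sup>2 < d + inverse (real (Suc n))"
    by metis
  have par: "(nrm (X p - X q))\<^sup>2 \<le> 2 * inverse (real (Suc p)) + 2 * inverse (real (Suc q))" for p q
  proof -
    define u v where "u = x - X p" and "v = x - X q"
    have uv: "u \<in> H" "v \<in> H" using x X SH by (auto simp: u_def v_def diff_mem)
    \<comment> \<open>The midpoint of \<open>X p\<close> and \<open>X q\<close> is again in
      \<open>S\<close>, so its distance to \<open>x\<close> is at least the infimum; the
      parallelogram identity turns this lower bound on \<open>u + v\<close> into an upper bound on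
      \<open>u - v\<close>.\<close>
    define m where "m = scl (1/2) (X p + X q)"
    have m: "m \<in> S" by (simp add: m_def Sadd Sscl X)
    have "u + v = scl 2 (x - m)"
    proof -
      have "scl 2 x = x + x" using scl_add_left[of 1 1 x] by simp
      then show ?thesis by (simp add: scl_diff_right m_def u_def v_def)
    qed
    then have "(nrm (u + v))\<^sup>2 = 4 * (nrm (x - m))\<^sup>2"
      using x m SH by (simp add: nrm_scl diff_mem power_mult_distrib)
    then have "(nrm (u + v))\<^sup>2 \<ge> 4 * d" using dle[OF m] by simp
    moreover have "(nrm (u - v))\<^sup>2 + (nrm (u + v))\<^sup>2 = 2 * (nrm u)\<^sup>2 + 2 * (nrm v)\<^sup>2"
      using uv by (simp add: nrm_sq_add nrm_sq_diff)
    moreover have "u - v = X q - X p" by (simp add: u_def v_def)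
    moreover have "nrm (X q - X p) = nrm (X p - X q)" by (simp add: nrm_minus_commute SH X)
    ultimately show ?thesis using Xd[of p] Xd[of q] by (simp add: u_def v_def)
  qed
  have "\<exists>p\<in>H. (\<lambda>n. nrm (X n - p)) \<longlonglongrightarrow> 0"
  proof (rule complete)
    fix e :: real assume e: "e > 0"
    obtain N where N: "inverse (real (Suc N)) < e\<^sup>2 / 4" using reals_Archimedean[of "e\<^sup>2/4"] e by auto
    have "nrm (X p - X q) < e" if "p \<ge> N" "q \<ge> N" for p q
    proof -
      have "inverse (real (Suc p)) \<le> inverse (real (Suc N))" "inverse (real (Suc q)) \<le> inverse (real (Suc N))"
        using that by (auto intro!: le_imp_inverse_le)
      then have "(nrm (X p - X q))\<^sup>2 < e\<^sup>2" using par[of p q] N by linarith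
      then show ?thesis by (rule power2_less_imp_less) (use e in simp)
    qed
    then show "\<exists>N. \<forall>p\<ge>N. \<forall>q\<ge>N. nrm (X p - X q) < e" by blast
  qed (simp add: SH X)
  then obtain p where p: "p \<in> H" and lim: "(\<lambda>n. nrm (X n - p)) \<longlonglongrightarrow> 0" by blast
  have pS: "p \<in> S" using S p lim X unfolding closed_subspace_def hclosed_def by blast
  have "(nrm (x - p))\<^sup>2 \<le> d"
  proof -
    have "nrm (x - p) \<le> sqrt (d + inverse (real (Suc n))) + nrm (X n - p)" for n
    proof -
      have "nrm (x - X n) \<le> sqrt (d + inverse (real (Suc n)))"
        using Xd[of n] by (intro real_le_rsqrt) simp
      then show ?thesis using nrm_triangle3[OF x SH[OF X[of n]] p] by linarith
    qed
    moreover have "(\<lambda>n. sqrt (d + inverse (real (Suc n))) + nrm (X n - p)) \<longlonglongrightarrow> sqrt (d + 0) + 0"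
      by (intro tendsto_intros lim LIMSEQ_inverse_real_of_nat)
    ultimately have "nrm (x - p) \<le> sqrt d" by (intro LIMSEQ_le_const[of _ "sqrt d"]) auto
    moreover have "0 \<le> d" unfolding d_def using ne by (intro cInf_greatest) (auto simp: N_def)
    ultimately show ?thesis
      by (metis nrm_ge0 diff_mem p x power2_le_iff_abs_le real_sqrt_ge_zero abs_of_nonneg real_sqrt_pow2)
  qed
  have "ip (x - p) s = 0" if s: "s \<in> S" for s
  proof (cases "s = 0")
    case True then show ?thesis using x p by (simp add: diff_mem)
  next
    case False
    define u where "u = x - p"
    have u: "u \<in> H" using x p by (simp add: u_def diff_mem)
    have sH: "s \<in> H" by (rule SH[OF s])
    have pos: "nrm s > 0" using False nrm_eq0[OF sH] nrm_ge0[OF sH] by linarith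
    \<comment> \<open>The coefficient that minimizes the distance from \<open>u\<close> to the line
      through \<open>s\<close>; the gain in the squared distance is the squared modulus of
      \<open>ip u s\<close> over the squared norm of \<open>s\<close>.\<close>
    define t where "t = ip u s / of_real ((nrm s)\<^sup>2)"
    have "p + scl t s \<in> S" by (simp add: Sadd Sscl pS s)
    from dle[OF this] have "d \<le> (nrm (u - scl t s))\<^sup>2" by (simp add: u_def diff_diff_eq)
    also have "\<dots> = (nrm u)\<^sup>2 + (cmod t * nrm s)\<^sup>2 - 2 * Re (cnj t * ip u s)"
      using u sH by (simp add: nrm_sq_diff mems nrm_scl ip_simps)
    also have "cnj t * ip u s = of_real ((cmod (ip u s))\<^sup>2 / (nrm s)\<^sup>2)"
      unfolding t_def of_real_divide complex_norm_square by (simp add: mult.commute)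
    also have "cmod t * nrm s = cmod (ip u s) / nrm s"
      using pos unfolding t_def norm_divide norm_of_real by (simp add: power2_eq_square)
    finally have "(cmod (ip u s))\<^sup>2 / (nrm s)\<^sup>2 \<le> 0"
      using \<open>(nrm (x - p))\<^sup>2 \<le> d\<close> by (simp add: u_def power_divide)
    then have "ip u s = 0" using pos by (simp add: divide_le_0_iff)
    then show ?thesis by (simp add: u_def)
  qed
  with pS show ?thesis using that by blast
qed

text \<open>The bound makes the kernel of \<phi> closed. A vector \<open>n\<close> orthogonal to it
  spans the rest: subtracting a suitable multiple of \<open>n\<close> from \<open>f\<close> lands in
  the kernel, so a multiple of \<open>n\<close> represents \<phi>.\<close>

theorem riesz:
  assumes add: "\<And>f g. f \<in> H \<Longrightarrow> g \<in> H \<Longrightarrow> \<phi> (f + g) = \<phi> f + \<phi> g"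
    and sc: "\<And>c f. f \<in> H \<Longrightarrow> \<phi> (scl c f) = c * \<phi> f"
    and bd: "\<And>f. f \<in> H \<Longrightarrow> cmod (\<phi> f) \<le> C * nrm f"
  obtains p where "p \<in> H" "\<And>f. f \<in> H \<Longrightarrow> \<phi> f = ip f p"
proof (cases "\<forall>f\<in>H. \<phi> f = 0")
  case True
  then show ?thesis by (intro that[of 0]) auto
next
  case False
  then obtain x where x: "x \<in> H" "\<phi> x \<noteq> 0" by blast
  define S where "S = {f\<in>H. \<phi> f = 0}"
  have diff: "\<phi> (f - g) = \<phi> f - \<phi> g" if "f \<in> H" "g \<in> H" for f g
    using add[of f "- g"] sc[of g "-1"] that by (simp add: minus_mem scl_minus_one)
  have z: "\<phi> 0 = 0" using sc[of 0 0] by simp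
  have "closed_subspace S"
    unfolding closed_subspace_def hclosed_def
  proof (intro conjI allI impI ballI)
    fix X y assume *: "(\<forall>n. X n \<in> S) \<and> y \<in> H \<and> (\<lambda>n. nrm (X n - y)) \<longlonglongrightarrow> 0"
    have "cmod (\<phi> y) \<le> C * nrm (X n - y)" for n
      using * bd[of "X n - y"] diff[of "X n" y] by (auto simp: S_def diff_mem)
    moreover have "(\<lambda>n. C * nrm (X n - y)) \<longlonglongrightarrow> C * 0" using * by (intro tendsto_intros) auto
    ultimately have "cmod (\<phi> y) \<le> 0" by (intro LIMSEQ_le_const[of "\<lambda>n. C * nrm (X n - y)"]) auto
    then show "y \<in> S" using * by (simp add: S_def)
  qed (auto simp: S_def mems add sc z)
  then obtain q where q: "q \<in> S" "\<And>s. s \<in> S \<Longrightarrow> ip (x - q) s = 0"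
    using projection x(1) by blast
  define n where "n = x - q"
  have qH: "q \<in> H" and n: "n \<in> H" using q x by (auto simp: n_def S_def diff_mem)
  have fn: "\<phi> n = \<phi> x" using q x by (simp add: n_def diff qH S_def)
  then have "n \<noteq> 0" using x z by auto
  then have pos: "nrm n > 0" using nrm_eq0[OF n] nrm_ge0[OF n] by linarith
  show ?thesis
  proof (rule that)
    show "scl (cnj (\<phi> n) / of_real ((nrm n)\<^sup>2)) n \<in> H" by (simp add: n scl_mem)
    fix f assume f: "f \<in> H"
    have "f - scl (\<phi> f / \<phi> n) n \<in> S"
      using f n x fn by (simp add: S_def mems diff sc)
    then have "ip n (f - scl (\<phi> f / \<phi> n) n) = 0" using q(2) by (simp add: n_def)
    then have "ip (f - scl (\<phi> f / \<phi> n) n) n = 0" using ip_cnj[of n "f - scl (\<phi> f / \<phi> n) n"] n f by (simp add: mems)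
    then have "ip f n = \<phi> f / \<phi> n * of_real ((nrm n)\<^sup>2)"
      using f n by (simp add: ip_simps mems ip_self)
    then show "\<phi> f = ip f (scl (cnj (\<phi> n) / of_real ((nrm n)\<^sup>2)) n)"
      using f n fn x pos by (simp add: ip_simps)
  qed
qed

text \<open>Sokal's proof: a unit step in the direction of a vector of large norm, taken with the right
  sign, makes the corresponding functional large; the steps shrink fast enough to converge.\<close>

theorem uniform_boundedness:
  assumes U: "U \<subseteq> H" and pw: "\<And>f. f \<in> H \<Longrightarrow> \<exists>c. \<forall>u\<in>U. cmod (ip f u) \<le> c"
  shows "\<exists>C\<ge>0. \<forall>u\<in>U. nrm u \<le> C"
proof (rule ccontr)
  assume neg: "\<not> ?thesis"
  \<comment> \<open>Norms above 4^n against steps of length 3^-n: the steps after step n have total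
    length at most half of 3^-n, so \<open>x\<close> keeps half of the gain made against
    \<open>u n\<close>, which is at least (4/3)^n / 2 and unbounded.\<close>
  have "\<exists>u\<in>U. nrm u > 4 ^ n" for n :: nat
    using neg by (meson linorder_not_less zero_le_numeral zero_le_power)
  then obtain u where uU: "\<And>n. u n \<in> U" and un: "\<And>n::nat. nrm (u n) > 4 ^ n" by metis
  have u: "u n \<in> H" for n using uU U by blast
  have upos: "nrm (u n) > 0" for n using un[of n] by (smt (verit) zero_less_power)
  define \<xi> where "\<xi> n = scl (of_real ((1/3) ^ n / nrm (u n))) (u n)" for n
  have \<xi>: "\<xi> n \<in> H" for n by (simp add: \<xi>_def u scl_mem)
  have n\<xi>: "nrm (\<xi> n) = (1/3) ^ n" for n
    using upos[of n] by (simp add: \<xi>_def nrm_scl u norm_divide norm_power)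
  have ip\<xi>: "ip (\<xi> n) (u n) = of_real ((1/3) ^ n * nrm (u n))" for n
    using upos[of n] by (simp add: \<xi>_def ip_simps u ip_self power2_eq_square)
  define step where "step n x = (if cmod (ip (x + \<xi> n) (u n)) \<ge> cmod (ip (x - \<xi> n) (u n)) then x + \<xi> n else x - \<xi> n)" for n x
  define X where "X = rec_nat 0 step"
  have X0: "X 0 = 0" and XS: "X (Suc n) = step n (X n)" for n by (auto simp: X_def)
  have X: "X n \<in> H" for n by (induction n) (auto simp: X0 XS step_def mems \<xi>)
  have big: "cmod (ip (X (Suc n)) (u n)) \<ge> (1/3) ^ n * nrm (u n)" for n
  proof -
    define a b where "a = ip (X n) (u n)" and "b = ip (\<xi> n) (u n)"
    have "2 * cmod b \<le> cmod (a + b) + cmod (a - b)"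
      using norm_triangle_ineq4[of "a + b" "a - b"] by (simp flip: mult_2 add: norm_mult)
    moreover have "cmod (ip (X (Suc n)) (u n)) = max (cmod (a + b)) (cmod (a - b))"
      by (auto simp: XS step_def a_def b_def ip_simps X \<xi> u)
    moreover have "cmod b = (1/3) ^ n * nrm (u n)"
      using upos[of n] by (simp add: b_def ip\<xi> norm_mult norm_power norm_divide)
    ultimately show ?thesis by linarith
  qed
  have dist1: "nrm (X (Suc n) - X n) = (1/3) ^ n" for n
    using nrm_minus[OF \<xi>[of n]] by (auto simp: XS step_def n\<xi>)
  have dist: "nrm (X (n + k) - X n) \<le> 3/2 * (1/3) ^ n * (1 - (1/3)^k)" for n k
  proof (induction k)
    case (Suc k)
    have "nrm (X (n + Suc k) - X n) \<le> nrm (X (Suc (n+k)) - X (n+k)) + nrm (X (n+k) - X n)"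
      using nrm_triangle3[OF X X X] by simp
    then show ?case using Suc by (simp add: dist1 power_add algebra_simps)
  qed simp
  have distle: "nrm (X (n + k) - X n) \<le> 3/2 * (1/3) ^ n" for n k
  proof -
    have "3/2 * (1/3) ^ n * (1 - (1/3)^k) \<le> 3/2 * (1/3::real) ^ n * 1"
      by (intro mult_left_mono) auto
    then show ?thesis using dist[of n k] by linarith
  qed
  have "\<exists>x\<in>H. (\<lambda>n. nrm (X n - x)) \<longlonglongrightarrow> 0"
  proof (rule complete[OF X])
    fix e :: real assume e: "e > 0"
    obtain N where N: "(1/3) ^ N < e / 3" using real_arch_pow_inv[of "e/3" "1/3"] e by auto
    have "nrm (X p - X q) < e" if "p \<ge> N" "q \<ge> N" for p q
      using distle[of N "p - N"] distle[of N "q - N"] that N nrm_triangle3[of "X p" "X N" "X q"] X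
        nrm_minus_commute[OF X X, of N q] by simp
    then show "\<exists>N. \<forall>p\<ge>N. \<forall>q\<ge>N. nrm (X p - X q) < e" by blast
  qed
  then obtain x where x: "x \<in> H" and lim: "(\<lambda>n. nrm (X n - x)) \<longlonglongrightarrow> 0" by blast
  have xd: "nrm (x - X n) \<le> 3/2 * (1/3) ^ n" for n
  proof -
    have "nrm (x - X n) \<le> nrm (X (k + n) - x) + 3/2 * (1/3) ^ n" for k
      using nrm_triangle3[of x "X (k + n)" "X n"] x X distle[of n k] nrm_minus_commute[OF x X, of "k + n"]
      by (simp add: add.commute)
    moreover have "(\<lambda>k. nrm (X (k + n) - x) + 3/2 * (1/3) ^ n) \<longlonglongrightarrow> 0 + 3/2 * (1/3) ^ n"
      by (intro tendsto_intros LIMSEQ_ignore_initial_segment lim)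
    ultimately show ?thesis by (intro LIMSEQ_le_const[of _ "3/2 * (1/3) ^ n"]) auto
  qed
  obtain c where c: "\<And>n. cmod (ip x (u n)) \<le> c" using pw[OF x] uU by blast
  have cge: "c \<ge> 1/2 * (4/3) ^ n" for n
  proof -
    define b where "b = (1/3) ^ n * nrm (u n)"
    have le: "cmod (ip (x - X (Suc n)) (u n)) \<le> 1/2 * b"
    proof -
      have "nrm (x - X (Suc n)) * nrm (u n) \<le> (1/2 * (1/3) ^ n) * nrm (u n)"
        using xd[of "Suc n"] upos[of n] by (intro mult_right_mono) auto
      then have "nrm (x - X (Suc n)) * nrm (u n) \<le> 1/2 * b" by (simp add: b_def)
      then show ?thesis using cauchy_schwarz[OF diff_mem[OF x X[of "Suc n"]] u[of n]] by linarith
    qed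
    have "ip (x - X (Suc n)) (u n) = ip x (u n) - ip (X (Suc n)) (u n)"
      by (simp add: ip_simps x X u)
    with le have "cmod (ip x (u n) - ip (X (Suc n)) (u n)) \<le> 1/2 * b" by simp
    moreover have "cmod (ip (X (Suc n)) (u n)) \<le> cmod (ip x (u n)) + cmod (ip x (u n) - ip (X (Suc n)) (u n))"
      by (metis norm_triangle_sub norm_minus_commute)
    moreover have "b \<le> cmod (ip (X (Suc n)) (u n))" using big[of n] by (simp add: b_def)
    ultimately have "1/2 * b \<le> cmod (ip x (u n))" by linarith
    moreover have "b \<ge> (1/3) ^ n * 4 ^ n"
      using un[of n] unfolding b_def by (intro mult_left_mono) auto
    moreover have "(1/3) ^ n * 4 ^ n = (4/3::real) ^ n" by (simp flip: power_mult_distrib)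
    ultimately show ?thesis using c[of n] by linarith
  qed
  obtain n where "(4/3) ^ n > 2 * c" using real_arch_pow[of "4/3" "2*c"] by auto
  then show False using cge[of n] by linarith
qed

text \<open>The form in which the principle yields lower bounds for operators: with
  \<open>q u\<close> the norm of the image of \<open>u\<close>, estimates whose constants depend on
  \<open>f\<close> become a single inequality. The weight may vanish, so \<open>u\<close> is divided
  not by \<open>q u\<close> but by every positive \<open>r\<close> that is at least
  \<open>q u\<close>.\<close>

corollary uniform_boundedness_weighted:
  assumes q: "\<And>u. u \<in> H \<Longrightarrow> q u \<ge> 0" and pw: "\<And>f. f \<in> H \<Longrightarrow> \<exists>c\<ge>0. \<forall>u\<in>H. cmod (ip f u) \<le> c * q u"
  shows "\<exists>C\<ge>0. \<forall>u\<in>H. nrm u \<le> C * q u"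
proof -
  define U where "U = {scl (of_real (1 / r)) u |u r. u \<in> H \<and> r > 0 \<and> q u \<le> r}"
  have "\<exists>C\<ge>0. \<forall>u\<in>U. nrm u \<le> C"
  proof (rule uniform_boundedness)
    show "U \<subseteq> H" by (auto simp: U_def scl_mem)
    fix f assume f: "f \<in> H"
    from pw[OF f] obtain c where c: "c \<ge> 0" "\<And>u. u \<in> H \<Longrightarrow> cmod (ip f u) \<le> c * q u" by blast
    have "cmod (ip f v) \<le> c" if v: "v \<in> U" for v
    proof -
      from v obtain u r where u: "v = scl (of_real (1 / r)) u" "u \<in> H" "r > 0" "q u \<le> r" by (auto simp: U_def)
      have "cmod (ip f u) \<le> c * r" using c(2)[OF u(2)] mult_left_mono[OF u(4) c(1)] by linarith
      then show ?thesis using u f by (simp add: ip_scl_right norm_divide field_simps)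
    qed
    then show "\<exists>c. \<forall>u\<in>U. cmod (ip f u) \<le> c" by blast
  qed
  then obtain C where C: "C \<ge> 0" "\<And>u. u \<in> U \<Longrightarrow> nrm u \<le> C" by blast
  have "nrm u \<le> C * q u" if u: "u \<in> H" for u
  proof (rule field_le_epsilon)
    fix e :: real assume e: "e > 0"
    \<comment> \<open>A positive number just above \<open>q u\<close>; the denominator
      \<open>C + 1\<close> is positive even when \<open>C\<close> is zero.\<close>
    define r where "r = q u + e / (C + 1)"
    have r: "r > 0" "q u \<le> r" using q[OF u] e C(1) by (auto simp: r_def intro: add_nonneg_pos)
    then have "nrm (scl (of_real (1 / r)) u) \<le> C" using u by (intro C) (auto simp: U_def)
    then have "nrm u \<le> C * r" using r u by (simp add: nrm_scl norm_divide field_simps)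
    also have "\<dots> \<le> C * q u + e" using C(1) e by (simp add: r_def field_simps)
    finally show "nrm u \<le> C * q u + e" .
  qed
  with C(1) show ?thesis by blast
qed

end

section \<open>Operators bounded below and the closed range theorem\<close>

lemma hclosed_image:
  assumes S: "hilbert scl1 S ip1" and G: "hilbert scl2 G ip2"
    and TG: "\<And>x. x \<in> S \<Longrightarrow> T x \<in> G"
    and diff: "\<And>x y. x \<in> S \<Longrightarrow> y \<in> S \<Longrightarrow> T (x - y) = T x - T y"
    and up: "\<And>x. x \<in> S \<Longrightarrow> hnorm ip2 (T x) \<le> c * hnorm ip1 x"
    and low: "\<And>x. x \<in> S \<Longrightarrow> hnorm ip1 x \<le> C * hnorm ip2 (T x)"
  shows "hclosed G ip2 (T ` S)"
  unfolding hclosed_def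
proof (intro allI impI)
  interpret S: hilbert scl1 S ip1 by fact
  interpret G: hilbert scl2 G ip2 by fact
  fix X y assume *: "(\<forall>n. X n \<in> T ` S) \<and> y \<in> G \<and> (\<lambda>n. hnorm ip2 (X n - y)) \<longlonglongrightarrow> 0"
  then have "\<forall>n. \<exists>x. x \<in> S \<and> X n = T x" by blast
  then obtain x where x: "\<And>n. x n \<in> S" and Xx: "X = (\<lambda>n. T (x n))" by metis
  have lim: "(\<lambda>n. hnorm ip2 (T (x n) - y)) \<longlonglongrightarrow> 0" and y: "y \<in> G" using * Xx by auto
  have "\<exists>s\<in>S. (\<lambda>n. hnorm ip1 (x n - s)) \<longlonglongrightarrow> 0"
  proof (rule S.complete[OF x])
    fix e :: real assume e: "e > 0"
    define d where "d = e / (\<bar>C\<bar> + 1)"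
    have "d > 0" using e by (simp add: d_def)
    then obtain N where N: "\<And>p q. p \<ge> N \<Longrightarrow> q \<ge> N \<Longrightarrow> hnorm ip2 (T (x p) - T (x q)) < d"
      using G.cauchyI_of_tendsto[OF TG[OF x] y lim] by blast
    have "hnorm ip1 (x p - x q) < e" if "p \<ge> N" "q \<ge> N" for p q
    proof -
      have "hnorm ip1 (x p - x q) \<le> C * hnorm ip2 (T (x p) - T (x q))"
        using low[OF S.diff_mem[OF x x], of p q] by (simp add: diff x)
      also have "\<dots> \<le> (\<bar>C\<bar> + 1) * hnorm ip2 (T (x p) - T (x q))"
        by (intro mult_right_mono) (auto simp: TG x G.diff_mem)
      also have "\<dots> < (\<bar>C\<bar> + 1) * d" using N[OF that] by (intro mult_strict_left_mono) auto
      also have "\<dots> = e" by (simp add: d_def)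
      finally show ?thesis .
    qed
    then show "\<exists>N. \<forall>p\<ge>N. \<forall>q\<ge>N. hnorm ip1 (x p - x q) < e" by blast
  qed
  then obtain s where s: "s \<in> S" and lims: "(\<lambda>n. hnorm ip1 (x n - s)) \<longlonglongrightarrow> 0" by blast
  have "(\<lambda>n. hnorm ip2 (T (x n) - T s)) \<longlonglongrightarrow> 0"
  proof (rule Lim_null_comparison)
    show "(\<lambda>n. c * hnorm ip1 (x n - s)) \<longlonglongrightarrow> 0" using tendsto_mult_right_zero[OF lims] by simp
    show "\<forall>\<^sub>F n in sequentially. norm (hnorm ip2 (T (x n) - T s)) \<le> c * hnorm ip1 (x n - s)"
      using up[OF S.diff_mem[OF x s]] by (simp add: diff x s G.diff_mem TG)
  qed
  then have "y = T s" using G.nrm_lim_unique[OF TG[OF x] y TG[OF s] lim] by blast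
  then show "y \<in> T ` S" using s by blast
qed

text \<open>Vectors are determined by their inner products, so linearity of both maps and
  boundedness of \<open>D\<close> follow from the adjoint identity and the bound on
  \<open>A\<close>. In the application \<open>A\<close> is the row operator \<open>row w\<close> on
  tuples and \<open>D\<close> the tuple of adjoints \<open>D_mult_adj H ip w\<close>.\<close>

locale adjoint_pair = H: hilbert sclH H ipH + G: hilbert sclG G ipG
  for sclH :: "complex \<Rightarrow> 'v::ab_group_add \<Rightarrow> 'v" and H ipH
    and sclG :: "complex \<Rightarrow> 'w::ab_group_add \<Rightarrow> 'w" and G ipG +
  fixes A :: "'w \<Rightarrow> 'v" and D :: "'v \<Rightarrow> 'w" and c :: real
  assumes A_mem: "y \<in> G \<Longrightarrow> A y \<in> H"
    and D_mem: "x \<in> H \<Longrightarrow> D x \<in> G"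
    and adj: "y \<in> G \<Longrightarrow> x \<in> H \<Longrightarrow> ipH (A y) x = ipG y (D x)"
    and A_bound: "y \<in> G \<Longrightarrow> H.nrm (A y) \<le> c * G.nrm y"
begin

lemma adj': "y \<in> G \<Longrightarrow> x \<in> H \<Longrightarrow> ipH x (A y) = ipG (D x) y"
  using adj[of y x] H.ip_cnj[of "A y" x] G.ip_cnj[of y "D x"] by (simp add: A_mem D_mem)

lemma A_add: "y \<in> G \<Longrightarrow> z \<in> G \<Longrightarrow> A (y + z) = A y + A z"
  by (rule H.eq_if_ip_eq) (simp_all add: A_mem H.add_mem G.add_mem H.ip_add_right G.ip_add_right D_mem adj')

lemma A_scl: "y \<in> G \<Longrightarrow> A (sclG a y) = sclH a (A y)"
  by (rule H.eq_if_ip_eq) (simp_all add: A_mem H.scl_mem G.scl_mem H.ip_scl_right G.ip_scl_right D_mem adj')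

lemma D_add: "y \<in> H \<Longrightarrow> z \<in> H \<Longrightarrow> D (y + z) = D y + D z"
  by (rule G.eq_if_ip_eq) (simp_all add: A_mem H.add_mem G.add_mem H.ip_add_right G.ip_add_right D_mem flip: adj)

lemma D_scl: "y \<in> H \<Longrightarrow> D (sclH a y) = sclG a (D y)"
  by (rule G.eq_if_ip_eq) (simp_all add: A_mem H.scl_mem G.scl_mem H.ip_scl_right G.ip_scl_right D_mem flip: adj)

lemma A_diff: "y \<in> G \<Longrightarrow> z \<in> G \<Longrightarrow> A (y - z) = A y - A z"
  using A_add[of y "- z"] A_scl[of z "-1"] by (simp add: G.minus_mem H.scl_minus_one G.scl_minus_one)

lemma D_diff: "y \<in> H \<Longrightarrow> z \<in> H \<Longrightarrow> D (y - z) = D y - D z"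
  using D_add[of y "- z"] D_scl[of z "-1"] by (simp add: H.minus_mem H.scl_minus_one G.scl_minus_one)

lemma A_zero [simp]: "A 0 = 0" and D_zero [simp]: "D 0 = 0"
  using A_diff[of 0 0] D_diff[of 0 0] by auto

lemma D_bound: assumes x: "x \<in> H" shows "G.nrm (D x) \<le> \<bar>c\<bar> * H.nrm x"
proof (rule G.nrm_leI)
  fix y assume y: "y \<in> G"
  have "H.nrm (A y) \<le> \<bar>c\<bar> * G.nrm y"
    using A_bound[OF y] mult_right_mono[OF abs_ge_self G.nrm_ge0[OF y], of c] by (rule order_trans)
  then have 1: "H.nrm (A y) * H.nrm x \<le> (\<bar>c\<bar> * G.nrm y) * H.nrm x"
    using x by (intro mult_right_mono) auto
  have "cmod (ipG y (D x)) \<le> H.nrm (A y) * H.nrm x"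
    using H.cauchy_schwarz[OF A_mem[OF y] x] by (simp add: adj y x)
  also have "\<dots> \<le> (\<bar>c\<bar> * G.nrm y) * H.nrm x"
    by (rule 1)
  finally show "cmod (ipG y (D x)) \<le> \<bar>c\<bar> * H.nrm x * G.nrm y" by (simp add: ac_simps)
qed (use x in \<open>auto simp: D_mem\<close>)

text \<open>On the closed range of \<open>D\<close> the adjoint identity bounds the inner product of
  \<open>D x\<close> with \<open>u\<close> by a multiple of the norm of \<open>A u\<close>, so
  uniform boundedness bounds \<open>A\<close> from below there. Hence \<open>A\<close> maps that
  range onto a closed subspace, and the lower bound controls the norm of the solution.\<close>

lemma range_A_if_closed_range_D:
  assumes cl: "hclosed G ipG (D ` H)"
  shows "\<exists>C\<ge>0. \<forall>f\<in>H. (\<forall>x\<in>H. D x = 0 \<longrightarrow> ipH f x = 0) \<longrightarrow> (\<exists>y\<in>G. A y = f \<and> G.nrm y \<le> C * H.nrm f)"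
proof -
  define Y where "Y = D ` H"
  have "G.closed_subspace Y"
    unfolding G.closed_subspace_def
  proof (intro conjI ballI allI)
    show "0 \<in> Y" using D_zero unfolding Y_def by (metis H.zero_mem image_eqI)
    show "x + y \<in> Y" if "x \<in> Y" "y \<in> Y" for x y
      using that unfolding Y_def by (metis (no_types, lifting) D_add H.add_mem imageE imageI)
    show "sclG a x \<in> Y" if "x \<in> Y" for x a
      using that unfolding Y_def by (metis (no_types, lifting) D_scl H.scl_mem imageE imageI)
  qed (use cl in \<open>auto simp: Y_def D_mem\<close>)
  then interpret Y: hilbert sclG Y ipG by (rule G.hilbert_closed_subspace)
  have YG: "y \<in> Y \<Longrightarrow> y \<in> G" for y by (auto simp: Y_def D_mem)
  have "\<exists>C\<ge>0. \<forall>u\<in>Y. G.nrm u \<le> C * H.nrm (A u)"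
  proof (rule Y.uniform_boundedness_weighted)
    fix f assume "f \<in> Y"
    then obtain x where x: "x \<in> H" "f = D x" by (auto simp: Y_def)
    have "cmod (ipG f u) \<le> H.nrm x * H.nrm (A u)" if "u \<in> Y" for u
      using H.cauchy_schwarz[of x "A u"] x that by (simp add: YG A_mem adj')
    then show "\<exists>c\<ge>0. \<forall>u\<in>Y. cmod (ipG f u) \<le> c * H.nrm (A u)" using H.nrm_ge0[OF x(1)] by blast
  qed (simp add: A_mem YG)
  then obtain C where C: "C \<ge> 0" "\<And>u. u \<in> Y \<Longrightarrow> G.nrm u \<le> C * H.nrm (A u)" by blast
  have "H.closed_subspace (A ` Y)"
    unfolding H.closed_subspace_def
  proof (intro conjI ballI allI)
    show "hclosed H ipH (A ` Y)"
      by (rule hclosed_image[of sclG Y ipG sclH H ipH A c C])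
        (auto simp: Y.hilbert_axioms H.hilbert_axioms A_mem YG A_diff A_bound C)
    show "0 \<in> A ` Y" using A_zero by (metis Y.zero_mem image_eqI)
    show "x + y \<in> A ` Y" if "x \<in> A ` Y" "y \<in> A ` Y" for x y
      using that by (auto simp: YG Y.add_mem simp flip: A_add intro!: imageI)
    show "sclH a x \<in> A ` Y" if "x \<in> A ` Y" for x a
      using that by (auto simp: YG Y.scl_mem simp flip: A_scl intro!: imageI)
  qed (auto simp: A_mem YG)
  note AY = this
  have "\<exists>y\<in>G. A y = f \<and> G.nrm y \<le> C * H.nrm f"
    if f: "f \<in> H" and orth: "\<And>x. x \<in> H \<Longrightarrow> D x = 0 \<Longrightarrow> ipH f x = 0" for f
  proof -
    obtain p where p: "p \<in> A ` Y" "\<And>s. s \<in> A ` Y \<Longrightarrow> ipH (f - p) s = 0"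
      using H.projection[OF AY f] by blast
    then obtain y where y: "y \<in> Y" "p = A y" by blast
    \<comment> \<open>The part of \<open>f\<close> orthogonal to the image. Since \<open>D g\<close>
      lies in the range of \<open>D\<close>, the vector \<open>A (D g)\<close> is orthogonal to
      \<open>g\<close>, and so the squared norm of \<open>D g\<close> is zero; as \<open>f\<close>
      and \<open>p\<close> are both orthogonal to the kernel of \<open>D\<close>, the vector
      \<open>g\<close> is orthogonal to itself.\<close>
    define g where "g = f - p"
    have pH: "p \<in> H" and g: "g \<in> H" using y f by (auto simp: A_mem YG g_def H.diff_mem)
    have "D g \<in> Y" using g by (simp add: Y_def)
    then have "ipH g (A (D g)) = 0" using p(2)[of "A (D g)"] by (simp add: g_def)
    then have "ipG (D g) (D g) = 0" using g by (simp add: adj' D_mem)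
    then have D0: "D g = 0" using G.ip_pos[OF D_mem[OF g]] by force
    then have "ipH f g = 0" "ipH p g = 0" using orth[OF g] y g by (auto simp: adj YG)
    then have "ipH g g = 0" by (simp add: g_def H.ip_diff_left f pH H.diff_mem)
    then have "g = 0" using H.ip_pos[OF g] by force
    then have "f = A y" using y by (simp add: g_def)
    then show ?thesis using C(2)[OF y(1)] YG[OF y(1)] by auto
  qed
  then show ?thesis using C(1) by blast
qed

text \<open>Each \<open>f\<close> in the orthogonal complement \<open>N\<close> of the kernel is
  some \<open>A y\<close>, which bounds its inner product with \<open>u\<close> by a multiple of the
  norm of \<open>D u\<close>. Uniform boundedness makes \<open>D\<close> bounded below on
  \<open>N\<close>, and \<open>D\<close> has the same range on \<open>N\<close> as on
  \<open>H\<close>. Solvability is assumed without an estimate; the principle supplies one.\<close>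

lemma closed_range_D_if_range_A:
  assumes ran: "\<And>f. f \<in> H \<Longrightarrow> (\<And>x. x \<in> H \<Longrightarrow> D x = 0 \<Longrightarrow> ipH f x = 0) \<Longrightarrow> \<exists>y\<in>G. A y = f"
  shows "hclosed G ipG (D ` H)"
proof -
  define K where "K = {x\<in>H. D x = 0}"
  define N where "N = H.orth K"
  have "K = H.orth (A ` G)"
  proof -
    have "D x = 0 \<longleftrightarrow> (\<forall>y\<in>G. ipH x (A y) = 0)" if x: "x \<in> H" for x
    proof
      assume *: "\<forall>y\<in>G. ipH x (A y) = 0"
      then have "ipG (D x) (D x) = 0" using x by (simp add: adj' D_mem)
      then show "D x = 0" using G.ip_pos[OF D_mem[OF x]] by force
    qed (simp add: adj' x)
    then show ?thesis by (auto simp: K_def H.orth_def)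
  qed
  then have K: "H.closed_subspace K" using A_mem H.closed_subspace_orth[of "A ` G"] by auto
  have KH: "K \<subseteq> H" by (auto simp: K_def)
  interpret N: hilbert sclH N ipH unfolding N_def by (intro H.hilbert_closed_subspace H.closed_subspace_orth KH)
  have NH: "x \<in> N \<Longrightarrow> x \<in> H" for x by (auto simp: N_def H.orth_def)
  have "\<exists>C\<ge>0. \<forall>u\<in>N. H.nrm u \<le> C * G.nrm (D u)"
  proof (rule N.uniform_boundedness_weighted)
    fix f assume f: "f \<in> N"
    then obtain y where y: "y \<in> G" "A y = f"
      using ran[of f] by (auto simp: N_def K_def H.orth_def)
    have "cmod (ipH f u) \<le> G.nrm y * G.nrm (D u)" if "u \<in> N" for u
      using G.cauchy_schwarz[of y "D u"] y that by (auto simp: NH D_mem adj)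
    then show "\<exists>c\<ge>0. \<forall>u\<in>N. cmod (ipH f u) \<le> c * G.nrm (D u)" using G.nrm_ge0[OF y(1)] by blast
  qed (simp add: D_mem NH)
  then obtain C where C: "\<And>u. u \<in> N \<Longrightarrow> H.nrm u \<le> C * G.nrm (D u)" by blast
  have "hclosed G ipG (D ` N)"
    by (rule hclosed_image[of sclH N ipH sclG G ipG D "\<bar>c\<bar>" C])
      (auto simp: N.hilbert_axioms G.hilbert_axioms D_mem NH D_diff D_bound C)
  moreover have "D ` H = D ` N"
  proof
    show "D ` H \<subseteq> D ` N"
    proof
      fix d assume "d \<in> D ` H"
      then obtain x where x: "x \<in> H" "d = D x" by blast
      obtain k where k: "k \<in> K" "\<And>s. s \<in> K \<Longrightarrow> ipH (x - k) s = 0" using H.projection[OF K x(1)] by blast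
      have "x - k \<in> N" using x k KH by (auto simp: N_def H.orth_def intro!: H.diff_mem)
      moreover have "D (x - k) = d" using x k by (simp add: D_diff K_def)
      ultimately show "d \<in> D ` N" by blast
    qed
  qed (use NH in auto)
  ultimately show ?thesis by simp
qed

end

section \<open>Hilbert sums and tensor products\<close>

text \<open>Two objects in one: over a finite index type it is the direct sum in which tuples of
  operators take their values, over an orthonormal basis of a second space it is the tensor product.
  Values off \<open>B\<close> are zero so that a vector of norm zero is the zero function.\<close>

definition l2_sum :: "'b set \<Rightarrow> 'v set \<Rightarrow> ('v \<Rightarrow> 'v \<Rightarrow> complex) \<Rightarrow> ('b \<Rightarrow> 'v::zero) set" where
  "l2_sum B H ip = {f. (\<forall>a\<in>B. f a \<in> H) \<and> (\<forall>a. a \<notin> B \<longrightarrow> f a = 0) \<and> (\<lambda>a. (hnorm ip (f a))\<^sup>2) summable_on B}"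

definition l2_ip :: "'b set \<Rightarrow> ('v \<Rightarrow> 'v \<Rightarrow> complex) \<Rightarrow> ('b \<Rightarrow> 'v) \<Rightarrow> ('b \<Rightarrow> 'v) \<Rightarrow> complex" where
  "l2_ip B ip f g = infsum (\<lambda>a. ip (f a) (g a)) B"

definition l2_scl :: "(complex \<Rightarrow> 'v \<Rightarrow> 'v) \<Rightarrow> complex \<Rightarrow> ('b \<Rightarrow> 'v) \<Rightarrow> ('b \<Rightarrow> 'v)" where
  "l2_scl scl c f = (\<lambda>a. scl c (f a))"

lemma dsum_space_eq_l2_sum: "dsum_space H = (l2_sum UNIV H ip :: ('m::finite \<Rightarrow> 'v::zero) set)"
  by (auto simp: dsum_space_def l2_sum_def)

lemma dsum_inner_eq_l2_ip: "dsum_inner ip = (l2_ip UNIV ip :: ('m::finite \<Rightarrow> 'v) \<Rightarrow> _)"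
  by (auto simp: dsum_inner_def l2_ip_def fun_eq_iff)

context hilbert
begin

lemma nrm_tendsto:
  assumes X: "\<And>n::nat. X n \<in> H" and f: "f \<in> H" and g: "g \<in> H"
    and lim: "(\<lambda>n. nrm (X n - f)) \<longlonglongrightarrow> 0"
  shows "(\<lambda>n. nrm (g - X n)) \<longlonglongrightarrow> nrm (g - f)"
proof -
  have "(\<lambda>n. nrm (g - X n) - nrm (g - f)) \<longlonglongrightarrow> 0"
  proof (rule Lim_null_comparison[OF _ lim], intro always_eventually allI)
    fix n
    show "norm (nrm (g - X n) - nrm (g - f)) \<le> nrm (X n - f)"
      using nrm_triangle3[OF g X f, of n] nrm_triangle3[OF g f X, of n] nrm_minus_commute[OF X f, of n]
      by (simp add: abs_le_iff)
  qed
  then show ?thesis by (simp add: LIM_zero_iff)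
qed

lemma nrm_sq_add_le: assumes "f \<in> H" "g \<in> H" shows "(nrm (f + g))\<^sup>2 \<le> 2 * (nrm f)\<^sup>2 + 2 * (nrm g)\<^sup>2"
proof -
  have "(nrm (f + g))\<^sup>2 \<le> (nrm f + nrm g)\<^sup>2"
    using assms by (intro power_mono nrm_triangle) (auto simp: add_mem)
  moreover have "0 \<le> (nrm f - nrm g)\<^sup>2" by simp
  ultimately show ?thesis by (simp add: power2_sum power2_diff)
qed

lemma summable_on_ip_bound:
  assumes "f \<in> l2_sum B H ip" "g \<in> l2_sum B H ip"
  shows "(\<lambda>a. norm (ip (f a) (g a))) summable_on B"
proof (rule Infinite_Sum.abs_summable_on_comparison_test')
  show "(\<lambda>a. (nrm (f a))\<^sup>2 + (nrm (g a))\<^sup>2) summable_on B"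
    using assms by (intro summable_on_add) (auto simp: l2_sum_def)
  fix a assume "a \<in> B"
  then have "f a \<in> H" "g a \<in> H" using assms by (auto simp: l2_sum_def)
  then have "norm (ip (f a) (g a)) \<le> nrm (f a) * nrm (g a)" by (rule cauchy_schwarz)
  also have "\<dots> \<le> (nrm (f a))\<^sup>2 + (nrm (g a))\<^sup>2"
    using sum_squares_bound[of "nrm (f a)" "nrm (g a)"] zero_le_power2[of "nrm (f a)"] zero_le_power2[of "nrm (g a)"]
    by linarith
  finally show "norm (ip (f a) (g a)) \<le> (nrm (f a))\<^sup>2 + (nrm (g a))\<^sup>2" .
qed

lemma summable_on_ip:
  "f \<in> l2_sum B H ip \<Longrightarrow> g \<in> l2_sum B H ip \<Longrightarrow> (\<lambda>a. ip (f a) (g a)) summable_on B"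
  by (rule abs_summable_summable[OF summable_on_ip_bound])

lemma l2_memD: "f \<in> l2_sum B H ip \<Longrightarrow> a \<in> B \<Longrightarrow> f a \<in> H"
  "f \<in> l2_sum B H ip \<Longrightarrow> (\<lambda>a. (nrm (f a))\<^sup>2) summable_on B"
  "f \<in> l2_sum B H ip \<Longrightarrow> a \<notin> B \<Longrightarrow> f a = 0"
  by (auto simp: l2_sum_def)

lemma l2_add_mem: assumes "f \<in> l2_sum B H ip" "g \<in> l2_sum B H ip" shows "f + g \<in> l2_sum B H ip"
proof -
  have "(\<lambda>a. (nrm ((f + g) a))\<^sup>2) summable_on B"
  proof (rule summable_on_comparison_test)
    show "(\<lambda>a. 2 * (nrm (f a))\<^sup>2 + 2 * (nrm (g a))\<^sup>2) summable_on B"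
      using assms by (intro summable_on_add summable_on_cmult_right) (auto simp: l2_sum_def)
  qed (use assms in \<open>auto intro!: nrm_sq_add_le simp: l2_sum_def\<close>)
  then show ?thesis using assms by (auto simp: l2_sum_def add_mem)
qed

lemma l2_scl_mem: assumes "f \<in> l2_sum B H ip" shows "l2_scl scl c f \<in> l2_sum B H ip"
proof -
  have "(\<lambda>a. (cmod c)\<^sup>2 * (nrm (f a))\<^sup>2) summable_on B"
    using assms by (intro summable_on_cmult_right) (auto simp: l2_sum_def)
  also have "?this \<longleftrightarrow> (\<lambda>a. (nrm (scl c (f a)))\<^sup>2) summable_on B"
    using assms by (intro summable_on_cong) (auto simp: nrm_scl power_mult_distrib l2_memD)
  finally show ?thesis using assms by (auto simp: l2_sum_def l2_scl_def scl_mem)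
qed

lemma l2_diff_mem: assumes "f \<in> l2_sum B H ip" "g \<in> l2_sum B H ip" shows "f - g \<in> l2_sum B H ip"
  using l2_add_mem[OF assms(1) l2_scl_mem[OF assms(2), of "-1"]]
  by (simp add: l2_scl_def scl_minus_one[abs_def] fun_diff_def plus_fun_def)

lemma l2_zero_mem: "0 \<in> l2_sum B H ip"
  by (simp add: l2_sum_def)

lemma l2_nrm_sq:
  assumes "f \<in> l2_sum B H ip"
  shows "(hnorm (l2_ip B ip) f)\<^sup>2 = infsum (\<lambda>a. (nrm (f a))\<^sup>2) B"
proof -
  have "Re (l2_ip B ip f f) = infsum (\<lambda>a. Re (ip (f a) (f a))) B"
    unfolding l2_ip_def using summable_on_ip[OF assms assms] by (rule infsum_Re[symmetric])
  also have "\<dots> = infsum (\<lambda>a. (nrm (f a))\<^sup>2) B"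
    using assms by (intro infsum_cong) (simp add: nrm_sq l2_memD)
  finally show ?thesis
    by (simp add: hnorm_def infsum_nonneg)
qed

lemma l2_nrm_ge0 [simp]:
  assumes "f \<in> l2_sum B H ip" shows "hnorm (l2_ip B ip) f \<ge> 0"
proof -
  have "Re (l2_ip B ip f f) = infsum (\<lambda>a. Re (ip (f a) (f a))) B"
    unfolding l2_ip_def using summable_on_ip[OF assms assms] by (rule infsum_Re[symmetric])
  also have "\<dots> \<ge> 0" using assms by (intro infsum_nonneg Re_ip_self_ge0 l2_memD)
  finally show ?thesis by (simp add: hnorm_def)
qed

lemma finite_sum_le_l2_nrm:
  assumes "f \<in> l2_sum B H ip" "finite S" "S \<subseteq> B"
  shows "(\<Sum>a\<in>S. (nrm (f a))\<^sup>2) \<le> (hnorm (l2_ip B ip) f)\<^sup>2"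
  unfolding l2_nrm_sq[OF assms(1)] using assms
  by (intro finite_sum_le_infsum) (auto simp: l2_memD)

lemma coord_le_l2_nrm:
  assumes "f \<in> l2_sum B H ip" "a \<in> B" shows "nrm (f a) \<le> hnorm (l2_ip B ip) f"
  using finite_sum_le_l2_nrm[of f B "{a}"] assms by (intro power2_le_imp_le[OF _ l2_nrm_ge0]) auto

lemma l2_mem_bounded:
  assumes f: "\<And>a. a \<in> B \<Longrightarrow> f a \<in> H" "\<And>a. a \<notin> B \<Longrightarrow> f a = 0"
    and bd: "\<And>S. finite S \<Longrightarrow> S \<subseteq> B \<Longrightarrow> (\<Sum>a\<in>S. (nrm (f a))\<^sup>2) \<le> C\<^sup>2" and C: "C \<ge> 0"
  shows "f \<in> l2_sum B H ip" "hnorm (l2_ip B ip) f \<le> C"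
proof -
  have s: "(\<lambda>a. (nrm (f a))\<^sup>2) summable_on B"
    using bd by (intro nonneg_bdd_above_summable_on) (auto intro!: bdd_aboveI2[where M = "C\<^sup>2"])
  then show m: "f \<in> l2_sum B H ip" using f by (simp add: l2_sum_def)
  have "(hnorm (l2_ip B ip) f)\<^sup>2 \<le> C\<^sup>2" unfolding l2_nrm_sq[OF m]
    using s bd by (rule infsum_le_finite_sums)
  then show "hnorm (l2_ip B ip) f \<le> C" using C by (rule power2_le_imp_le)
qed

theorem hilbert_l2_sum:
  fixes B :: "'b set"
  shows "hilbert (l2_scl scl) (l2_sum B H ip) (l2_ip B ip)"
proof
  fix f g h :: "'b \<Rightarrow> 'v" and c :: complex
  assume f: "f \<in> l2_sum B H ip" and g: "g \<in> l2_sum B H ip"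
  show "l2_ip B ip (l2_scl scl c f) g = c * l2_ip B ip f g"
  proof -
    have "l2_ip B ip (l2_scl scl c f) g = infsum (\<lambda>a. c * ip (f a) (g a)) B"
      unfolding l2_ip_def l2_scl_def using f g by (intro infsum_cong) (simp add: ip_scl_left l2_memD)
    also have "\<dots> = c * l2_ip B ip f g"
      unfolding l2_ip_def using summable_on_ip[OF f g] by (intro infsum_cmult_right)
    finally show ?thesis .
  qed
  show "l2_ip B ip g f = cnj (l2_ip B ip f g)"
    unfolding l2_ip_def infsum_cnj[symmetric] using f g by (intro infsum_cong ip_cnj l2_memD)
  assume h: "h \<in> l2_sum B H ip"
  have "l2_ip B ip (f + g) h = infsum (\<lambda>a. ip (f a) (h a) + ip (g a) (h a)) B"
    unfolding l2_ip_def using f g h by (intro infsum_cong) (simp add: ip_add_left l2_memD)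
  also have "\<dots> = l2_ip B ip f h + l2_ip B ip g h"
    unfolding l2_ip_def by (intro infsum_add summable_on_ip f g h)
  finally show "l2_ip B ip (f + g) h = l2_ip B ip f h + l2_ip B ip g h" .
next
  fix f :: "'b \<Rightarrow> 'v" assume f: "f \<in> l2_sum B H ip" and "f \<noteq> 0"
  then obtain a where a: "f a \<noteq> 0" by (auto simp: fun_eq_iff)
  then have "a \<in> B" using f by (auto simp: l2_sum_def)
  then have "nrm (f a) > 0" "nrm (f a) \<le> hnorm (l2_ip B ip) f"
    using a nrm_eq0[of "f a"] nrm_ge0[of "f a"] l2_memD[OF f] coord_le_l2_nrm[OF f] by (auto simp: less_le)
  then have "hnorm (l2_ip B ip) f > 0" by linarith
  then show "0 < Re (l2_ip B ip f f)" by (simp add: hnorm_def)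
next
  fix X :: "nat \<Rightarrow> 'b \<Rightarrow> 'v"
  assume X: "\<And>n. X n \<in> l2_sum B H ip"
    and C: "\<And>e. e > 0 \<Longrightarrow> \<exists>N. \<forall>p\<ge>N. \<forall>q\<ge>N. hnorm (l2_ip B ip) (X p - X q) < e"
  have XH: "X n a \<in> H" if "a \<in> B" for n a using l2_memD(1)[OF X that] .
  have "\<exists>y. y \<in> H \<and> (\<lambda>n. nrm (X n a - y)) \<longlonglongrightarrow> 0" if a: "a \<in> B" for a
  proof -
    have "\<exists>y\<in>H. (\<lambda>n. nrm (X n a - y)) \<longlonglongrightarrow> 0"
    proof (rule complete)
      fix e :: real assume "e > 0"
      from C[OF this] obtain N where N: "\<And>p q. p \<ge> N \<Longrightarrow> q \<ge> N \<Longrightarrow> hnorm (l2_ip B ip) (X p - X q) < e" by blast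
      have "nrm (X p a - X q a) < e" if "p \<ge> N" "q \<ge> N" for p q
        using coord_le_l2_nrm[OF l2_diff_mem[OF X X] a, of p q] N[OF that] by simp
      then show "\<exists>N. \<forall>p\<ge>N. \<forall>q\<ge>N. nrm (X p a - X q a) < e" by blast
    qed (rule XH[OF a])
    then show ?thesis by blast
  qed
  then obtain Y0 where Y0: "\<And>a. a \<in> B \<Longrightarrow> Y0 a \<in> H" "\<And>a. a \<in> B \<Longrightarrow> (\<lambda>n. nrm (X n a - Y0 a)) \<longlonglongrightarrow> 0"
    by metis
  define Y where "Y a = (if a \<in> B then Y0 a else 0)" for a
  have YH: "a \<in> B \<Longrightarrow> Y a \<in> H" and Y_out: "a \<notin> B \<Longrightarrow> Y a = 0"
    and Ylim: "a \<in> B \<Longrightarrow> (\<lambda>n. nrm (X n a - Y a)) \<longlonglongrightarrow> 0" for a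
    using Y0 by (auto simp: Y_def)
  \<comment> \<open>The limit in \<open>q\<close> is taken on finite sets of coordinates, where the
    squared norms converge termwise. The bound is uniform in the finite set, so it yields both the
    membership of \<open>X p - Y\<close> and the estimate of its norm.\<close>
  have key: "\<exists>N. \<forall>p\<ge>N. X p - Y \<in> l2_sum B H ip \<and> hnorm (l2_ip B ip) (X p - Y) \<le> e" if e: "e > 0" for e
  proof -
    obtain N where N: "\<And>p q. p \<ge> N \<Longrightarrow> q \<ge> N \<Longrightarrow> hnorm (l2_ip B ip) (X p - X q) < e"
      using C[OF e] by blast
    have "X p - Y \<in> l2_sum B H ip \<and> hnorm (l2_ip B ip) (X p - Y) \<le> e" if p: "p \<ge> N" for p
    proof -
      have bd: "(\<Sum>a\<in>S. (nrm ((X p - Y) a))\<^sup>2) \<le> e\<^sup>2" if S: "finite S" "S \<subseteq> B" for S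
      proof -
        have "(\<Sum>a\<in>S. (nrm (X p a - X q a))\<^sup>2) \<le> e\<^sup>2" if "q \<ge> N" for q
        proof -
          have "(\<Sum>a\<in>S. (nrm ((X p - X q) a))\<^sup>2) \<le> (hnorm (l2_ip B ip) (X p - X q))\<^sup>2"
            using finite_sum_le_l2_nrm[OF l2_diff_mem[OF X X] S] .
          also have "\<dots> \<le> e\<^sup>2"
            using N[OF p that] l2_nrm_ge0[OF l2_diff_mem[OF X X]] by (intro power_mono) auto
          finally show ?thesis by simp
        qed
        moreover have "(\<lambda>q. \<Sum>a\<in>S. (nrm (X p a - X q a))\<^sup>2) \<longlonglongrightarrow> (\<Sum>a\<in>S. (nrm (X p a - Y a))\<^sup>2)"
          using S by (intro tendsto_intros nrm_tendsto XH YH Ylim) auto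
        ultimately show ?thesis by (intro LIMSEQ_le_const2) auto
      qed
      show ?thesis
        using l2_mem_bounded[of B "X p - Y" e] bd e YH Y_out XH l2_memD(3)[OF X] by (auto simp: diff_mem)
    qed
    then show ?thesis by blast
  qed
  obtain N where "X N - Y \<in> l2_sum B H ip" using key[of 1] by auto
  from l2_diff_mem[OF X[of N] this] have "Y \<in> l2_sum B H ip" by simp
  moreover have "(\<lambda>n. hnorm (l2_ip B ip) (X n - Y)) \<longlonglongrightarrow> 0"
  proof (rule LIMSEQ_I)
    fix r :: real assume "r > 0"
    then obtain N where "\<forall>p\<ge>N. X p - Y \<in> l2_sum B H ip \<and> hnorm (l2_ip B ip) (X p - Y) \<le> r / 2"
      using key[of "r/2"] by auto
    then show "\<exists>no. \<forall>n\<ge>no. norm (hnorm (l2_ip B ip) (X n - Y) - 0) < r"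
      using \<open>r > 0\<close> l2_nrm_ge0 by (intro exI[of _ N]) fastforce
  qed
  ultimately show "\<exists>f\<in>l2_sum B H ip. (\<lambda>n. hnorm (l2_ip B ip) (X n - f)) \<longlonglongrightarrow> 0" by blast
qed (auto simp: l2_scl_def scl_add_right scl_add_left fun_eq_iff l2_add_mem l2_zero_mem
       intro: l2_scl_mem[unfolded l2_scl_def])

section \<open>Orthonormal bases and Parseval's identity\<close>

definition orthonormal :: "'v set \<Rightarrow> bool" where
  "orthonormal B \<longleftrightarrow> B \<subseteq> H \<and> (\<forall>a\<in>B. \<forall>b\<in>B. ip a b = (if a = b then 1 else 0))"

definition orthonormal_basis :: "'v set \<Rightarrow> bool" where
  "orthonormal_basis B \<longleftrightarrow> orthonormal B \<and> (\<forall>f\<in>H. (\<forall>a\<in>B. ip f a = 0) \<longrightarrow> f = 0)"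

text \<open>Zorn's lemma gives a maximal orthonormal set; normalizing a nonzero vector orthogonal to
  all of it would enlarge it. The set may be of any cardinality, so sums over it are
  unordered.\<close>

lemma orthonormal_basis_exists: obtains B where "orthonormal_basis B"
proof -
  have "\<exists>M\<in>Collect orthonormal. \<forall>X\<in>Collect orthonormal. M \<subseteq> X \<longrightarrow> X = M"
  proof (rule subset_Zorn')
    fix C assume "subset.chain (Collect orthonormal) C"
    then have sub: "\<And>X. X \<in> C \<Longrightarrow> orthonormal X" and lin: "\<And>X Y. X \<in> C \<Longrightarrow> Y \<in> C \<Longrightarrow> X \<subseteq> Y \<or> Y \<subseteq> X"
      by (auto simp: subset_chain_def)
    have "ip a b = (if a = b then 1 else 0)" if ab: "a \<in> X" "X \<in> C" "b \<in> Y" "Y \<in> C" for a b X Y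
    proof -
      obtain Z where "Z \<in> C" "a \<in> Z" "b \<in> Z" using lin[OF ab(2,4)] ab by blast
      then show ?thesis using sub[of Z] by (simp add: orthonormal_def)
    qed
    moreover have "\<Union> C \<subseteq> H" using sub by (auto simp: orthonormal_def)
    ultimately show "\<Union> C \<in> Collect orthonormal" by (simp add: orthonormal_def)
  qed
  then obtain M where M: "orthonormal M" and max: "\<And>X. orthonormal X \<Longrightarrow> M \<subseteq> X \<Longrightarrow> X = M" by blast
  have "f = 0" if f: "f \<in> H" and o: "\<forall>a\<in>M. ip f a = 0" for f
  proof (rule ccontr)
    assume "f \<noteq> 0"
    then have n: "nrm f \<noteq> 0" using nrm_eq0[OF f] by simp
    define e where "e = scl (of_real (1 / nrm f)) f"
    have e: "e \<in> H" by (simp add: e_def f scl_mem)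
    have ee: "ip e e = 1" using f n by (simp add: e_def ip_scl_left ip_scl_right scl_mem ip_self[OF f] power2_eq_square)
    have o1: "ip e a = 0" "ip a e = 0" if "a \<in> M" for a
    proof -
      have a: "a \<in> H" using that M by (auto simp: orthonormal_def)
      show "ip e a = 0" using o that f a by (simp add: e_def ip_simps)
      then show "ip a e = 0" using ip_cnj[OF e a] by simp
    qed
    have "orthonormal (insert e M)"
      using M e ee o1 unfolding orthonormal_def by (auto)
    then have "e \<in> M" using max[of "insert e M"] by blast
    then show False using o1 ee by force
  qed
  then show ?thesis using that[of M] M by (simp add: orthonormal_basis_def)
qed

lemma bessel_finite:
  assumes B: "orthonormal B" and S: "finite S" "S \<subseteq> B" and f: "f \<in> H"
  shows "(\<Sum>a\<in>S. (cmod (ip f a))\<^sup>2) \<le> (nrm f)\<^sup>2"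
proof -
  have SH: "a \<in> S \<Longrightarrow> a \<in> H" for a using B S by (auto simp: orthonormal_def)
  define p where "p = (\<Sum>a\<in>S. scl (ip f a) a)"
  have p: "p \<in> H" by (auto simp: p_def SH intro!: mems)
  have pf: "ip f p = of_real (\<Sum>a\<in>S. (cmod (ip f a))\<^sup>2)"
    by (simp add: p_def ip_simps SH f scl_mem complex_norm_square mult.commute del: of_real_power)
  have ap: "ip a p = cnj (ip f a)" if a: "a \<in> S" for a
  proof -
    have "ip a p = (\<Sum>b\<in>S. cnj (ip f b) * ip a b)"
      unfolding p_def using a by (simp add: ip_sum_right ip_scl_right SH scl_mem)
    also have "\<dots> = (\<Sum>b\<in>S. if b = a then cnj (ip f a) else 0)"
      using B S a by (intro sum.cong) (auto simp: orthonormal_def subset_iff)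
    finally show ?thesis using S a by (simp add: sum.delta')
  qed
  have "ip p p = (\<Sum>a\<in>S. ip f a * ip a p)"
    by (subst (1) p_def) (simp add: ip_sum_left ip_scl_left SH scl_mem p)
  also have "\<dots> = of_real (\<Sum>a\<in>S. (cmod (ip f a))\<^sup>2)"
    by (simp add: ap complex_norm_square del: of_real_power)
  finally have pp: "(nrm p)\<^sup>2 = (\<Sum>a\<in>S. (cmod (ip f a))\<^sup>2)" using nrm_sq[OF p] by simp
  have "0 \<le> (nrm (f - p))\<^sup>2" by simp
  also have "\<dots> = (nrm f)\<^sup>2 - (\<Sum>a\<in>S. (cmod (ip f a))\<^sup>2)"
    using pf pp by (simp add: nrm_sq_diff f p)
  finally show ?thesis by simp
qed

lemma bessel:
  assumes B: "orthonormal B" and f: "f \<in> H"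
  shows "(\<lambda>a. (cmod (ip f a))\<^sup>2) summable_on B" "infsum (\<lambda>a. (cmod (ip f a))\<^sup>2) B \<le> (nrm f)\<^sup>2"
proof -
  show s: "(\<lambda>a. (cmod (ip f a))\<^sup>2) summable_on B"
    using bessel_finite[OF B _ _ f]
    by (intro nonneg_bdd_above_summable_on) (auto intro!: bdd_aboveI2[where M = "(nrm f)\<^sup>2"])
  show "infsum (\<lambda>a. (cmod (ip f a))\<^sup>2) B \<le> (nrm f)\<^sup>2"
    using s bessel_finite[OF B _ _ f] by (rule infsum_le_finite_sums)
qed

lemma coeff_product_bound: "norm (ip f a * cnj (ip g a)) \<le> (cmod (ip f a))\<^sup>2 + (cmod (ip g a))\<^sup>2"
  using sum_squares_bound[of "cmod (ip f a)" "cmod (ip g a)"]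
    zero_le_power2[of "cmod (ip f a)"] zero_le_power2[of "cmod (ip g a)"]
  unfolding norm_mult complex_mod_cnj by linarith

lemma coeff_product_summable:
  assumes B: "orthonormal B" and f: "f \<in> H" and g: "g \<in> H"
  shows "(\<lambda>a. norm (ip f a * cnj (ip g a))) summable_on B"
proof (rule Infinite_Sum.abs_summable_on_comparison_test')
  show "(\<lambda>a. (cmod (ip f a))\<^sup>2 + (cmod (ip g a))\<^sup>2) summable_on B"
    by (intro summable_on_add bessel B f g)
qed (rule coeff_product_bound)

text \<open>The sum of the series is a bounded functional of the first argument; its Riesz vector has the
  same coefficients as the second argument, so it is that argument.\<close>

theorem parseval:
  assumes B: "orthonormal_basis B" and f: "f \<in> H" and g: "g \<in> H"
  shows "((\<lambda>a. ip f a * cnj (ip g a)) has_sum ip f g) B"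
proof -
  have on: "orthonormal B" using B by (simp add: orthonormal_basis_def)
  then have BH: "a \<in> B \<Longrightarrow> a \<in> H" for a by (auto simp: orthonormal_def)
  have summ: "(\<lambda>a. ip f a * cnj (ip g a)) summable_on B" if "f \<in> H" for f
    by (rule abs_summable_summable[OF coeff_product_summable[OF on that g]])
  define \<phi> where "\<phi> f = infsum (\<lambda>a. ip f a * cnj (ip g a)) B" for f
  \<comment> \<open>Each product is at most the sum of the two squares, and Bessel's inequality sums
    these; homogeneity then removes the restriction to the unit ball. The value of the constant is
    immaterial for the application of Riesz.\<close>
  have bound: "cmod (\<phi> h) \<le> (1 + (nrm g)\<^sup>2)" if h: "h \<in> H" "nrm h \<le> 1" for h
  proof -
    have "cmod (\<phi> h) \<le> infsum (\<lambda>a. norm (ip h a * cnj (ip g a))) B"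
      unfolding \<phi>_def by (rule norm_infsum_bound[OF coeff_product_summable[OF on h(1) g]])
    also have "\<dots> \<le> infsum (\<lambda>a. (cmod (ip h a))\<^sup>2 + (cmod (ip g a))\<^sup>2) B"
    proof (rule infsum_mono[OF coeff_product_summable[OF on h(1) g]])
      show "(\<lambda>a. (cmod (ip h a))\<^sup>2 + (cmod (ip g a))\<^sup>2) summable_on B"
        by (intro summable_on_add bessel on h g)
    qed (rule coeff_product_bound)
    also have "\<dots> = infsum (\<lambda>a. (cmod (ip h a))\<^sup>2) B + infsum (\<lambda>a. (cmod (ip g a))\<^sup>2) B"
      by (intro infsum_add bessel on h g)
    also have "\<dots> \<le> (nrm h)\<^sup>2 + (nrm g)\<^sup>2"
      by (intro add_mono bessel on h g)
    also have "\<dots> \<le> 1 + (nrm g)\<^sup>2" using h by (simp add: power_le_one)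
    finally show ?thesis .
  qed
  have add: "\<phi> (f + h) = \<phi> f + \<phi> h" if "f \<in> H" "h \<in> H" for f h
  proof -
    have "\<phi> (f + h) = infsum (\<lambda>a. ip f a * cnj (ip g a) + ip h a * cnj (ip g a)) B"
      unfolding \<phi>_def using that by (intro infsum_cong) (simp add: ip_add_left BH algebra_simps)
    also have "\<dots> = \<phi> f + \<phi> h" unfolding \<phi>_def by (intro infsum_add summ that)
    finally show ?thesis .
  qed
  have sc: "\<phi> (scl c f) = c * \<phi> f" if "f \<in> H" for f c
  proof -
    have "\<phi> (scl c f) = infsum (\<lambda>a. c * (ip f a * cnj (ip g a))) B"
      unfolding \<phi>_def using that by (intro infsum_cong) (simp add: ip_scl_left BH algebra_simps)
    also have "\<dots> = c * \<phi> f" unfolding \<phi>_def by (intro infsum_cmult_right summ that)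
    finally show ?thesis .
  qed
  have "cmod (\<phi> h) \<le> (1 + (nrm g)\<^sup>2) * nrm h" if h: "h \<in> H" for h
  proof (cases "nrm h = 0")
    case True
    then have "h = 0" using nrm_eq0[OF h] by simp
    then show ?thesis using sc[of 0 0] by simp
  next
    case False
    then have pos: "nrm h > 0" using nrm_ge0[OF h] by linarith
    have "cmod (\<phi> (scl (of_real (1 / nrm h)) h)) \<le> 1 + (nrm g)\<^sup>2"
      using pos h by (intro bound) (auto simp: scl_mem nrm_scl norm_divide)
    then show ?thesis using pos by (simp add: sc[OF h] norm_divide norm_mult field_simps)
  qed
  from riesz[OF add sc this] obtain p where p: "p \<in> H" "\<And>f. f \<in> H \<Longrightarrow> \<phi> f = ip f p" by blast
  have "ip (p - g) a = 0" if a: "a \<in> B" for a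
  proof -
    have "ip a p = infsum (\<lambda>b. ip a b * cnj (ip g b)) B" using p(2)[OF BH[OF a]] by (simp add: \<phi>_def)
    also have "\<dots> = infsum (\<lambda>b. ip a b * cnj (ip g b)) {a}"
      using on a by (intro infsum_cong_neutral) (auto simp: orthonormal_def)
    also have "\<dots> = ip a g" using on a ip_cnj[OF g BH[OF a]] by (simp add: orthonormal_def)
    finally have "ip p a = ip g a" using ip_cnj[OF BH[OF a] p(1)] ip_cnj[OF BH[OF a] g] by simp
    then show ?thesis using p(1) g BH[OF a] by (simp add: ip_diff_left)
  qed
  then have "p = g" using B p(1) g diff_mem[OF p(1) g] by (auto simp: orthonormal_basis_def)
  then have "infsum (\<lambda>a. ip f a * cnj (ip g a)) B = ip f g" using p(2)[OF f] by (simp add: \<phi>_def)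
  then show ?thesis using has_sum_infsum[OF summ[OF f]] by simp
qed

end

text \<open>A member \<open>f\<close> of \<open>E\<close> stands for the sum over \<open>a\<close>
  in \<open>B\<close> of the tensors of \<open>f a\<close> with \<open>a\<close>. Keeping the
  coordinates in \<open>H1\<close> lets operators and division problems on \<open>H1\<close> be
  treated one coordinate at a time; only the second factor needs a basis.\<close>

locale tensor = H1: hilbert scl1 H1 ip1 + H2: hilbert scl2 H2 ip2
  for scl1 :: "complex \<Rightarrow> 'v::ab_group_add \<Rightarrow> 'v" and H1 ip1
    and scl2 :: "complex \<Rightarrow> 'w::ab_group_add \<Rightarrow> 'w" and H2 ip2 +
  fixes B assumes basis: "H2.orthonormal_basis B"
begin

abbreviation "E \<equiv> l2_sum B H1 ip1"
abbreviation "ipE \<equiv> l2_ip B ip1"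
abbreviation "sclE \<equiv> l2_scl scl1"

sublocale E: hilbert sclE E ipE by (rule H1.hilbert_l2_sum)

lemma B_mem: "a \<in> B \<Longrightarrow> a \<in> H2" and ip_B: "a \<in> B \<Longrightarrow> b \<in> B \<Longrightarrow> ip2 a b = (if a = b then 1 else 0)"
  using basis by (auto simp: H2.orthonormal_basis_def H2.orthonormal_def)

lemma orthonormal_B: "H2.orthonormal B"
  using basis by (simp add: H2.orthonormal_basis_def)

text \<open>The elementary tensor of \<open>h\<close> and \<open>g\<close>: the scalar
  \<open>ip2 g a\<close> is the coefficient of \<open>a\<close> in the expansion of
  \<open>g\<close>.\<close>

definition tens :: "'v \<Rightarrow> 'w \<Rightarrow> 'w \<Rightarrow> 'v" where
  "tens h g = (\<lambda>a. if a \<in> B then scl1 (ip2 g a) h else 0)"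

lemma tens_mem: assumes h: "h \<in> H1" and g: "g \<in> H2" shows "tens h g \<in> E"
proof -
  have "(\<lambda>a. (cmod (ip2 g a))\<^sup>2 * (H1.nrm h)\<^sup>2) summable_on B"
    by (intro summable_on_cmult_left H2.bessel orthonormal_B g)
  also have "?this \<longleftrightarrow> (\<lambda>a. (H1.nrm (tens h g a))\<^sup>2) summable_on B"
    by (intro summable_on_cong) (simp add: tens_def H1.nrm_scl h power_mult_distrib)
  finally show ?thesis using h by (auto simp: l2_sum_def tens_def H1.scl_mem)
qed

lemma ip_tens_right:
  assumes f: "f \<in> E" and h: "h \<in> H1" and g: "g \<in> H2"
  shows "ipE f (tens h g) = infsum (\<lambda>a. ip1 (f a) h * cnj (ip2 g a)) B"
  unfolding l2_ip_def using f h by (intro infsum_cong) (simp add: tens_def H1.ip_scl_right H1.l2_memD mult.commute)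

text \<open>Parseval's identity in the second space evaluates the sum over the basis; the outcome
  does not depend on \<open>B\<close>.\<close>

lemma ip_tens:
  assumes "h \<in> H1" "g \<in> H2" "h' \<in> H1" "g' \<in> H2"
  shows "ipE (tens h g) (tens h' g') = ip1 h h' * ip2 g g'"
proof -
  have "ipE (tens h g) (tens h' g') = infsum (\<lambda>a. ip1 h h' * (ip2 g a * cnj (ip2 g' a))) B"
    unfolding ip_tens_right[OF tens_mem[OF assms(1,2)] assms(3,4)]
    using assms by (intro infsum_cong) (simp add: tens_def H1.ip_scl_left)
  also have "\<dots> = ip1 h h' * ip2 g g'"
    using H2.parseval[OF basis assms(2,4)] by (metis has_sum_cmult_right infsumI)
  finally show ?thesis .
qed

lemma nrm_tens: assumes "h \<in> H1" "g \<in> H2" shows "E.nrm (tens h g) = H1.nrm h * H2.nrm g"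
proof -
  have "(E.nrm (tens h g))\<^sup>2 = (H1.nrm h * H2.nrm g)\<^sup>2"
    using assms by (simp add: E.nrm_sq tens_mem ip_tens H1.ip_self H2.ip_self power_mult_distrib)
  then show ?thesis using assms by (simp add: power2_eq_iff_nonneg tens_mem)
qed

lemma tens_add_right: "g \<in> H2 \<Longrightarrow> g' \<in> H2 \<Longrightarrow> tens h (g + g') = tens h g + tens h g'"
  by (auto simp: tens_def H1.scl_add_left H2.ip_add_left B_mem)

lemma tens_scl_right: "h \<in> H1 \<Longrightarrow> g \<in> H2 \<Longrightarrow> tens h (scl2 c g) = sclE c (tens h g)"
  by (auto simp: tens_def l2_scl_def H2.ip_scl_left B_mem)

text \<open>Truncation to finitely many coordinates. It reduces statements that survive uniform
  limits, such as the holomorphy of jets, to elementary tensors.\<close>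

lemma finite_tens_approx:
  assumes f: "f \<in> E" and e: "e > 0"
  obtains S where "finite S" "S \<subseteq> B" "E.nrm (f - (\<Sum>a\<in>S. tens (f a) a)) \<le> e"
proof -
  have s: "(\<lambda>a. (H1.nrm (f a))\<^sup>2) summable_on B" using f by (rule H1.l2_memD)
  obtain S where S: "finite S" "S \<subseteq> B"
    and d: "dist (\<Sum>a\<in>S. (H1.nrm (f a))\<^sup>2) (infsum (\<lambda>a. (H1.nrm (f a))\<^sup>2) B) \<le> e\<^sup>2"
    using infsum_finite_approximation[OF s, of "e\<^sup>2"] e by auto
  define t where "t = (\<Sum>a\<in>S. tens (f a) a)"
  have t: "t a = (if a \<in> S then f a else 0)" for a
  proof -
    have "t a = (\<Sum>b\<in>S. tens (f b) b a)"
      unfolding t_def by (induction S rule: infinite_finite_induct) auto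
    also have "\<dots> = (\<Sum>b\<in>S. if b = a then f a else 0)"
      using S by (intro sum.cong) (auto simp: tens_def ip_B subset_iff)
    finally show ?thesis using S by (simp add: sum.delta')
  qed
  have tE: "t \<in> E" unfolding t_def using S f
    by (intro E.sum_mem tens_mem) (auto intro: H1.l2_memD B_mem)
  have "(E.nrm (f - t))\<^sup>2 = infsum (\<lambda>a. (H1.nrm ((f - t) a))\<^sup>2) B"
    by (intro H1.l2_nrm_sq E.diff_mem f tE)
  also have "\<dots> = infsum (\<lambda>a. (H1.nrm (f a))\<^sup>2) (B - S)"
    by (intro infsum_cong_neutral) (auto simp: t)
  also have "\<dots> = infsum (\<lambda>a. (H1.nrm (f a))\<^sup>2) B - (\<Sum>a\<in>S. (H1.nrm (f a))\<^sup>2)"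
    using infsum_Diff[OF s _ S(2)] S by simp
  also have "\<dots> \<le> e\<^sup>2" using d by (simp add: dist_real_def)
  finally have "E.nrm (f - t) \<le> e" by (rule power2_le_imp_le) (use e in simp)
  then show ?thesis using that S by (simp add: t_def)
qed

end

section \<open>Holomorphic functions of several variables\<close>

lemma norm_vector_smult: "norm (c *s (x :: complex ^ 'n)) = cmod c * norm x"
  by (simp add: norm_vec_def norm_mult L2_set_right_distrib)

lemma norm_axis_one: "norm (axis l (1 :: complex) :: complex ^ 'n) = 1"
proof -
  have "(\<Sum>i\<in>UNIV. (cmod (axis l (1 :: complex) $ i))\<^sup>2) = (\<Sum>i\<in>(UNIV :: 'n set). if i = l then 1 else 0)"
    by (intro sum.cong) (auto simp: axis_def)
  then show ?thesis by (simp add: norm_vec_def L2_set_def)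
qed

lemma bounded_linear_vector_smult_left: "bounded_linear (\<lambda>c. c *s (x :: complex ^ 'n))"
  by (rule bounded_linear_intro[where K = "norm x"])
    (simp_all add: norm_vector_smult vector_sadd_rdistrib scaleR_vec_def vec_eq_iff algebra_simps)

lemma coord_upd_eq: "coord_upd z l \<zeta> = z + (\<zeta> - z $ l) *s axis l 1"
  by (simp add: coord_upd_def vec_eq_iff axis_def)

lemma coord_upd_self [simp]: "coord_upd z l (z $ l) = z"
  by (simp add: coord_upd_eq)

lemma sum_smult_axis: "(h :: complex ^ 'n) = (\<Sum>l\<in>UNIV. h $ l *s axis l 1)"
  by (simp add: vec_eq_iff axis_def if_distrib cong: if_cong)

lemma eventually_coord_upd_mem:
  assumes "open S" "z \<in> S"
  shows "eventually (\<lambda>\<zeta>. coord_upd z l \<zeta> \<in> S) (nhds (z $ l))"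
proof -
  have "isCont (\<lambda>\<zeta>. coord_upd z l \<zeta>) (z $ l)"
    unfolding coord_upd_eq
    by (intro continuous_intros bounded_linear.isCont[OF bounded_linear_vector_smult_left])
  then have "((\<lambda>\<zeta>. coord_upd z l \<zeta>) \<longlongrightarrow> z) (at (z $ l))" by (simp add: isCont_def)
  then have "((\<lambda>\<zeta>. coord_upd z l \<zeta>) \<longlongrightarrow> z) (nhds (z $ l))"
    by (simp add: tendsto_nhds_iff)
  then show ?thesis using assms by (rule topological_tendstoD)
qed

section \<open>Complex differentials, Cauchy estimates and uniform limits\<close>

definition has_cderiv :: "(complex ^ 'm \<Rightarrow> complex) \<Rightarrow> (complex ^ 'm \<Rightarrow> complex) \<Rightarrow> complex ^ 'm \<Rightarrow> bool" where
  "has_cderiv f D z \<longleftrightarrow> (f has_derivative D) (at z) \<and> (\<forall>c h. D (c *s h) = c * D h)"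

lemma holomorphic_cn_iff: "holomorphic_cn S f \<longleftrightarrow> (\<forall>z\<in>S. \<exists>D. has_cderiv f D z)"
  by (simp add: holomorphic_cn_def has_cderiv_def)

lemma holomorphic_cn_subset: "holomorphic_cn S f \<Longrightarrow> T \<subseteq> S \<Longrightarrow> holomorphic_cn T f"
  by (auto simp: holomorphic_cn_def)

lemma holomorphic_cn_isCont: "holomorphic_cn S f \<Longrightarrow> z \<in> S \<Longrightarrow> isCont f z"
  unfolding holomorphic_cn_def using has_derivative_continuous by blast

lemma holomorphic_cn_continuous_on: "holomorphic_cn S f \<Longrightarrow> continuous_on S f"
  by (simp add: continuous_at_imp_continuous_on holomorphic_cn_isCont)

lemma has_cderiv_linear: "has_cderiv f D z \<Longrightarrow> linear D"
  unfolding has_cderiv_def using has_derivative_linear by blast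

lemma has_cderiv_const: "has_cderiv (\<lambda>z. c) (\<lambda>h. 0) z"
  by (simp add: has_cderiv_def)

lemma has_cderiv_add: "has_cderiv f D z \<Longrightarrow> has_cderiv g D' z \<Longrightarrow> has_cderiv (\<lambda>z. f z + g z) (\<lambda>h. D h + D' h) z"
  by (auto simp: has_cderiv_def algebra_simps intro!: derivative_eq_intros)

lemma has_cderiv_diff: "has_cderiv f D z \<Longrightarrow> has_cderiv g D' z \<Longrightarrow> has_cderiv (\<lambda>z. f z - g z) (\<lambda>h. D h - D' h) z"
  by (auto simp: has_cderiv_def algebra_simps intro!: derivative_eq_intros)

lemma has_cderiv_mult:
  "has_cderiv f D z \<Longrightarrow> has_cderiv g D' z \<Longrightarrow> has_cderiv (\<lambda>z. f z * g z) (\<lambda>h. f z * D' h + D h * g z) z"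
  by (auto simp: has_cderiv_def algebra_simps intro!: derivative_eq_intros)

lemma has_cderiv_component: "has_cderiv (\<lambda>z. z $ l) (\<lambda>h. h $ l) z"
  by (auto simp: has_cderiv_def intro!: bounded_linear_imp_has_derivative bounded_linear_vec_nth)

lemma has_cderiv_shift: "has_cderiv f D (z + a) \<Longrightarrow> has_cderiv (\<lambda>z. f (z + a)) D z"
  unfolding has_cderiv_def
  using has_derivative_compose[of "\<lambda>z. z + a" "\<lambda>h. h" z UNIV f D]
    has_derivative_add_const[OF has_derivative_ident, of a] by auto

lemma has_cderiv_line:
  assumes "has_cderiv f D (z + t *s h)"
  shows "((\<lambda>t. f (z + t *s h)) has_field_derivative D h) (at t)"
proof -
  have "((\<lambda>t. z + t *s h) has_derivative (\<lambda>s. s *s h)) (at t)"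
    using bounded_linear_imp_has_derivative[OF bounded_linear_vector_smult_left[of h], of "at t"]
    by (auto intro!: derivative_eq_intros)
  then have "((\<lambda>t. f (z + t *s h)) has_derivative (\<lambda>s. D (s *s h))) (at t)"
    using assms has_derivative_compose[of "\<lambda>t. z + t *s h" "\<lambda>s. s *s h" t UNIV f D] by (simp add: has_cderiv_def)
  moreover have "(\<lambda>s. D (s *s h)) = (*) (D h)" using assms by (auto simp: has_cderiv_def)
  ultimately show ?thesis by (simp add: has_field_derivative_def)
qed

lemma has_cderiv_coord:
  assumes "has_cderiv f D z"
  shows "((\<lambda>\<zeta>. f (coord_upd z l \<zeta>)) has_field_derivative D (axis l 1)) (at (z $ l))"
proof -
  have "((\<lambda>t. f (z + t *s axis l 1)) has_field_derivative D (axis l 1)) (at (z $ l - z $ l))"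
    by (rule has_cderiv_line) (use assms in simp)
  then show ?thesis
    unfolding coord_upd_eq using DERIV_shift[of "\<lambda>t. f (z + t *s axis l 1)" "D (axis l 1)" "z $ l" "- z $ l"] by simp
qed

lemma cpartial_eq: "has_cderiv f D z \<Longrightarrow> cpartial l f z = D (axis l 1)"
  unfolding cpartial_def by (rule DERIV_imp_deriv[OF has_cderiv_coord])

lemma has_cderiv_eq_sum:
  assumes "has_cderiv f D z" shows "D h = (\<Sum>l\<in>UNIV. h $ l * cpartial l f z)"
proof -
  have "D h = D (\<Sum>l\<in>UNIV. h $ l *s axis l 1)" by (simp flip: sum_smult_axis)
  also have "\<dots> = (\<Sum>l\<in>UNIV. h $ l * cpartial l f z)"
    using assms by (simp add: linear_sum[OF has_cderiv_linear[OF assms]] cpartial_eq has_cderiv_def)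
  finally show ?thesis .
qed

text \<open>Restriction to a complex line makes the one-variable Cauchy estimates available. The
  disc is open, so \<open>norm h\<close> may equal \<open>r\<close>; \<open>h = 0\<close> is a
  separate case because an empty ball is not excluded, and there the function is constant.\<close>

lemma holomorphic_line:
  assumes "holomorphic_cn (ball z r) f" "norm h \<le> r"
  shows "(\<lambda>t. f (z + t *s h)) holomorphic_on ball 0 1"
  unfolding holomorphic_on_def
proof
  fix t :: complex assume t: "t \<in> ball 0 1"
  have "cmod t * norm h < r \<or> h = 0"
  proof (cases "h = 0")
    case False
    then have "cmod t * norm h < 1 * norm h" using t by (intro mult_strict_right_mono) auto
    then show ?thesis using assms(2) by linarith
  qed simp
  moreover have "z + t *s h \<in> ball z r" if "cmod t * norm h < r"
    using that by (simp add: dist_norm norm_vector_smult)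
  moreover have "(\<lambda>t. f (z + t *s h)) field_differentiable (at t within ball 0 1)" if "h = 0"
    using that by simp
  ultimately show "(\<lambda>t. f (z + t *s h)) field_differentiable (at t within ball 0 1)"
    using assms(1) has_cderiv_line field_differentiable_at_within field_differentiable_def
    unfolding holomorphic_cn_iff by metis
qed

text \<open>Cauchy's inequality on circles of radius 1/4 about points of modulus at most 1/4 bounds
  the second derivative by 2 B / (1/4)^2 = 32 B; the circle of radius 1/2 about 0 bounds the first
  derivative by 2 B.\<close>

lemma cauchy_quadratic:
  assumes hol: "\<psi> holomorphic_on ball 0 1" and bd: "\<And>t. t \<in> ball 0 1 \<Longrightarrow> cmod (\<psi> t) \<le> B"
  shows "cmod t \<le> 1/4 \<Longrightarrow> cmod (\<psi> t - \<psi> 0 - deriv \<psi> 0 * t) \<le> 32 * B * (cmod t)\<^sup>2"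
    and "cmod (deriv \<psi> 0) \<le> 2 * B"
proof -
  have c: "continuous_on (cball x r) \<psi>" "\<psi> holomorphic_on ball x r"
     if "cmod x + r < 1" for x :: complex and r
  proof -
    have "cball x r \<subseteq> ball 0 1"
    proof
      fix y assume "y \<in> cball x r"
      then show "y \<in> ball 0 1" using that norm_triangle_sub[of y x] by (simp add: dist_norm norm_minus_commute)
    qed
    then have "\<psi> holomorphic_on cball x r" by (rule holomorphic_on_subset[OF hol])
    then show "continuous_on (cball x r) \<psi>" "\<psi> holomorphic_on ball x r"
      by (rule holomorphic_on_imp_continuous_on, rule holomorphic_on_subset[OF _ ball_subset_cball])
  qed
  have nb: "cmod (\<psi> y) \<le> B" if "cmod x + r < 1" "norm (x - y) = r" for x y :: complex and r
    using that norm_triangle_sub[of y x] by (intro bd) (simp add: norm_minus_commute)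
  show "cmod (deriv \<psi> 0) \<le> 2 * B"
    using Cauchy_inequality[of \<psi> 0 "1/2" B 1] c[of 0 "1/2"] nb[of 0 "1/2"] by simp
  have d2: "cmod ((deriv ^^ 2) \<psi> x) \<le> 32 * B" if "cmod x \<le> 1/4" for x
    using Cauchy_inequality[of \<psi> x "1/4" B 2] c[of x "1/4"] nb[of x "1/4"] that by (simp add: power2_eq_square)
  assume t: "cmod t \<le> 1/4"
  have "cmod ((deriv ^^ 0) \<psi> t - (\<Sum>i\<le>1. (deriv ^^ i) \<psi> 0 * (t - 0) ^ i / fact i))
      \<le> 32 * B * cmod (t - 0) ^ Suc 1 / fact 1"
  proof (rule complex_Taylor[where S = "cball 0 (1/4)"])
    fix i :: nat and x :: complex assume "x \<in> cball 0 (1/4)" "i \<le> 1"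
    have "(deriv ^^ i) \<psi> holomorphic_on ball 0 1"
      by (intro holomorphic_higher_deriv hol) auto
    from holomorphic_derivI[OF this, of x] \<open>x \<in> cball 0 (1/4)\<close>
    show "((deriv ^^ i) \<psi> has_field_derivative (deriv ^^ Suc i) \<psi> x) (at x within cball 0 (1/4))"
      by simp
  qed (use t d2 in \<open>auto simp: numeral_2_eq_2\<close>)
  then show "cmod (\<psi> t - \<psi> 0 - deriv \<psi> 0 * t) \<le> 32 * B * (cmod t)\<^sup>2"
    by (simp add: power2_eq_square diff_diff_eq)
qed

text \<open>The constants depend on \<open>f\<close> only through the bound \<open>B\<close>. This
  uniformity lets the estimates pass to limits of functions and, by uniform boundedness, to norms of
  representing vectors.\<close>

lemma quadratic_remainder:
  assumes hol: "holomorphic_cn (ball z r) f" and bd: "\<And>u. u \<in> ball z r \<Longrightarrow> cmod (f u) \<le> B"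
    and D: "has_cderiv f D z" and r: "r > 0"
  shows "norm h \<le> r / 4 \<Longrightarrow> cmod (f (z + h) - f z - D h) \<le> 32 * B / r\<^sup>2 * (norm h)\<^sup>2"
    and "cmod (D h) \<le> 2 * B / r * norm h"
proof -
  have D0: "D 0 = 0" using has_cderiv_linear[OF D] by (rule linear_0)
  have B: "B \<ge> 0" using bd[of z] r norm_ge_zero order_trans by (metis centre_in_ball)
  \<comment> \<open>The direction of \<open>h\<close> rescaled to length \<open>r\<close>, so that
    the open unit disc of the line fits in the ball and \<open>h\<close> sits at the parameter
    \<open>norm h / r\<close>. For \<open>h = 0\<close> the claims are checked directly.\<close>
  define u where "u = of_real (r / norm h) *s h"
  define \<psi> where "\<psi> t = f (z + t *s u)" for t
  define t0 where "t0 = complex_of_real (norm h / r)"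
  have u: "norm u \<le> r" using r by (simp add: u_def norm_vector_smult norm_divide)
  have hol\<psi>: "\<psi> holomorphic_on ball 0 1" unfolding \<psi>_def by (rule holomorphic_line[OF hol u])
  have bd\<psi>: "cmod (\<psi> t) \<le> B" if "t \<in> ball 0 1" for t
  proof -
    have "norm (t *s u) < r"
    proof (cases "norm u = 0")
      case False
      then have "cmod t * norm u < 1 * norm u" using that by (intro mult_strict_right_mono) auto
      then show ?thesis using u by (simp add: norm_vector_smult)
    qed (use r in \<open>simp add: norm_vector_smult\<close>)
    then show ?thesis unfolding \<psi>_def by (intro bd) (simp add: dist_norm)
  qed
  have der: "deriv \<psi> 0 = D u"
    unfolding \<psi>_def by (intro DERIV_imp_deriv has_cderiv_line) (simp add: D)
  have h: "h = t0 *s u" "D h = t0 * D u" if "h \<noteq> 0"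
  proof -
    show "h = t0 *s u" using that r by (simp add: t0_def u_def vector_smult_assoc)
    then show "D h = t0 * D u" using D by (metis has_cderiv_def)
  qed
  show "cmod (D h) \<le> 2 * B / r * norm h"
  proof (cases "h = 0")
    case False
    have "cmod (D h) = norm h / r * cmod (D u)" using h(2)[OF False] r by (simp add: t0_def norm_mult norm_divide)
    also have "\<dots> \<le> norm h / r * (2 * B)"
      using cauchy_quadratic(2)[OF hol\<psi> bd\<psi>] r by (intro mult_left_mono) (auto simp: der)
    finally show ?thesis by (simp add: field_simps)
  qed (simp add: D0)
  assume nh: "norm h \<le> r / 4"
  show "cmod (f (z + h) - f z - D h) \<le> 32 * B / r\<^sup>2 * (norm h)\<^sup>2"
  proof (cases "h = 0")
    case False
    have "cmod t0 \<le> 1/4" using nh r by (simp add: t0_def field_simps norm_divide)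
    then have "cmod (\<psi> t0 - \<psi> 0 - deriv \<psi> 0 * t0) \<le> 32 * B * (cmod t0)\<^sup>2"
      using cauchy_quadratic(1)[of \<psi> B t0] hol\<psi> bd\<psi> by blast
    moreover have "\<psi> t0 - \<psi> 0 - deriv \<psi> 0 * t0 = f (z + h) - f z - D h"
      using h[OF False] by (simp add: der \<psi>_def mult.commute)
    moreover have "32 * B * (cmod t0)\<^sup>2 = 32 * B / r\<^sup>2 * (norm h)\<^sup>2"
      using r by (simp add: t0_def power_divide norm_divide)
    ultimately show ?thesis by simp
  qed (use B in \<open>simp add: D0\<close>)
qed

lemma has_derivative_quadraticI:
  fixes D :: "'a::euclidean_space \<Rightarrow> 'b::real_normed_vector"
  assumes D: "linear D" and d: "d > 0" and bd: "\<And>h. norm h < d \<Longrightarrow> norm (f (z + h) - f z - D h) \<le> C * (norm h)\<^sup>2"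
  shows "(f has_derivative D) (at z)"
proof (rule has_derivativeI_sandwich[OF d])
  show "bounded_linear D" using D by (simp add: linear_conv_bounded_linear)
  show "((\<lambda>y. C * norm (y - z)) \<longlongrightarrow> 0) (at z)"
    by (auto intro!: tendsto_eq_intros)
  fix y assume "y \<noteq> z" "dist y z < d"
  then show "norm (f y - f z - D (y - z)) / norm (y - z) \<le> C * norm (y - z)"
    using bd[of "y - z"] by (simp add: dist_norm divide_le_eq power2_eq_square ac_simps)
qed

text \<open>Weierstrass' theorem. The differentials of the approximants converge because the Cauchy
  estimate applies to their differences, and the quadratic remainder bound, uniform in the
  approximants, passes to the limit.\<close>

lemma holomorphic_cn_limit:
  assumes approx: "\<And>z. z \<in> S \<Longrightarrow> \<exists>r>0. \<forall>e>0. \<exists>g. holomorphic_cn (ball z r) g \<and> (\<forall>u\<in>ball z r. cmod (f u - g u) \<le> e)"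
  shows "holomorphic_cn S f"
  unfolding holomorphic_cn_iff
proof
  fix z assume "z \<in> S"
  from approx[OF this] obtain r where r: "r > 0"
    and ex: "\<forall>e>0. \<exists>g. holomorphic_cn (ball z r) g \<and> (\<forall>u\<in>ball z r. cmod (f u - g u) \<le> e)" by blast
  have "\<forall>n. \<exists>g. holomorphic_cn (ball z r) g \<and> (\<forall>u\<in>ball z r. cmod (f u - g u) \<le> inverse (real (Suc n)))"
    using ex by simp
  then obtain g where g: "\<And>n. holomorphic_cn (ball z r) (g n)"
    and fg: "\<And>n u. u \<in> ball z r \<Longrightarrow> cmod (f u - g n u) \<le> inverse (real (Suc n))" by metis
  have "isCont (g 0) z" using holomorphic_cn_isCont[OF g] r by simp
  then obtain \<delta> where \<delta>: "\<delta> > 0" "\<And>u. dist u z < \<delta> \<Longrightarrow> dist (g 0 u) (g 0 z) < 1"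
    unfolding continuous_at_eps_delta by (metis zero_less_one)
  \<comment> \<open>On this ball \<open>g 0\<close> varies by less than 1, which bounds all
    approximants at once: \<open>g 0\<close> is within 1 of its value at the centre,
    \<open>f\<close> within 1 of \<open>g 0\<close>, and \<open>g n\<close> within 1 of
    \<open>f\<close>. Hence the 3 in \<open>B\<close>.\<close>
  define \<rho> where "\<rho> = min r \<delta>"
  have \<rho>: "\<rho> > 0" using r \<delta> by (simp add: \<rho>_def)
  define B where "B = cmod (g 0 z) + 3"
  have gB: "cmod (g n u) \<le> B" if u: "u \<in> ball z \<rho>" for n u
  proof -
    have "cmod (g 0 u) \<le> cmod (g 0 z) + 1"
      using \<delta>(2)[of u] u norm_triangle_sub[of "g 0 u" "g 0 z"] by (simp add: \<rho>_def dist_norm norm_minus_commute)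
    moreover have "cmod (f u - g 0 u) \<le> 1" "cmod (f u - g n u) \<le> 1"
      using fg[of u 0] fg[of u n] u by (auto simp: \<rho>_def inverse_eq_divide intro: order_trans)
    moreover have "cmod (g n u) \<le> cmod (g 0 u) + cmod (f u - g 0 u) + cmod (f u - g n u)"
      using norm_triangle_sub[of "g n u" "g 0 u"] norm_triangle_ineq4[of "f u - g 0 u" "f u - g n u"] by simp
    ultimately show ?thesis by (simp add: B_def)
  qed
  have g\<rho>: "holomorphic_cn (ball z \<rho>) (g n)" for n
    by (rule holomorphic_cn_subset[OF g]) (auto simp: \<rho>_def)
  have "\<forall>n. \<exists>D. has_cderiv (g n) D z" using g r by (auto simp: holomorphic_cn_iff)
  then obtain D where D: "\<And>n. has_cderiv (g n) (D n) z" by metis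
  have DD: "cmod (D n h - D m h) \<le> 2 * (inverse (real (Suc n)) + inverse (real (Suc m))) / \<rho> * norm h" for n m h
  proof (rule quadratic_remainder(2)[OF _ _ has_cderiv_diff[OF D D] \<rho>])
    show "holomorphic_cn (ball z \<rho>) (\<lambda>u. g n u - g m u)"
      using g\<rho>[of n] g\<rho>[of m] has_cderiv_diff unfolding holomorphic_cn_iff by blast
    fix u assume "u \<in> ball z \<rho>"
    then have u: "u \<in> ball z r" by (simp add: \<rho>_def)
    show "cmod (g n u - g m u) \<le> inverse (real (Suc n)) + inverse (real (Suc m))"
      using fg[OF u, of n] fg[OF u, of m] norm_triangle_ineq4[of "f u - g m u" "f u - g n u"] by simp
  qed
  have "\<exists>d. (\<lambda>n. D n h) \<longlonglongrightarrow> d" for h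
  proof -
    have "Cauchy (\<lambda>n. D n h)"
    proof (rule metric_CauchyI)
      fix e :: real assume e: "e > 0"
      define c where "c = 4 / \<rho> * norm h + 1"
      have c: "c > 0" using \<rho> by (auto simp: c_def intro: add_nonneg_pos)
      obtain N where N: "inverse (real (Suc N)) < e / c" using reals_Archimedean[of "e/c"] e c by auto
      have "dist (D n h) (D m h) < e" if "n \<ge> N" "m \<ge> N" for n m
      proof -
        have "inverse (real (Suc n)) + inverse (real (Suc m)) \<le> 2 * inverse (real (Suc N))"
        proof -
          have "inverse (real (Suc k)) \<le> inverse (real (Suc N))" if "k \<ge> N" for k
            using that by (intro le_imp_inverse_le) auto
          from this[OF that(1)] this[OF that(2)] show ?thesis by linarith
        qed
        then have "(inverse (real (Suc n)) + inverse (real (Suc m))) * (2 / \<rho> * norm h)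
           \<le> (2 * inverse (real (Suc N))) * (2 / \<rho> * norm h)"
          using \<rho> by (intro mult_right_mono) auto
        also have "\<dots> \<le> c * inverse (real (Suc N))" by (simp add: c_def algebra_simps)
        also have "\<dots> < e" using N c by (simp add: field_simps)
        finally show ?thesis using DD[of n h m] by (simp add: dist_norm algebra_simps add_divide_distrib)
      qed
      then show "\<exists>M. \<forall>m\<ge>M. \<forall>n\<ge>M. dist (D m h) (D n h) < e" by blast
    qed
    then show ?thesis by (simp add: Cauchy_convergent_iff convergent_def)
  qed
  then obtain L where L: "\<And>h. (\<lambda>n. D n h) \<longlonglongrightarrow> L h" by metis
  have gz: "(\<lambda>n. g n u) \<longlonglongrightarrow> f u" if "u \<in> ball z r" for u
  proof -
    have "(\<lambda>n. g n u - f u) \<longlonglongrightarrow> 0"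
      by (rule Lim_null_comparison[OF _ LIMSEQ_inverse_real_of_nat]) (use fg[OF that] in \<open>simp add: norm_minus_commute\<close>)
    then show ?thesis by (simp add: LIM_zero_iff)
  qed
  have lin: "linear L"
  proof (rule linearI)
    fix x y :: "complex ^ 'a" and c :: real
    have "(\<lambda>n. D n (x + y)) \<longlonglongrightarrow> L x + L y"
      using tendsto_add[OF L[of x] L[of y]] by (simp add: linear_add[OF has_cderiv_linear[OF D]])
    then show "L (x + y) = L x + L y" using L LIMSEQ_unique by blast
    have "(\<lambda>n. D n (c *\<^sub>R x)) \<longlonglongrightarrow> c *\<^sub>R L x"
      using tendsto_scaleR[OF tendsto_const L[of x]] by (simp add: linear_cmul[OF has_cderiv_linear[OF D]])
    then show "L (c *\<^sub>R x) = c *\<^sub>R L x" using L LIMSEQ_unique by blast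
  qed
  have "L (c *s h) = c * L h" for c h
  proof -
    have "D n (c *s h) = c * D n h" for n using D by (auto simp: has_cderiv_def)
    then have "(\<lambda>n. D n (c *s h)) \<longlonglongrightarrow> c * L h"
      using tendsto_mult[OF tendsto_const L[of h]] by simp
    then show ?thesis using L LIMSEQ_unique by blast
  qed
  moreover have "(f has_derivative L) (at z)"
  proof (rule has_derivative_quadraticI[OF lin])
    show "\<rho> / 4 > 0" using \<rho> by simp
    fix h :: "complex ^ 'a" assume h: "norm h < \<rho> / 4"
    have "z + h \<in> ball z r" using h \<rho> by (simp add: \<rho>_def dist_norm)
    then have "(\<lambda>n. cmod (g n (z + h) - g n z - D n h)) \<longlonglongrightarrow> cmod (f (z + h) - f z - L h)"
      using r by (intro tendsto_intros gz L) auto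
    moreover have "cmod (g n (z + h) - g n z - D n h) \<le> 32 * B / \<rho>\<^sup>2 * (norm h)\<^sup>2" for n
      using h by (intro quadratic_remainder(1)[OF g\<rho> gB D \<rho>]) auto
    ultimately show "norm (f (z + h) - f z - L h) \<le> 32 * B / \<rho>\<^sup>2 * (norm h)\<^sup>2"
      by (intro LIMSEQ_le_const2) auto
  qed
  ultimately show "\<exists>D. has_cderiv f D z" by (auto simp: has_cderiv_def)
qed

section \<open>Closure properties of holomorphic functions and their partial derivatives\<close>

lemma holomorphic_cn_const: "holomorphic_cn S (\<lambda>z. c)"
  using has_cderiv_const by (auto simp: holomorphic_cn_iff)

lemma holomorphic_cn_component: "holomorphic_cn S (\<lambda>z. z $ l)"
  using has_cderiv_component by (auto simp: holomorphic_cn_iff)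

lemma holomorphic_cn_add: "holomorphic_cn S f \<Longrightarrow> holomorphic_cn S g \<Longrightarrow> holomorphic_cn S (\<lambda>z. f z + g z)"
  unfolding holomorphic_cn_iff using has_cderiv_add by blast

lemma holomorphic_cn_diff: "holomorphic_cn S f \<Longrightarrow> holomorphic_cn S g \<Longrightarrow> holomorphic_cn S (\<lambda>z. f z - g z)"
  unfolding holomorphic_cn_iff using has_cderiv_diff by blast

lemma holomorphic_cn_mult: "holomorphic_cn S f \<Longrightarrow> holomorphic_cn S g \<Longrightarrow> holomorphic_cn S (\<lambda>z. f z * g z)"
  unfolding holomorphic_cn_iff using has_cderiv_mult by blast

lemma holomorphic_cn_cmult: "holomorphic_cn S f \<Longrightarrow> holomorphic_cn S (\<lambda>z. c * f z)"
  by (intro holomorphic_cn_mult holomorphic_cn_const)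

lemma holomorphic_cn_sum:
  "(\<And>i. i \<in> I \<Longrightarrow> holomorphic_cn S (f i)) \<Longrightarrow> holomorphic_cn S (\<lambda>z. \<Sum>i\<in>I. f i z)"
  by (induction I rule: infinite_finite_induct) (auto intro: holomorphic_cn_add holomorphic_cn_const)

lemma holomorphic_cn_power: "holomorphic_cn S f \<Longrightarrow> holomorphic_cn S (\<lambda>z. f z ^ n)"
  by (induction n) (auto intro: holomorphic_cn_const holomorphic_cn_mult)

lemma holomorphic_cn_prod:
  "(\<And>i. i \<in> I \<Longrightarrow> holomorphic_cn S (f i)) \<Longrightarrow> holomorphic_cn S (\<lambda>z. \<Prod>i\<in>I. f i z)"
  by (induction I rule: infinite_finite_induct) (auto intro: holomorphic_cn_mult holomorphic_cn_const)

lemma locally_bounded: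
  assumes "open S" "isCont f z" "z \<in> S"
  obtains r B where "r > 0" "ball z r \<subseteq> S" "\<And>u. u \<in> ball z r \<Longrightarrow> cmod (f u) \<le> B"
proof -
  obtain \<delta> where \<delta>: "\<delta> > 0" "\<And>u. dist u z < \<delta> \<Longrightarrow> dist (f u) (f z) < 1"
    using assms(2) unfolding continuous_at_eps_delta by (metis zero_less_one)
  obtain \<epsilon> where \<epsilon>: "\<epsilon> > 0" "ball z \<epsilon> \<subseteq> S" using assms open_contains_ball by blast
  have "cmod (f u) \<le> cmod (f z) + 1" if "u \<in> ball z (min \<delta> \<epsilon>)" for u
    using \<delta>(2)[of u] that norm_triangle_sub[of "f u" "f z"]
    by (simp add: dist_commute[of z] dist_norm[of "f u"])
  moreover have "ball z (min \<delta> \<epsilon>) \<subseteq> S" using \<epsilon> by auto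
  ultimately show ?thesis using that[of "min \<delta> \<epsilon>" "cmod (f z) + 1"] \<delta> \<epsilon> by simp
qed

text \<open>Difference quotients in the direction \<open>l\<close> are holomorphic and, by the
  quadratic remainder bound, converge to the partial derivative uniformly on a smaller ball.\<close>

theorem holomorphic_cn_cpartial:
  assumes S: "open S" and f: "holomorphic_cn S f"
  shows "holomorphic_cn S (cpartial l f)"
proof (rule holomorphic_cn_limit)
  fix z assume z: "z \<in> S"
  obtain R B where R: "R > 0" "ball z R \<subseteq> S" and B: "\<And>u. u \<in> ball z R \<Longrightarrow> cmod (f u) \<le> B"
    using locally_bounded[OF S holomorphic_cn_isCont[OF f z] z] by blast
  \<comment> \<open>Half the radius keeps the balls of radius \<open>r\<close> about points of the
    smaller ball inside the ball on which \<open>f\<close> is bounded by \<open>B\<close>.\<close>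
  define r where "r = R / 2"
  have r: "r > 0" using R by (simp add: r_def)
  have near: "u + h \<in> ball z R" if "u \<in> ball z r" "norm h < r" for u h
    using that dist_triangle[of z "u + h" u] by (simp add: r_def dist_norm)
  have B0: "B \<ge> 0" using B[of z] R norm_ge_zero order_trans by (metis centre_in_ball)
  show "\<exists>r>0. \<forall>e>0. \<exists>g. holomorphic_cn (ball z r) g \<and> (\<forall>u\<in>ball z r. cmod (cpartial l f u - g u) \<le> e)"
  proof (intro exI conjI allI impI)
    show "r > 0" by fact
    fix e :: real assume e: "e > 0"
    define C where "C = 32 * B / r\<^sup>2 + 1"
    have C: "C > 0" using B0 r by (auto simp: C_def intro: add_nonneg_pos)
    \<comment> \<open>The remainder bound is valid up to \<open>r / 4\<close>, and the difference
      quotient with step \<open>s\<close> has an error of at most \<open>C * s\<close>.\<close>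
    define s where "s = min (r / 4) (e / C)"
    have s: "s > 0" "s \<le> r / 4" "s \<le> e / C"
      using r e C min.cobounded1[of "r / 4" "e / C"] min.cobounded2[of "r / 4" "e / C"]
      unfolding s_def[symmetric] by (auto simp: s_def)
    define h where "h = complex_of_real s *s (axis l 1 :: complex ^ 'a)"
    have nh: "norm h = s" using s by (simp add: h_def norm_vector_smult norm_axis_one)
    define g where "g u = (1 / of_real s) * (f (u + h) - f u)" for u
    have "holomorphic_cn (ball z r) (\<lambda>u. f (u + h))"
    proof -
      have "\<exists>D. has_cderiv f D (u + h)" if "u \<in> ball z r" for u
        using f near[of u h] that nh s r R by (auto simp: holomorphic_cn_iff)
      then show ?thesis unfolding holomorphic_cn_iff using has_cderiv_shift by blast
    qed
    moreover have "holomorphic_cn (ball z r) f"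
      using R near[of _ 0] r by (intro holomorphic_cn_subset[OF f]) auto
    ultimately show "holomorphic_cn (ball z r) g"
      unfolding g_def by (intro holomorphic_cn_cmult holomorphic_cn_diff)
    show "\<forall>u\<in>ball z r. cmod (cpartial l f u - g u) \<le> e"
    proof
      fix u assume u: "u \<in> ball z r"
      have sub: "ball u r \<subseteq> ball z R"
      proof
        fix v assume "v \<in> ball u r"
        then show "v \<in> ball z R" using near[OF u, of "v - u"] by (simp add: dist_norm norm_minus_commute)
      qed
      have "u \<in> S" using near[OF u, of 0] r R by auto
      then obtain D where D: "has_cderiv f D u" using f by (auto simp: holomorphic_cn_iff)
      have "cmod (f (u + h) - f u - D h) \<le> 32 * B / r\<^sup>2 * (norm h)\<^sup>2"
      proof (rule quadratic_remainder(1)[OF _ _ D r])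
        show "holomorphic_cn (ball u r) f" using f sub R by (auto intro: holomorphic_cn_subset)
      qed (use B sub s nh in auto)
      also have "\<dots> \<le> C * s\<^sup>2" unfolding nh C_def by (intro mult_right_mono) auto
      finally have *: "cmod (f (u + h) - f u - D h) \<le> C * s\<^sup>2" .
      have "D h = of_real s * cpartial l f u" using D unfolding h_def by (simp add: has_cderiv_def cpartial_eq[OF D])
      then have "cpartial l f u - g u = - ((f (u + h) - f u - D h) / of_real s)"
        using s by (simp add: g_def field_simps)
      then have "cmod (cpartial l f u - g u) = cmod (f (u + h) - f u - D h) / s"
        using s by (simp add: norm_divide)
      also have "\<dots> \<le> C * s" using * s by (simp add: field_simps power2_eq_square)
      also have "\<dots> \<le> e" using s C by (simp add: field_simps)
      finally show "cmod (cpartial l f u - g u) \<le> e" .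
    qed
  qed
qed

lemma has_cderiv_exists: "holomorphic_cn S f \<Longrightarrow> z \<in> S \<Longrightarrow> \<exists>D. has_cderiv f D z"
  by (auto simp: holomorphic_cn_iff)

lemma cpartial_cong:
  assumes "open S" "z \<in> S" "\<And>u. u \<in> S \<Longrightarrow> f u = g u"
  shows "cpartial l f z = cpartial l g z"
  unfolding cpartial_def
proof (rule deriv_cong_ev)
  show "\<forall>\<^sub>F \<zeta> in nhds (z $ l). f (coord_upd z l \<zeta>) = g (coord_upd z l \<zeta>)"
    using eventually_coord_upd_mem[OF assms(1,2)] by (rule eventually_mono) (rule assms(3))
qed simp

lemma cpartial_add:
  assumes "holomorphic_cn S f" "holomorphic_cn S g" "z \<in> S"
  shows "cpartial l (\<lambda>z. f z + g z) z = cpartial l f z + cpartial l g z"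
proof -
  obtain D D' where "has_cderiv f D z" "has_cderiv g D' z"
    using has_cderiv_exists assms by blast
  then show ?thesis using cpartial_eq[OF has_cderiv_add] by (simp add: cpartial_eq)
qed

lemma cpartial_mult:
  assumes "holomorphic_cn S f" "holomorphic_cn S g" "z \<in> S"
  shows "cpartial l (\<lambda>z. f z * g z) z = f z * cpartial l g z + cpartial l f z * g z"
proof -
  obtain D D' where "has_cderiv f D z" "has_cderiv g D' z"
    using has_cderiv_exists assms by blast
  then show ?thesis using cpartial_eq[OF has_cderiv_mult] by (simp add: cpartial_eq)
qed

lemma cpartial_cmult:
  assumes "holomorphic_cn S f" "z \<in> S"
  shows "cpartial l (\<lambda>z. c * f z) z = c * cpartial l f z"
  using cpartial_mult[OF holomorphic_cn_const assms(1,2), of l c] cpartial_eq[OF has_cderiv_const, of l c z] by simp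

text \<open>The first element of the list is the direction of the innermost derivative.\<close>

definition ipartial :: "'m::finite list \<Rightarrow> (complex ^ 'm \<Rightarrow> complex) \<Rightarrow> complex ^ 'm \<Rightarrow> complex" where
  "ipartial L f = fold cpartial L f"

lemma ipartial_Nil [simp]: "ipartial [] f = f"
  and ipartial_Cons [simp]: "ipartial (l # L) f = ipartial L (cpartial l f)"
  and ipartial_snoc: "ipartial (L @ [l]) f = cpartial l (ipartial L f)"
  by (simp_all add: ipartial_def)

lemma ipartial_cong:
  assumes "open S" "z \<in> S" "\<And>u. u \<in> S \<Longrightarrow> f u = g u"
  shows "ipartial L f z = ipartial L g z"
  using assms(3)
proof (induction L arbitrary: f g)
  case Nil
  then show ?case using assms(2) by simp
next
  case (Cons l L)
  have "cpartial l f u = cpartial l g u" if "u \<in> S" for u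
    using assms(1) that Cons.prems by (rule cpartial_cong)
  then show ?case unfolding ipartial_Cons by (rule Cons.IH)
qed

lemma holomorphic_ipartial: "open S \<Longrightarrow> holomorphic_cn S f \<Longrightarrow> holomorphic_cn S (ipartial L f)"
  by (induction L arbitrary: f) (auto intro: holomorphic_cn_cpartial)

lemma ipartial_add:
  assumes "open S" "holomorphic_cn S f" "holomorphic_cn S g" "z \<in> S"
  shows "ipartial L (\<lambda>z. f z + g z) z = ipartial L f z + ipartial L g z"
  using assms(2,3)
proof (induction L arbitrary: f g)
  case (Cons l L)
  have "ipartial L (cpartial l (\<lambda>z. f z + g z)) z = ipartial L (\<lambda>z. cpartial l f z + cpartial l g z) z"
    using assms(1,4) by (rule ipartial_cong) (rule cpartial_add[OF Cons.prems])
  then show ?case using Cons.IH[of "cpartial l f" "cpartial l g"] Cons.prems assms(1)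
    by (simp add: holomorphic_cn_cpartial)
qed simp

lemma ipartial_cmult:
  assumes "open S" "holomorphic_cn S f" "z \<in> S"
  shows "ipartial L (\<lambda>z. c * f z) z = c * ipartial L f z"
  using assms(2)
proof (induction L arbitrary: f)
  case (Cons l L)
  have "ipartial L (cpartial l (\<lambda>z. c * f z)) z = ipartial L (\<lambda>z. c * cpartial l f z) z"
    using assms(1,3) by (rule ipartial_cong) (rule cpartial_cmult[OF Cons.prems])
  then show ?case using Cons.IH[of "cpartial l f"] Cons.prems assms(1)
    by (simp add: holomorphic_cn_cpartial)
qed simp

lemma ipartial_sum:
  assumes "open S" "\<And>i. i \<in> I \<Longrightarrow> holomorphic_cn S (f i)" "z \<in> S"
  shows "ipartial L (\<lambda>z. \<Sum>i\<in>I. f i z) z = (\<Sum>i\<in>I. ipartial L (f i) z)"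
  using assms(2)
proof (induction I rule: infinite_finite_induct)
  case (insert i I)
  then show ?case
    using ipartial_add[OF assms(1) _ holomorphic_cn_sum[of I S f] assms(3), of "f i" L] by simp
qed (use ipartial_cmult[OF assms(1) holomorphic_cn_const assms(3), of L 0 0] in simp_all)

section \<open>Derivatives of monomial multiples at the centre of the monomial\<close>

definition monomial_at :: "complex ^ 'm \<Rightarrow> ('m::finite \<Rightarrow> nat) \<Rightarrow> complex ^ 'm \<Rightarrow> complex" where
  "monomial_at w \<gamma> z = (\<Prod>l\<in>UNIV. (z $ l - w $ l) ^ \<gamma> l)"

lemma holomorphic_monomial: "holomorphic_cn S (monomial_at w \<gamma>)"
  unfolding monomial_at_def[abs_def]
  by (intro holomorphic_cn_prod holomorphic_cn_power holomorphic_cn_diff holomorphic_cn_component holomorphic_cn_const)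

lemma monomial_at_zero [simp]: "monomial_at w (\<lambda>_. 0) z = 1"
  by (simp add: monomial_at_def)

lemma monomial_at_Suc: "monomial_at w (\<gamma>(l := Suc (\<gamma> l))) z = (z $ l - w $ l) * monomial_at w \<gamma> z"
proof -
  have "monomial_at w \<delta> z = (z $ l - w $ l) ^ \<delta> l * (\<Prod>j\<in>UNIV - {l}. (z $ j - w $ j) ^ \<delta> j)" for \<delta>
    unfolding monomial_at_def by (rule prod.remove) auto
  from this[of "\<gamma>(l := Suc (\<gamma> l))"] this[of \<gamma>] show ?thesis by simp
qed

lemma monomial_at_self: "monomial_at w \<gamma> w = (if \<gamma> = (\<lambda>_. 0) then 1 else 0)"
proof (cases "\<gamma> = (\<lambda>_. 0)")
  case False
  then obtain l where "\<gamma> l \<noteq> 0" by auto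
  then have "(w $ l - w $ l) ^ \<gamma> l = 0" by simp
  then show ?thesis using False unfolding monomial_at_def by (auto intro!: prod_zero)
qed simp

lemma cpartial_monomial:
  "cpartial l (monomial_at w \<gamma>) z = of_nat (\<gamma> l) * monomial_at w (\<gamma>(l := \<gamma> l - 1)) z"
proof -
  define P where "P = (\<Prod>j\<in>UNIV - {l}. (z $ j - w $ j) ^ \<gamma> j)"
  have split: "monomial_at w \<delta> u = (u $ l - w $ l) ^ \<delta> l * (\<Prod>j\<in>UNIV - {l}. (u $ j - w $ j) ^ \<delta> j)" for \<delta> u
    unfolding monomial_at_def by (rule prod.remove) auto
  have "monomial_at w \<gamma> (coord_upd z l \<zeta>) = (\<zeta> - w $ l) ^ \<gamma> l * P" for \<zeta>
    by (simp add: split P_def coord_upd_def)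
  then have "cpartial l (monomial_at w \<gamma>) z = deriv (\<lambda>\<zeta>. (\<zeta> - w $ l) ^ \<gamma> l * P) (z $ l)"
    by (simp add: cpartial_def)
  also have "\<dots> = of_nat (\<gamma> l) * (z $ l - w $ l) ^ (\<gamma> l - 1) * P"
    by (rule DERIV_imp_deriv) (auto intro!: derivative_eq_intros)
  also have "\<dots> = of_nat (\<gamma> l) * monomial_at w (\<gamma>(l := \<gamma> l - 1)) z"
    by (simp add: split P_def)
  finally show ?thesis .
qed

lemma prod_fact_pred:
  fixes \<gamma> :: "'m::finite \<Rightarrow> nat" assumes "\<gamma> l > 0"
  shows "(\<Prod>j\<in>UNIV. fact (\<gamma> j)) = of_nat (\<gamma> l) * (\<Prod>j\<in>UNIV. (fact ((\<gamma>(l := \<gamma> l - 1)) j) :: complex))"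
proof -
  have split: "(\<Prod>j\<in>UNIV. (fact (\<delta> j) :: complex)) = fact (\<delta> l) * (\<Prod>j\<in>UNIV - {l}. fact (\<delta> j))"
    for \<delta> :: "'m \<Rightarrow> nat" by (rule prod.remove) auto
  show ?thesis using assms
    by (subst split[of \<gamma>], subst split[of "\<gamma>(l := \<gamma> l - 1)"]) (simp add: fact_reduce)
qed

lemma sum_fun_upd_pred:
  fixes \<gamma> :: "'m::finite \<Rightarrow> nat" assumes "\<gamma> l > 0"
  shows "(\<Sum>j\<in>UNIV. \<gamma> j) = Suc (\<Sum>j\<in>UNIV. (\<gamma>(l := \<gamma> l - 1)) j)"
proof -
  have split: "(\<Sum>j\<in>UNIV. \<delta> j) = \<delta> l + (\<Sum>j\<in>UNIV - {l}. \<delta> j)" for \<delta> :: "'m \<Rightarrow> nat"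
    by (rule sum.remove) auto
  show ?thesis using assms by (subst split[of \<gamma>], subst split[of "\<gamma>(l := \<gamma> l - 1)"]) simp
qed

lemma sum_fun_upd_Suc:
  fixes \<gamma> :: "'m::finite \<Rightarrow> nat"
  shows "(\<Sum>j\<in>UNIV. (\<gamma>(l := Suc (\<gamma> l))) j) = Suc (\<Sum>j\<in>UNIV. \<gamma> j)"
  using sum_fun_upd_pred[of "\<gamma>(l := Suc (\<gamma> l))" l] by simp

lemma sum_count_list: "(\<Sum>j\<in>UNIV. count_list L j) = length (L :: 'm::finite list)"
proof (induction L)
  case (Cons a L)
  have "(\<Sum>j\<in>UNIV. count_list (a # L) j) = (\<Sum>j\<in>UNIV. (if a = j then 1 else 0) + count_list L j)"
    by (intro sum.cong) auto
  then show ?case using Cons by (simp add: sum.distrib)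
qed simp

text \<open>By the Leibniz rule each derivative hits the monomial or the cofactor. One that hits the
  cofactor leaves fewer derivatives than the degree of the monomial, so that term vanishes at
  \<open>w\<close>. The surviving term differentiates the monomial completely, and for it only the
  multiplicities in \<open>L\<close> matter, not the order.\<close>

theorem ipartial_monomial_mult:
  assumes S: "open S" "w \<in> S" and f: "holomorphic_cn S f" and "length L \<le> (\<Sum>l\<in>UNIV. \<gamma> l)"
  shows "ipartial L (\<lambda>z. monomial_at w \<gamma> z * f z) w =
     (if count_list L = \<gamma> then (\<Prod>l\<in>UNIV. fact (\<gamma> l)) * f w else 0)"
  using assms(3,4)
proof (induction L arbitrary: f \<gamma>)
  case Nil
  have "count_list [] = \<gamma> \<longleftrightarrow> \<gamma> = (\<lambda>_. 0)" by auto
  then show ?case by (auto simp: monomial_at_self)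
next
  case (Cons l L)
  have hf': "holomorphic_cn S (cpartial l f)" using Cons.prems S by (simp add: holomorphic_cn_cpartial)
  let ?\<gamma> = "\<gamma>(l := \<gamma> l - 1)"
  have "ipartial (l # L) (\<lambda>z. monomial_at w \<gamma> z * f z) w
      = ipartial L (\<lambda>z. of_nat (\<gamma> l) * (monomial_at w ?\<gamma> z * f z) + monomial_at w \<gamma> z * cpartial l f z) w"
    unfolding ipartial_Cons using S
    by (rule ipartial_cong)
      (simp add: cpartial_mult[OF holomorphic_monomial Cons.prems(1)] cpartial_monomial)
  also have "\<dots> = of_nat (\<gamma> l) * ipartial L (\<lambda>z. monomial_at w ?\<gamma> z * f z) w
      + ipartial L (\<lambda>z. monomial_at w \<gamma> z * cpartial l f z) w"
    using S Cons.prems hf' by (simp add: ipartial_add[of S] ipartial_cmult[of S] holomorphic_cn_mult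
       holomorphic_monomial holomorphic_cn_cmult)
  also have "ipartial L (\<lambda>z. monomial_at w \<gamma> z * cpartial l f z) w = 0"
  proof -
    have "count_list L \<noteq> \<gamma>" using Cons.prems(2) sum_count_list[of L] by auto
    then show ?thesis using Cons.IH[OF hf', of \<gamma>] Cons.prems(2) by simp
  qed
  also have "of_nat (\<gamma> l) * ipartial L (\<lambda>z. monomial_at w ?\<gamma> z * f z) w + 0
     = (if count_list (l # L) = \<gamma> then (\<Prod>l\<in>UNIV. fact (\<gamma> l)) * f w else 0)"
  proof (cases "\<gamma> l > 0")
    case True
    have "ipartial L (\<lambda>z. monomial_at w ?\<gamma> z * f z) w =
       (if count_list L = ?\<gamma> then (\<Prod>l\<in>UNIV. fact (?\<gamma> l)) * f w else 0)"
      using sum_fun_upd_pred[of \<gamma> l] True Cons.prems by (intro Cons.IH) auto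
    moreover have "count_list L = ?\<gamma> \<longleftrightarrow> count_list (l # L) = \<gamma>"
      using True by (auto simp: fun_eq_iff)
    ultimately show ?thesis using prod_fact_pred[of \<gamma> l] True by simp
  next
    \<comment> \<open>Here \<open>l\<close> occurs in the list but not in \<gamma>, and the Leibniz
      coefficient \<open>\<gamma> l\<close> is zero.\<close>
    case False
    then have "count_list (l # L) \<noteq> \<gamma>" by (metis count_list.simps(2) gr0I nat.distinct(1) One_nat_def add_Suc_right)
    then show ?thesis using False by simp
  qed
  finally show ?case .
qed

text \<open>The coordinates are reversed because \<open>foldr\<close> in \<open>multi_power\<close>
  applies the operators of the last coordinate first, whereas \<open>ipartial\<close> starts at the
  head of its list.\<close>

definition index_list :: "('m::finite \<Rightarrow> nat) \<Rightarrow> 'm list" where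
  "index_list \<alpha> = concat (map (\<lambda>l. replicate (\<alpha> l) l) (rev coord_enum))"

lemma coord_enum: "distinct (coord_enum :: 'm::finite list)" "set (coord_enum :: 'm list) = UNIV"
proof -
  have "\<exists>ls :: 'm list. distinct ls \<and> set ls = UNIV"
    using finite_distinct_list[of "UNIV :: 'm set"] by auto
  from someI_ex[OF this] show "distinct (coord_enum :: 'm list)" "set (coord_enum :: 'm list) = UNIV"
    unfolding coord_enum_def by auto
qed

lemma count_list_concat_replicate:
  "distinct ls \<Longrightarrow> count_list (concat (map (\<lambda>l. replicate (\<alpha> l) l) ls)) j = (if j \<in> set ls then \<alpha> j else 0)"
proof (induction ls)
  case (Cons l ls)
  have "count_list (replicate n l) j = (if j = l then n else 0)" for n by (induction n) auto
  then show ?case using Cons by auto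
qed simp

lemma count_index_list: "count_list (index_list \<alpha>) = \<alpha>"
  using coord_enum[where 'm = 'a] count_list_concat_replicate[of "rev coord_enum" \<alpha>]
  unfolding index_list_def by (intro ext) simp

lemma length_index_list: "length (index_list \<alpha>) = (\<Sum>l\<in>UNIV. \<alpha> l)"
  using sum_count_list[of "index_list \<alpha>"] by (simp add: count_index_list)

lemma multi_power_eq_fold: "multi_power P \<alpha> f = fold P (index_list \<alpha>) f"
proof -
  have "fold P (concat (map (\<lambda>l. replicate (\<alpha> l) l) ls)) = fold (\<lambda>l. P l ^^ \<alpha> l) ls" for ls
    by (induction ls) (auto simp: fun_eq_iff fold_replicate)
  then show ?thesis by (simp add: multi_power_def index_list_def foldr_conv_fold)
qed

lemma multi_power_cpartial: "multi_power cpartial \<alpha> f = ipartial (index_list \<alpha>) f"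
  by (simp add: multi_power_eq_fold ipartial_def)

text \<open>Conjugation on both sides turns the derivative in the conjugate variable into a
  holomorphic one. Together with the Hermitian symmetry of the kernel this reduces derivatives in
  the second variables to derivatives of kernel sections.\<close>

lemma cpartial_bar_cnj:
  assumes S: "open S" "w \<in> S" and f: "holomorphic_cn S f" and g: "\<And>u. u \<in> S \<Longrightarrow> g u = cnj (f u)"
  shows "cpartial_bar l g w = cnj (cpartial l f w)"
proof -
  define \<phi> where "\<phi> \<zeta> = f (coord_upd w l \<zeta>)" for \<zeta>
  obtain D where D: "has_cderiv f D w" using has_cderiv_exists[OF f S(2)] by blast
  have "(\<phi> has_field_derivative cpartial l f w) (at (w $ l))"
    unfolding \<phi>_def cpartial_eq[OF D] by (rule has_cderiv_coord[OF D])
  then have *: "((cnj \<circ> \<phi> \<circ> cnj) has_field_derivative cnj (cpartial l f w)) (at (cnj (w $ l)))"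
    by (intro has_field_derivative_cnj_cnj) simp
  have ev: "\<forall>\<^sub>F \<zeta> in nhds (cnj (w $ l)). coord_upd w l (cnj \<zeta>) \<in> S"
  proof -
    have "filterlim cnj (nhds (w $ l)) (nhds (cnj (w $ l)))"
      using tendsto_cnj[OF filterlim_ident[of "nhds (cnj (w $ l))"]] by simp
    then show ?thesis
      using eventually_compose_filterlim[OF eventually_coord_upd_mem[OF S, of l]] by blast
  qed
  have "cpartial_bar l g w = deriv (cnj \<circ> \<phi> \<circ> cnj) (cnj (w $ l))"
    unfolding cpartial_bar_def
    by (rule deriv_cong_ev) (use ev g in \<open>auto simp: \<phi>_def elim: eventually_mono\<close>)
  also have "\<dots> = cnj (cpartial l f w)" using * by (rule DERIV_imp_deriv)
  finally show ?thesis .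
qed

lemma multi_power_cpartial_bar_cnj:
  assumes S: "open S" "w \<in> S" and f: "holomorphic_cn S f" and g: "\<And>u. u \<in> S \<Longrightarrow> g u = cnj (f u)"
  shows "multi_power cpartial_bar \<beta> g w = cnj (ipartial (index_list \<beta>) f w)"
proof -
  have "fold cpartial_bar L g w = cnj (ipartial L f w)" for L
    using f g
  proof (induction L arbitrary: f g)
    case Nil
    then show ?case using S by simp
  next
    case (Cons l L)
    have "cpartial_bar l g u = cnj (cpartial l f u)" if "u \<in> S" for u
      using cpartial_bar_cnj[OF S(1) that Cons.prems] .
    then show ?case using Cons.IH[of "cpartial l f" "cpartial_bar l g"] Cons.prems(1) S
      by (simp add: holomorphic_cn_cpartial)
  qed
  then show ?thesis by (simp add: multi_power_eq_fold)
qed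

section \<open>Reproducing kernel Hilbert spaces and division\<close>

lemma hilbert_of_hilbert_function_space:
  assumes "hilbert_function_space H ip" shows "hilbert fscale H ip"
proof
  note d = assms[unfolded hilbert_function_space_def]
  show "0 \<in> H" using d by (elim conjE)
  fix f g h c
  show "f \<in> H \<Longrightarrow> g \<in> H \<Longrightarrow> f + g \<in> H" using d by (elim conjE) blast
  show "f \<in> H \<Longrightarrow> fscale c f \<in> H" using d by (elim conjE) blast
  show "f \<in> H \<Longrightarrow> g \<in> H \<Longrightarrow> h \<in> H \<Longrightarrow> ip (f + g) h = ip f h + ip g h" using d by (elim conjE) blast
  show "f \<in> H \<Longrightarrow> g \<in> H \<Longrightarrow> ip (fscale c f) g = c * ip f g" using d by (elim conjE) blast
  show "f \<in> H \<Longrightarrow> g \<in> H \<Longrightarrow> ip g f = cnj (ip f g)" using d by (elim conjE) blast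
  show "f \<in> H \<Longrightarrow> f \<noteq> 0 \<Longrightarrow> Re (ip f f) > 0" using d by (elim conjE) blast
next
  fix X :: "nat \<Rightarrow> 'a \<Rightarrow> 'b \<Rightarrow> complex"
  assume X: "\<And>n. X n \<in> H" and C: "\<And>e. e > 0 \<Longrightarrow> \<exists>N. \<forall>p\<ge>N. \<forall>q\<ge>N. hnorm ip (X p - X q) < e"
  have "\<forall>X. (\<forall>n::nat. X n \<in> H) \<and> (\<forall>e>0. \<exists>N. \<forall>p\<ge>N. \<forall>q\<ge>N. hnorm ip (X p - X q) < e) \<longrightarrow>
          (\<exists>f\<in>H. (\<lambda>n. hnorm ip (X n - f)) \<longlonglongrightarrow> 0)"
    using assms unfolding hilbert_function_space_def by (elim conjE)
  then have "(\<forall>n. X n \<in> H) \<and> (\<forall>e>0. \<exists>N. \<forall>p\<ge>N. \<forall>q\<ge>N. hnorm ip (X p - X q) < e) \<longrightarrow>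
          (\<exists>f\<in>H. (\<lambda>n. hnorm ip (X n - f)) \<longlonglongrightarrow> 0)"
    by (rule spec)
  then show "\<exists>f\<in>H. (\<lambda>n. hnorm ip (X n - f)) \<longlonglongrightarrow> 0"
    by (rule mp) (intro conjI allI impI X C)
qed (simp_all add: fscale_def fun_eq_iff algebra_simps)

lemma hilbert_function_spaceI:
  assumes "hilbert fscale H ip" shows "hilbert_function_space H ip"
proof -
  interpret hilbert fscale H ip by fact
  show ?thesis
    unfolding hilbert_function_space_def
  proof (intro conjI ballI allI impI)
    fix X :: "nat \<Rightarrow> 'a \<Rightarrow> 'b \<Rightarrow> complex"
    assume "(\<forall>n. X n \<in> H) \<and> (\<forall>e>0. \<exists>N. \<forall>p\<ge>N. \<forall>q\<ge>N. hnorm ip (X p - X q) < e)"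
    then show "\<exists>f\<in>H. (\<lambda>n. hnorm ip (X n - f)) \<longlonglongrightarrow> 0" by (intro complete) auto
  qed (rule zero_mem add_mem scl_mem ip_add_left ip_scl_left ip_cnj ip_pos; assumption)+
qed

lemma fscale_apply [simp]: "fscale c f z i = c * f z i"
  by (simp add: fscale_def)

lemma sum_apply1: "(\<Sum>a\<in>S. f a) z = (\<Sum>a\<in>S. f a z)"
  by (induction S rule: infinite_finite_induct) auto

lemma sum_apply2: "(\<Sum>a\<in>S. f a) z i = (\<Sum>a\<in>S. f a z i)"
  by (induction S rule: infinite_finite_induct) auto

section \<open>Adjoints and finite families of functionals\<close>

context hilbert
begin

text \<open>Riesz representation yields a vector with the adjoint property and inner products
  determine it, so the definite description denotes it.\<close>

lemma hadjoint:
  assumes T: "\<And>f. f \<in> H \<Longrightarrow> T f \<in> H"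
    and add: "\<And>f g. f \<in> H \<Longrightarrow> g \<in> H \<Longrightarrow> T (f + g) = T f + T g"
    and sc: "\<And>c f. f \<in> H \<Longrightarrow> T (scl c f) = scl c (T f)"
    and bd: "\<And>f. f \<in> H \<Longrightarrow> nrm (T f) \<le> C * nrm f" and f: "f \<in> H"
  shows "hadjoint H ip T f \<in> H" "\<And>h. h \<in> H \<Longrightarrow> ip (T h) f = ip h (hadjoint H ip T f)"
proof -
  obtain p where p: "p \<in> H" "\<And>h. h \<in> H \<Longrightarrow> ip (T h) f = ip h p"
  proof (rule riesz[of "\<lambda>h. ip (T h) f" "C * nrm f"])
    fix h assume h: "h \<in> H"
    have "cmod (ip (T h) f) \<le> nrm (T h) * nrm f" using cauchy_schwarz T h f by blast
    also have "\<dots> \<le> (C * nrm h) * nrm f" using bd[OF h] f by (intro mult_right_mono) auto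
    finally show "cmod (ip (T h) f) \<le> C * nrm f * nrm h" by (simp add: ac_simps)
  qed (auto simp: add sc T f ip_add_left ip_scl_left)
  have "hadjoint H ip T f = p"
    unfolding hadjoint_def
  proof (rule the_equality)
    fix g assume "g \<in> H \<and> (\<forall>h\<in>H. ip (T h) f = ip h g)"
    then show "g = p" using p by (intro eq_if_ip_eq) auto
  qed (use p in auto)
  then show "hadjoint H ip T f \<in> H" "\<And>h. h \<in> H \<Longrightarrow> ip (T h) f = ip h (hadjoint H ip T f)"
    using p by auto
qed

text \<open>Induction on \<open>J\<close>, passing to the kernel of one functional, for which
  \<open>V\<close> has to vary; a vector \<open>v\<close> outside that kernel fixes the missing
  coefficient. Applied to the evaluations at a point, it confines the joint kernel of the adjoints
  to the kernel sections.\<close>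

lemma functional_combination:
  assumes "finite J" and "\<And>f. f \<in> V \<Longrightarrow> (\<And>j. j \<in> J \<Longrightarrow> \<phi> j f = 0) \<Longrightarrow> \<psi> f = 0"
    and "\<And>f g. f \<in> V \<Longrightarrow> g \<in> V \<Longrightarrow> f + g \<in> V" "\<And>c f. f \<in> V \<Longrightarrow> scl c f \<in> V"
    and "\<And>j f g. f \<in> V \<Longrightarrow> g \<in> V \<Longrightarrow> \<phi> j (f + g) = \<phi> j f + (\<phi> j g :: complex)"
    and "\<And>j c f. f \<in> V \<Longrightarrow> \<phi> j (scl c f) = c * \<phi> j f"
    and "\<And>f g. f \<in> V \<Longrightarrow> g \<in> V \<Longrightarrow> \<psi> (f + g) = \<psi> f + \<psi> g" "\<And>c f. f \<in> V \<Longrightarrow> \<psi> (scl c f) = c * \<psi> f"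
  shows "\<exists>c. \<forall>f\<in>V. \<psi> f = (\<Sum>j\<in>J. c j * \<phi> j f)"
  using assms
proof (induction J arbitrary: V rule: finite_induct)
  case empty
  then show ?case by auto
next
  case (insert j J V)
  note prems = insert.prems
  let ?V = "{f\<in>V. \<phi> j f = 0}"
  have "\<exists>c. \<forall>f\<in>?V. \<psi> f = (\<Sum>j\<in>J. c j * \<phi> j f)"
  proof (rule insert.IH)
    fix f assume "f \<in> ?V" "\<And>i. i \<in> J \<Longrightarrow> \<phi> i f = 0"
    then show "\<psi> f = 0" by (intro prems(1)) auto
  qed (use prems in auto)
  then obtain c where c: "\<And>f. f \<in> V \<Longrightarrow> \<phi> j f = 0 \<Longrightarrow> \<psi> f = (\<Sum>j\<in>J. c j * \<phi> j f)" by auto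
  show ?case
  proof (cases "\<exists>v\<in>V. \<phi> j v \<noteq> 0")
    case False
    then have "\<psi> f = (\<Sum>i\<in>insert j J. c i * \<phi> i f)" if "f \<in> V" for f
      using c[OF that] that insert.hyps by simp
    then show ?thesis by blast
  next
    case True
    then obtain v where v: "v \<in> V" "\<phi> j v \<noteq> 0" by blast
    \<comment> \<open>Chosen so that the combination is correct at \<open>v\<close>; every
      \<open>f\<close> differs from a multiple of \<open>v\<close> by an element of the kernel of
      \<open>\<phi> j\<close>.\<close>
    define a where "a = (\<psi> v - (\<Sum>i\<in>J. c i * \<phi> i v)) / \<phi> j v"
    have "\<psi> f = (\<Sum>i\<in>insert j J. (c(j := a)) i * \<phi> i f)" if f: "f \<in> V" for f
    proof -
      define t where "t = - \<phi> j f / \<phi> j v"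
      define u where "u = f + scl t v"
      have tv: "scl t v \<in> V" using prems v by blast
      have u: "u \<in> V" using prems f tv by (auto simp: u_def)
      have \<phi>u: "\<phi> i u = \<phi> i f + t * \<phi> i v" for i using prems f v tv by (simp add: u_def)
      have "\<phi> j u = 0" using v by (simp add: \<phi>u t_def)
      then have "\<psi> u = (\<Sum>i\<in>J. c i * \<phi> i u)" by (rule c[OF u])
      moreover have "\<psi> u = \<psi> f + t * \<psi> v" using prems f v tv by (simp add: u_def)
      ultimately have "\<psi> f = (\<Sum>i\<in>J. c i * \<phi> i f) + t * ((\<Sum>i\<in>J. c i * \<phi> i v) - \<psi> v)"
        by (simp add: \<phi>u algebra_simps sum.distrib sum_distrib_left)
      also have "t * ((\<Sum>i\<in>J. c i * \<phi> i v) - \<psi> v) = a * \<phi> j f"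
        using v by (simp add: t_def a_def field_simps)
      finally have "\<psi> f = (\<Sum>i\<in>J. c i * \<phi> i f) + a * \<phi> j f" .
      moreover have "(\<Sum>i\<in>J. (c(j := a)) i * \<phi> i f) = (\<Sum>i\<in>J. c i * \<phi> i f)"
        using insert.hyps by (intro sum.cong) auto
      ultimately show ?thesis using insert.hyps by simp
    qed
    then show ?thesis by blast
  qed
qed

lemma nrm_sum_le: "(\<And>i. i \<in> S \<Longrightarrow> f i \<in> H) \<Longrightarrow> nrm (\<Sum>i\<in>S. f i) \<le> (\<Sum>i\<in>S. nrm (f i))"
proof (induction S rule: infinite_finite_induct)
  case (insert i S)
  then have "nrm (f i + (\<Sum>i\<in>S. f i)) \<le> nrm (f i) + nrm (\<Sum>i\<in>S. f i)"
    by (intro nrm_triangle sum_mem) auto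
  then show ?case using insert by fastforce
qed auto

end

locale rkhs =
  fixes \<Omega> :: "(complex ^ 'm::finite) set" and I :: "'i set" and K :: "('m, 'i) mkernel"
    and H :: "(complex ^ 'm \<Rightarrow> 'i \<Rightarrow> complex) set" and ip
  assumes open_domain: "open \<Omega>" and rkhs: "is_rkhs \<Omega> I K H ip"
begin

sublocale hilbert fscale H ip
  using rkhs hilbert_of_hilbert_function_space unfolding is_rkhs_def by blast

lemma holomorphic: "f \<in> H \<Longrightarrow> i \<in> I \<Longrightarrow> holomorphic_cn \<Omega> (\<lambda>z. f z i)"
  using rkhs unfolding is_rkhs_def by blast

lemma section_mem: "w \<in> \<Omega> \<Longrightarrow> kernel_section \<Omega> I K w \<eta> \<in> H"
  using rkhs unfolding is_rkhs_def by blast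

lemma reproducing: "w \<in> \<Omega> \<Longrightarrow> f \<in> H \<Longrightarrow> ip f (kernel_section \<Omega> I K w \<eta>) = (\<Sum>i\<in>I. f w i * cnj (\<eta> i))"
  using rkhs unfolding is_rkhs_def by blast

end

section \<open>Division at a point and the row of multiplication operators\<close>

locale rkhs_mult = rkhs +
  assumes mult_bounded: "\<And>l. bounded_operator H ip (mult_shift 0 l)"
begin

lemma mult_shift_eq: "mult_shift w l f = mult_shift 0 l f - fscale (w $ l) f"
  by (auto simp: mult_shift_def fun_eq_iff algebra_simps)

lemma mult_shift_mem: "f \<in> H \<Longrightarrow> mult_shift w l f \<in> H"
  using mult_bounded[of l] by (subst mult_shift_eq) (auto simp: bounded_operator_def intro!: mems)

lemma mult_shift_add: "mult_shift w l (f + g) = mult_shift w l f + mult_shift w l g"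
  by (auto simp: mult_shift_def fun_eq_iff algebra_simps)

lemma mult_shift_fscale: "mult_shift w l (fscale c f) = fscale c (mult_shift w l f)"
  by (auto simp: mult_shift_def fun_eq_iff algebra_simps)

lemma mult_shift_bound: "\<exists>C\<ge>0. \<forall>f\<in>H. nrm (mult_shift w l f) \<le> C * nrm f"
proof -
  obtain C where C: "\<And>f. f \<in> H \<Longrightarrow> nrm (mult_shift 0 l f) \<le> C * nrm f"
    using mult_bounded[of l] unfolding bounded_operator_def by blast
  have "nrm (mult_shift w l f) \<le> (\<bar>C\<bar> + cmod (w $ l)) * nrm f" if f: "f \<in> H" for f
  proof -
    have "nrm (mult_shift w l f) \<le> nrm (mult_shift 0 l f) + nrm (fscale (w $ l) f)"
      by (subst mult_shift_eq) (intro nrm_triangle_diff mult_shift_mem scl_mem f)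
    also have "\<dots> \<le> \<bar>C\<bar> * nrm f + cmod (w $ l) * nrm f"
      using order_trans[OF C[OF f] mult_right_mono[OF abs_ge_self nrm_ge0[OF f]]] f by (simp add: nrm_scl)
    finally show ?thesis by (simp add: algebra_simps)
  qed
  then show ?thesis by (intro exI[of _ "\<bar>C\<bar> + cmod (w $ l)"]) auto
qed

definition row :: "complex ^ 'a \<Rightarrow> ('a \<Rightarrow> complex ^ 'a \<Rightarrow> 'b \<Rightarrow> complex) \<Rightarrow> complex ^ 'a \<Rightarrow> 'b \<Rightarrow> complex" where
  "row w g = (\<Sum>l\<in>UNIV. mult_shift w l (g l))"

lemma row_apply: "row w g z i = (\<Sum>l\<in>UNIV. (z $ l - w $ l) * g l z i)"
  by (simp add: row_def sum_apply2 mult_shift_def)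

lemma D_mult_adj_mem: "f \<in> H \<Longrightarrow> D_mult_adj H ip w f l \<in> H"
  and ip_D_mult_adj: "f \<in> H \<Longrightarrow> h \<in> H \<Longrightarrow> ip (mult_shift w l h) f = ip h (D_mult_adj H ip w f l)"
proof -
  obtain C where C: "\<And>f. f \<in> H \<Longrightarrow> nrm (mult_shift w l f) \<le> C * nrm f" using mult_shift_bound by blast
  show "f \<in> H \<Longrightarrow> D_mult_adj H ip w f l \<in> H"
    "f \<in> H \<Longrightarrow> h \<in> H \<Longrightarrow> ip (mult_shift w l h) f = ip h (D_mult_adj H ip w f l)"
    unfolding D_mult_adj_def D_tuple_def
    using hadjoint[OF mult_shift_mem mult_shift_add mult_shift_fscale C] by blast+
qed

lemma row_adjoint_pair:
  "\<exists>c. adjoint_pair fscale H ip (l2_scl fscale) (l2_sum UNIV H ip) (l2_ip UNIV ip) (row w) (D_mult_adj H ip w) c"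
proof -
  interpret G: hilbert "l2_scl fscale" "l2_sum UNIV H ip" "l2_ip (UNIV :: 'a set) ip"
    by (rule hilbert_l2_sum)
  have "\<forall>l. \<exists>C\<ge>0. \<forall>f\<in>H. nrm (mult_shift w l f) \<le> C * nrm f" using mult_shift_bound by blast
  then obtain C where C0: "\<And>l. C l \<ge> 0" and C: "\<And>l f. f \<in> H \<Longrightarrow> nrm (mult_shift w l f) \<le> C l * nrm f" by metis
  show ?thesis
  proof (intro exI, unfold_locales)
    fix g assume g: "g \<in> l2_sum (UNIV :: 'a set) H ip"
    then have gl: "g l \<in> H" for l by (simp add: l2_sum_def)
    show "row w g \<in> H" unfolding row_def by (intro sum_mem mult_shift_mem gl)
    have "nrm (row w g) \<le> (\<Sum>l\<in>UNIV. nrm (mult_shift w l (g l)))"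
      unfolding row_def by (intro nrm_sum_le mult_shift_mem gl)
    also have "\<dots> \<le> (\<Sum>l\<in>UNIV. C l * G.nrm g)"
      using C[OF gl] C0 coord_le_l2_nrm[OF g]
      by (intro sum_mono) (meson UNIV_I mult_left_mono order_trans)
    finally show "nrm (row w g) \<le> (\<Sum>l\<in>UNIV. C l) * G.nrm g" by (simp add: sum_distrib_right)
    fix f assume f: "f \<in> H"
    show "ip (row w g) f = l2_ip UNIV ip g (D_mult_adj H ip w f)"
      unfolding row_def l2_ip_def using gl f by (simp add: ip_sum_left mult_shift_mem ip_D_mult_adj)
  next
    fix f assume "f \<in> H"
    then show "D_mult_adj H ip w f \<in> l2_sum (UNIV :: 'a set) H ip"
      by (simp add: l2_sum_def D_mult_adj_mem)
  qed
qed

text \<open>By the reproducing property a function vanishing at \<open>w\<close> is orthogonal to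
  all kernel sections at \<open>w\<close>, and by sharpness these make up the kernel of the tuple of
  adjoints. The closed range theorem solves for the quotients, each of which is bounded by the norm
  of the whole tuple.\<close>

theorem division_if_generalized_bergman:
  assumes ker: "{f \<in> H. D_mult_adj H ip w f = 0} = range (kernel_section \<Omega> I K w)"
    and cl: "hclosed (dsum_space H) (dsum_inner ip) (D_mult_adj H ip w ` H)" and w: "w \<in> \<Omega>"
  shows "\<exists>C\<ge>0. \<forall>f\<in>H. (\<forall>i\<in>I. f w i = 0) \<longrightarrow> (\<exists>g. (\<forall>l. g l \<in> H \<and> nrm (g l) \<le> C * nrm f) \<and> row w g = f)"
proof -
  obtain c where "adjoint_pair fscale H ip (l2_scl fscale) (l2_sum UNIV H ip) (l2_ip UNIV ip) (row w) (D_mult_adj H ip w) c"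
    using row_adjoint_pair by blast
  then interpret P: adjoint_pair fscale H ip "l2_scl fscale" "l2_sum UNIV H ip" "l2_ip UNIV ip" "row w" "D_mult_adj H ip w" c .
  obtain C where C: "C \<ge> 0" and sol: "\<And>f. f \<in> H \<Longrightarrow> (\<And>x. x \<in> H \<Longrightarrow> D_mult_adj H ip w x = 0 \<Longrightarrow> ip f x = 0)
      \<Longrightarrow> \<exists>y\<in>l2_sum UNIV H ip. row w y = f \<and> P.G.nrm y \<le> C * nrm f"
    using P.range_A_if_closed_range_D cl unfolding dsum_space_eq_l2_sum[of H ip] dsum_inner_eq_l2_ip by blast
  have "\<exists>g. (\<forall>l. g l \<in> H \<and> nrm (g l) \<le> C * nrm f) \<and> row w g = f"
    if f: "f \<in> H" and z: "\<forall>i\<in>I. f w i = 0" for f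
  proof -
    have "ip f x = 0" if "x \<in> H" "D_mult_adj H ip w x = 0" for x
    proof -
      have "x \<in> range (kernel_section \<Omega> I K w)" using that ker by blast
      then show ?thesis using z by (auto simp: reproducing w f)
    qed
    then obtain y where y: "y \<in> l2_sum UNIV H ip" "row w y = f" "P.G.nrm y \<le> C * nrm f"
      using sol[OF f] by blast
    then have "nrm (y l) \<le> C * nrm f" "y l \<in> H" for l
      using coord_le_l2_nrm[OF y(1), of l] l2_memD(1)[OF y(1), of l] by auto
    then show ?thesis using y(2) by (intro exI[of _ y]) simp
  qed
  then show ?thesis using C by blast
qed

text \<open>Values of \<open>row w\<close> vanish at \<open>w\<close>, so the adjoints annihilate
  kernel sections. Conversely, a vector annihilated by the adjoints is orthogonal to everything that
  vanishes at \<open>w\<close>; its functional is then a combination of the evaluations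
  \<open>f w i\<close>, and the vector is a kernel section. For the closed range, orthogonality to
  the sections means vanishing at \<open>w\<close>, hence membership in the range of
  \<open>row w\<close>.\<close>

theorem generalized_bergman_if_division:
  assumes w: "w \<in> \<Omega>" and I: "finite I"
    and div: "\<And>f. f \<in> H \<Longrightarrow> (\<And>i. i \<in> I \<Longrightarrow> f w i = 0) \<Longrightarrow> \<exists>g. (\<forall>l. g l \<in> H) \<and> row w g = f"
  shows "{f \<in> H. D_mult_adj H ip w f = 0} = range (kernel_section \<Omega> I K w)"
    and "hclosed (dsum_space H) (dsum_inner ip) (D_mult_adj H ip w ` H)"
proof -
  obtain c where "adjoint_pair fscale H ip (l2_scl fscale) (l2_sum UNIV H ip) (l2_ip UNIV ip) (row w) (D_mult_adj H ip w) c"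
    using row_adjoint_pair by blast
  then interpret P: adjoint_pair fscale H ip "l2_scl fscale" "l2_sum UNIV H ip" "l2_ip UNIV ip" "row w" "D_mult_adj H ip w" c .
  have sub: "D_mult_adj H ip w (kernel_section \<Omega> I K w \<eta>) = 0" for \<eta>
  proof (rule P.G.eq_if_ip_eq)
    fix y assume y: "y \<in> l2_sum (UNIV :: 'a set) H ip"
    have "row w y w i = 0" for i by (simp add: row_apply)
    then have "ip (row w y) (kernel_section \<Omega> I K w \<eta>) = 0"
      by (simp add: reproducing w P.A_mem y)
    then show "l2_ip UNIV ip y (D_mult_adj H ip w (kernel_section \<Omega> I K w \<eta>)) = l2_ip UNIV ip y 0"
      using P.adj[OF y section_mem[OF w]] y by simp
  qed (auto simp: P.D_mem section_mem w)
  have sup: "x \<in> range (kernel_section \<Omega> I K w)" if x: "x \<in> H" "D_mult_adj H ip w x = 0" for x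
  proof -
    have "ip f x = 0" if f: "f \<in> H" and z: "\<And>i. i \<in> I \<Longrightarrow> f w i = 0" for f
    proof -
      obtain g where g: "\<forall>l. g l \<in> H" "row w g = f" using div f z by blast
      then have "g \<in> l2_sum UNIV H ip" by (simp add: l2_sum_def)
      then show ?thesis using P.adj[of g x] x g by simp
    qed
    then have "\<exists>a. \<forall>f\<in>H. ip f x = (\<Sum>i\<in>I. a i * f w i)"
      using x by (intro functional_combination[OF I]) (auto simp: ip_simps mems)
    then obtain a where a: "\<And>f. f \<in> H \<Longrightarrow> ip f x = (\<Sum>i\<in>I. a i * f w i)" by blast
    \<comment> \<open>The coefficients are conjugated because the section stands in the antilinear
      argument of the inner product.\<close>
    have "x = kernel_section \<Omega> I K w (\<lambda>i. cnj (a i))"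
      by (rule eq_if_ip_eq) (auto simp: x section_mem w a reproducing mult.commute)
    then show ?thesis by blast
  qed
  show "{f \<in> H. D_mult_adj H ip w f = 0} = range (kernel_section \<Omega> I K w)"
    using sub sup section_mem[OF w] by auto
  show "hclosed (dsum_space H) (dsum_inner ip) (D_mult_adj H ip w ` H)"
    unfolding dsum_space_eq_l2_sum[of H ip] dsum_inner_eq_l2_ip
  proof (rule P.closed_range_D_if_range_A)
    fix f assume f: "f \<in> H" and o: "\<And>x. x \<in> H \<Longrightarrow> D_mult_adj H ip w x = 0 \<Longrightarrow> ip f x = 0"
    have "f w i = 0" if i: "i \<in> I" for i
    proof -
      have "(\<Sum>j\<in>I. f w j * cnj (if j = i then 1 else 0)) = 0"
        using o[OF section_mem[OF w] sub] by (simp add: reproducing w f)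
      then show ?thesis using I i by (simp add: if_distrib cong: if_cong)
    qed
    then obtain g where g: "\<forall>l. g l \<in> H" "row w g = f" using div f by blast
    then have "g \<in> l2_sum UNIV H ip" by (simp add: l2_sum_def)
    then show "\<exists>y\<in>l2_sum UNIV H ip. row w y = f" using g by blast
  qed
qed

end

section \<open>Jets of scalar reproducing kernel Hilbert spaces\<close>

locale scalar_rkhs = rkhs \<Omega> "UNIV :: unit set" "scalar_kernel K" H ip
  for \<Omega> :: "(complex ^ 'm::finite) set" and K H ip
begin

abbreviation sect :: "complex ^ 'm \<Rightarrow> complex ^ 'm \<Rightarrow> unit \<Rightarrow> complex" where
  "sect w \<equiv> kernel_section \<Omega> UNIV (scalar_kernel K) w (\<lambda>_. 1)"

lemma ip_sect: "w \<in> \<Omega> \<Longrightarrow> f \<in> H \<Longrightarrow> ip f (sect w) = f w ()"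
  using reproducing[of w f "\<lambda>_. 1"] by (simp add: UNIV_unit)

lemma sect_apply: "z \<in> \<Omega> \<Longrightarrow> sect w z i = K z w"
  by (simp add: kernel_section_def scalar_kernel_def UNIV_unit)

lemma ip_sect_sect: "z \<in> \<Omega> \<Longrightarrow> w \<in> \<Omega> \<Longrightarrow> ip (sect w) (sect z) = K z w"
  by (simp add: ip_sect section_mem sect_apply)

lemma hol: "f \<in> H \<Longrightarrow> holomorphic_cn \<Omega> (\<lambda>z. f z ())"
  by (rule holomorphic) auto

text \<open>Derivatives of bounded functionals are pointwise limits of difference quotients, hence bounded
  by the uniform boundedness principle.\<close>

lemma jet_exists: "w \<in> \<Omega> \<Longrightarrow> \<exists>k\<in>H. \<forall>f\<in>H. ip f k = ipartial L (\<lambda>z. f z ()) w"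
proof (induction L arbitrary: w rule: rev_induct)
  case Nil
  then show ?case using ip_sect section_mem by (intro bexI[of _ "sect w"]) auto
next
  case (snoc l L)
  have "\<forall>v. \<exists>k. v \<in> \<Omega> \<longrightarrow> k \<in> H \<and> (\<forall>f\<in>H. ip f k = ipartial L (\<lambda>z. f z ()) v)"
    using snoc.IH by blast
  then obtain k where k: "\<And>v. v \<in> \<Omega> \<Longrightarrow> k v \<in> H"
    and ipk: "\<And>v f. v \<in> \<Omega> \<Longrightarrow> f \<in> H \<Longrightarrow> ip f (k v) = ipartial L (\<lambda>z. f z ()) v" by metis
  obtain r where r: "r > 0" "ball w r \<subseteq> \<Omega>" using open_domain snoc.prems open_contains_ball by blast
  \<comment> \<open>The 2 makes even the initial step shorter than \<open>r\<close>, so that all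
    points stay in the ball.\<close>
  define t where "t n = r / (2 + real n)" for n
  have t: "t n > 0" "t n < r" for n using r by (auto simp: t_def field_simps add_pos_nonneg)
  have tlim: "(\<lambda>n. complex_of_real (t n)) \<longlonglongrightarrow> 0"
  proof -
    have "t \<longlonglongrightarrow> 0" unfolding t_def by real_asymp
    then show ?thesis using tendsto_of_real[of t 0 sequentially, where 'a = complex] by simp
  qed
  define v where "v n = w + of_real (t n) *s axis l 1" for n
  have v: "v n \<in> \<Omega>" for n
    using r t[of n] by (auto simp: v_def dist_norm norm_vector_smult norm_axis_one)
  define u where "u n = fscale (1 / of_real (t n)) (k (v n) - k w)" for n
  have u: "u n \<in> H" for n by (simp add: u_def k v snoc.prems mems)
  let ?d = "\<lambda>f. ipartial (L @ [l]) (\<lambda>z. f z ()) w"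
  have lim: "(\<lambda>n. ip f (u n)) \<longlonglongrightarrow> ?d f" if f: "f \<in> H" for f
  proof -
    let ?g = "ipartial L (\<lambda>z. f z ())"
    obtain D where D: "has_cderiv ?g D w"
      using has_cderiv_exists[OF holomorphic_ipartial[OF open_domain hol[OF f]] snoc.prems] by blast
    have "((\<lambda>t. ?g (w + t *s axis l 1)) has_field_derivative cpartial l ?g w) (at 0)"
      unfolding cpartial_eq[OF D] by (rule has_cderiv_line) (simp add: D)
    then have "((\<lambda>t. (?g (w + t *s axis l 1) - ?g w) / t) \<longlongrightarrow> cpartial l ?g w) (at 0)"
      by (simp add: has_field_derivative_iff)
    moreover have "filterlim (\<lambda>n. complex_of_real (t n)) (at 0) sequentially"
      using tlim t by (auto simp: filterlim_at less_imp_neq[symmetric])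
    ultimately have "(\<lambda>n. (?g (w + of_real (t n) *s axis l 1) - ?g w) / of_real (t n)) \<longlonglongrightarrow> cpartial l ?g w"
      by (rule filterlim_compose)
    moreover have "ip f (u n) = (?g (w + of_real (t n) *s axis l 1) - ?g w) / of_real (t n)" for n
      using f k v snoc.prems by (simp add: u_def ip_scl_right ip_diff_right ipk mems) (simp add: v_def)
    ultimately show ?thesis by (simp add: ipartial_snoc)
  qed
  have "\<exists>C\<ge>0. \<forall>x\<in>range u. nrm x \<le> C"
  proof (rule uniform_boundedness)
    fix f assume "f \<in> H"
    from lim[OF this] have "Bseq (\<lambda>n. ip f (u n))" using convergent_imp_Bseq convergentI by blast
    then show "\<exists>c. \<forall>x\<in>range u. cmod (ip f x) \<le> c" unfolding Bseq_def by auto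
  qed (use u in auto)
  then obtain C where C: "\<And>n. nrm (u n) \<le> C" by auto
  obtain p where "p \<in> H" "\<And>f. f \<in> H \<Longrightarrow> ?d f = ip f p"
  proof (rule riesz[of ?d C])
    fix f assume f: "f \<in> H"
    have "cmod (ip f (u n)) \<le> C * nrm f" for n
      using cauchy_schwarz[OF f u[of n]] mult_left_mono[OF C[of n] nrm_ge0[OF f]] by (simp add: mult.commute)
    then show "cmod (?d f) \<le> C * nrm f"
      using tendsto_norm[OF lim[OF f]] by (intro LIMSEQ_le_const2) auto
  next
    fix f g assume "f \<in> H" "g \<in> H"
    then show "?d (f + g) = ?d f + ?d g"
      using ipartial_add[OF open_domain hol hol snoc.prems] by simp
  next
    fix c f assume "f \<in> H"
    then show "?d (fscale c f) = c * ?d f"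
      using ipartial_cmult[OF open_domain hol snoc.prems] by simp
  qed blast
  then show ?case by (intro bexI[of _ p]) auto
qed

text \<open>As a function this is a derivative of the kernel section in the conjugates of its base
  point \<open>w\<close>; the proof of \<open>mixed_partial_eq\<close> makes this precise. Taking it
  as the vector representing a derivative functional gives access to norm estimates.\<close>

definition jet :: "complex ^ 'm \<Rightarrow> 'm list \<Rightarrow> complex ^ 'm \<Rightarrow> unit \<Rightarrow> complex" where
  "jet w L = (SOME k. k \<in> H \<and> (\<forall>f\<in>H. ip f k = ipartial L (\<lambda>z. f z ()) w))"

lemma jet_mem: "w \<in> \<Omega> \<Longrightarrow> jet w L \<in> H"
  and ip_jet: "w \<in> \<Omega> \<Longrightarrow> f \<in> H \<Longrightarrow> ip f (jet w L) = ipartial L (\<lambda>z. f z ()) w"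
  using someI_ex[of "\<lambda>k. k \<in> H \<and> (\<forall>f\<in>H. ip f k = ipartial L (\<lambda>z. f z ()) w)"] jet_exists[of w L]
  unfolding jet_def[symmetric] by (blast, blast)

lemma ip_jet_bounded:
  assumes f: "f \<in> H" and sub: "cball w r \<subseteq> \<Omega>"
  shows "\<exists>B. \<forall>z\<in>cball w r. cmod (ipartial L (\<lambda>z. f z ()) z) \<le> B"
proof -
  have "continuous_on (cball w r) (ipartial L (\<lambda>z. f z ()))"
    using holomorphic_cn_continuous_on[OF holomorphic_ipartial[OF open_domain hol[OF f]]] sub
    by (rule continuous_on_subset)
  then have "bounded (ipartial L (\<lambda>z. f z ()) ` cball w r)"
    by (intro compact_imp_bounded compact_continuous_image compact_cball)
  then show ?thesis by (auto simp: bounded_iff)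
qed

text \<open>Against a fixed \<open>f\<close> the jets give a continuous function, bounded on a
  compact ball; uniform boundedness turns this into a bound on their norms.\<close>

lemma jet_locally_bounded:
  assumes w: "w \<in> \<Omega>"
  obtains r C where "r > 0" "C \<ge> 0" "cball w r \<subseteq> \<Omega>" "\<And>z. z \<in> cball w r \<Longrightarrow> nrm (jet z L) \<le> C"
proof -
  obtain r where r: "r > 0" "cball w r \<subseteq> \<Omega>" using open_domain w open_contains_cball by blast
  have "\<exists>C\<ge>0. \<forall>x\<in>(\<lambda>z. jet z L) ` cball w r. nrm x \<le> C"
  proof (rule uniform_boundedness)
    fix f assume f: "f \<in> H"
    obtain B where "\<forall>z\<in>cball w r. cmod (ipartial L (\<lambda>z. f z ()) z) \<le> B"
      using ip_jet_bounded[OF f r(2)] by blast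
    then show "\<exists>c. \<forall>u\<in>(\<lambda>z. jet z L) ` cball w r. cmod (ip f u) \<le> c"
      using r f by (auto simp: ip_jet subset_iff)
  qed (use r in \<open>auto intro: jet_mem\<close>)
  then show ?thesis using that r by auto
qed

text \<open>The differential of the map taking \<open>w\<close> to \<open>jet w L\<close>. It is
  conjugate linear in \<open>h\<close> because representing vectors depend antiholomorphically on
  the point; each partial derivative is a jet with one more direction at the outer end of the
  list.\<close>

definition jet_deriv :: "complex ^ 'm \<Rightarrow> 'm list \<Rightarrow> complex ^ 'm \<Rightarrow> complex ^ 'm \<Rightarrow> unit \<Rightarrow> complex" where
  "jet_deriv w L h = (\<Sum>l\<in>UNIV. fscale (cnj (h $ l)) (jet w (L @ [l])))"

lemma jet_deriv_mem: "w \<in> \<Omega> \<Longrightarrow> jet_deriv w L h \<in> H"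
  by (auto simp: jet_deriv_def intro!: sum_mem scl_mem jet_mem)

lemma ip_jet_deriv_right:
  "w \<in> \<Omega> \<Longrightarrow> f \<in> H \<Longrightarrow> ip f (jet_deriv w L h) = (\<Sum>l\<in>UNIV. h $ l * ip f (jet w (L @ [l])))"
  by (simp add: jet_deriv_def ip_sum_right ip_scl_right scl_mem jet_mem)

lemma ip_jet_deriv_left:
  "w \<in> \<Omega> \<Longrightarrow> f \<in> H \<Longrightarrow> ip (jet_deriv w L h) f = (\<Sum>l\<in>UNIV. cnj (h $ l) * ip (jet w (L @ [l])) f)"
  by (simp add: jet_deriv_def ip_sum_left ip_scl_left scl_mem jet_mem)

lemma jet_deriv_bound:
  assumes "w \<in> \<Omega>"
  shows "nrm (jet_deriv w L h) \<le> (\<Sum>l\<in>UNIV. nrm (jet w (L @ [l]))) * norm h"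
proof -
  have "nrm (jet_deriv w L h) \<le> (\<Sum>l\<in>UNIV. nrm (fscale (cnj (h $ l)) (jet w (L @ [l]))))"
    unfolding jet_deriv_def using assms by (intro nrm_sum_le scl_mem jet_mem)
  also have "\<dots> \<le> (\<Sum>l\<in>UNIV. norm h * nrm (jet w (L @ [l])))"
    using assms by (intro sum_mono) (simp add: nrm_scl jet_mem mult_right_mono Finite_Cartesian_Product.norm_nth_le)
  finally show ?thesis by (simp add: sum_distrib_left mult.commute)
qed

text \<open>The remainders of second order are weakly bounded by the Cauchy estimates, hence bounded in norm.\<close>

lemma jet_differentiable:
  assumes w: "w \<in> \<Omega>"
  obtains r C where "r > 0" "C \<ge> 0" "\<And>h. norm h < r \<Longrightarrow> w + h \<in> \<Omega>"
    "\<And>h. norm h < r \<Longrightarrow> nrm (jet (w + h) L - jet w L - jet_deriv w L h) \<le> C * (norm h)\<^sup>2"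
proof -
  obtain \<rho> where \<rho>: "\<rho> > 0" "cball w \<rho> \<subseteq> \<Omega>" using open_domain w open_contains_cball by blast
  define r where "r = \<rho> / 4"
  have r: "r > 0" "r \<le> \<rho> / 4" using \<rho> by (auto simp: r_def)
  have in\<Omega>: "w + h \<in> \<Omega>" if "norm h < r" for h
    using that \<rho> r by (intro subsetD[OF \<rho>(2)]) (auto simp: dist_norm)
  let ?R = "\<lambda>h. jet (w + h) L - jet w L - jet_deriv w L h"
  define U where "U = {fscale (of_real (1 / (norm h)\<^sup>2)) (?R h) |h. h \<noteq> 0 \<and> norm h < r}"
  have R: "?R h \<in> H" if "norm h < r" for h using in\<Omega>[OF that] w by (intro mems jet_mem jet_deriv_mem)
  have "\<exists>C\<ge>0. \<forall>x\<in>U. nrm x \<le> C"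
  proof (rule uniform_boundedness)
    show "U \<subseteq> H" using R by (auto simp: U_def intro: scl_mem)
    fix f assume f: "f \<in> H"
    let ?g = "ipartial L (\<lambda>z. f z ())"
    obtain B where B: "\<And>z. z \<in> cball w \<rho> \<Longrightarrow> cmod (?g z) \<le> B" using ip_jet_bounded[OF f \<rho>(2)] by blast
    have hg: "holomorphic_cn \<Omega> ?g" by (rule holomorphic_ipartial[OF open_domain hol[OF f]])
    obtain D where D: "has_cderiv ?g D w" using has_cderiv_exists[OF hg w] by blast
    have "cmod (ip f x) \<le> 32 * B / \<rho>\<^sup>2" if x: "x \<in> U" for x
    proof -
      obtain h where h: "h \<noteq> 0" "norm h < r" "x = fscale (of_real (1 / (norm h)\<^sup>2)) (?R h)"
        using x by (auto simp: U_def)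
      have "ip f (?R h) = ?g (w + h) - ?g w - D h"
        using in\<Omega>[OF h(2)] w f
        by (simp add: ip_diff_right jet_mem jet_deriv_mem diff_mem ip_jet ip_jet_deriv_right
             has_cderiv_eq_sum[OF D] ipartial_snoc)
      also have "cmod \<dots> \<le> 32 * B / \<rho>\<^sup>2 * (norm h)\<^sup>2"
        using h(2) r B \<rho> by (intro quadratic_remainder(1)[OF holomorphic_cn_subset[OF hg] _ D \<rho>(1)]) auto
      finally show ?thesis
        using h R[OF h(2)] f by (simp add: ip_scl_right norm_divide norm_mult field_simps norm_power)
    qed
    then show "\<exists>c. \<forall>u\<in>U. cmod (ip f u) \<le> c" by blast
  qed
  then obtain C where C: "C \<ge> 0" "\<And>x. x \<in> U \<Longrightarrow> nrm x \<le> C" by blast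
  have "nrm (?R h) \<le> C * (norm h)\<^sup>2" if h: "norm h < r" for h
  proof (cases "h = 0")
    case True
    then show ?thesis by (simp add: jet_deriv_def)
  next
    case False
    then have "nrm (fscale (of_real (1 / (norm h)\<^sup>2)) (?R h)) \<le> C" using h by (intro C) (auto simp: U_def)
    then show ?thesis using False R[OF h] by (simp add: nrm_scl norm_divide norm_power field_simps)
  qed
  then show ?thesis using that r C in\<Omega> by blast
qed

text \<open>A product rule for two maps that are differentiable in norm; joint differentiability is
  the reason for working in norm. Both jets are antiholomorphic in their base points, so the first
  slot contributes a conjugate linear term in \<open>w\<close>, while the conjugation in the second
  slot makes the term in \<open>z\<close> linear.\<close>

lemma sesqui_analytic_ip_jet: "sesqui_analytic \<Omega> (\<lambda>z w. ip (jet w M) (jet z L))"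
  unfolding sesqui_analytic_def
proof (intro ballI)
  fix z w assume z: "z \<in> \<Omega>" and w: "w \<in> \<Omega>"
  obtain r1 C1 where r1: "r1 > 0" "C1 \<ge> 0" and in1: "\<And>h. norm h < r1 \<Longrightarrow> z + h \<in> \<Omega>"
    and est1: "\<And>h. norm h < r1 \<Longrightarrow> nrm (jet (z + h) L - jet z L - jet_deriv z L h) \<le> C1 * (norm h)\<^sup>2"
    using jet_differentiable[OF z, of L] by blast
  obtain r2 C2 where r2: "r2 > 0" "C2 \<ge> 0" and in2: "\<And>h. norm h < r2 \<Longrightarrow> w + h \<in> \<Omega>"
    and est2: "\<And>h. norm h < r2 \<Longrightarrow> nrm (jet (w + h) M - jet w M - jet_deriv w M h) \<le> C2 * (norm h)\<^sup>2"
    using jet_differentiable[OF w, of M] by blast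
  define D where "D p = ip (jet_deriv w M (snd p)) (jet z L) + ip (jet w M) (jet_deriv z L (fst p))" for p
  have D: "D p = (\<Sum>l\<in>UNIV. cnj (snd p $ l) * ip (jet w (M @ [l])) (jet z L))
      + (\<Sum>l\<in>UNIV. fst p $ l * ip (jet w M) (jet z (L @ [l])))" for p
    using z w by (simp add: D_def ip_jet_deriv_left ip_jet_deriv_right jet_mem)
  have lin: "linear D"
    by (rule linearI) (simp_all add: D algebra_simps sum.distrib scaleR_sum_right)
  define A1 A2 where "A1 = (\<Sum>l\<in>UNIV. nrm (jet z (L @ [l])))" and "A2 = (\<Sum>l\<in>UNIV. nrm (jet w (M @ [l])))"
  have A: "A1 \<ge> 0" "A2 \<ge> 0" using z w by (auto simp: A1_def A2_def intro!: sum_nonneg nrm_ge0 jet_mem)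
  define N1 where "N1 = nrm (jet z L) + C1 + A1"
  \<comment> \<open>One summand for each term of the decomposition (u' - u - du) v' + u (v' - v -
    dv) + du (v' - v) of the remainder below. The bound \<open>N1\<close> on v' uses increments of
    norm at most 1, hence the 1 in \<open>d\<close>.\<close>
  define C where "C = C2 * N1 + nrm (jet w M) * C1 + A2 * (C1 + A1)"
  define d where "d = min 1 (min r1 r2)"
  have "((\<lambda>(x, y). ip (jet y M) (jet x L)) has_derivative D) (at (z, w))"
  proof (rule has_derivative_quadraticI[OF lin])
    show "d > 0" using r1 r2 by (simp add: d_def)
    fix p :: "(complex ^ 'm) \<times> (complex ^ 'm)" assume p: "norm p < d"
    obtain h k where hk: "p = (h, k)" by (cases p)
    have nh: "norm h \<le> norm p" "norm k \<le> norm p" using norm_fst_le[of h k] norm_snd_le[of k h] hk by auto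
    have small: "norm h < r1" "norm k < r2" "norm h \<le> 1" "norm p \<le> 1" using nh p by (auto simp: d_def)
    define v v' dv where "v = jet z L" and "v' = jet (z + h) L" and "dv = jet_deriv z L h"
    define u u' du where "u = jet w M" and "u' = jet (w + k) M" and "du = jet_deriv w M k"
    have mem: "v \<in> H" "v' \<in> H" "dv \<in> H" "u \<in> H" "u' \<in> H" "du \<in> H"
      using z w in1[OF small(1)] in2[OF small(2)]
      by (auto simp: v_def v'_def dv_def u_def u'_def du_def intro: jet_mem jet_deriv_mem)
    have e1: "nrm (v' - v - dv) \<le> C1 * (norm p)\<^sup>2"
      using est1[OF small(1)] mult_left_mono[OF power_mono[OF nh(1) norm_ge_zero, of 2] r1(2)]
      by (simp add: v_def v'_def dv_def)
    have e2: "nrm (u' - u - du) \<le> C2 * (norm p)\<^sup>2"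
      using est2[OF small(2)] mult_left_mono[OF power_mono[OF nh(2) norm_ge_zero, of 2] r2(2)]
      by (simp add: u_def u'_def du_def)
    have e3: "nrm dv \<le> A1 * norm p"
      using jet_deriv_bound[OF z, of L h] mult_left_mono[OF nh(1) A(1)] by (simp add: dv_def A1_def)
    have e4: "nrm du \<le> A2 * norm p"
      using jet_deriv_bound[OF w, of M k] mult_left_mono[OF nh(2) A(2)] by (simp add: du_def A2_def)
    have pp: "(norm p)\<^sup>2 \<le> norm p" using small(4) by (simp add: power2_eq_square mult_left_le)
    have e5: "nrm (v' - v) \<le> (C1 + A1) * norm p"
    proof -
      have "nrm (v' - v) \<le> nrm (v' - v - dv) + nrm dv"
        using nrm_triangle[of "v' - v - dv" dv] mem by (simp add: diff_mem)
      also have "\<dots> \<le> C1 * norm p + A1 * norm p"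
        using e1 e3 mult_left_mono[OF pp r1(2)] by linarith
      finally show ?thesis by (simp add: algebra_simps)
    qed
    have e6: "nrm v' \<le> N1"
    proof -
      have "nrm v' \<le> nrm (v' - v) + nrm v" using nrm_triangle[of "v' - v" v] mem by (simp add: diff_mem)
      also have "\<dots> \<le> (C1 + A1) * 1 + nrm v"
        using e5 mult_left_mono[OF small(4), of "C1 + A1"] r1 A by linarith
      finally show ?thesis by (simp add: N1_def v_def)
    qed
    have "ip u' v' - ip u v - (ip du v + ip u dv) = ip (u' - u - du) v' + ip u (v' - v - dv) + ip du (v' - v)"
      using mem by (simp add: ip_diff_left ip_diff_right diff_mem)
    moreover have "cmod (ip (u' - u - du) v') \<le> C2 * (norm p)\<^sup>2 * N1"
      using cauchy_schwarz[of "u' - u - du" v'] mult_mono[OF e2 e6] mem r2 by (simp add: diff_mem)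
    moreover have "cmod (ip u (v' - v - dv)) \<le> nrm u * (C1 * (norm p)\<^sup>2)"
      using cauchy_schwarz[of u "v' - v - dv"] mult_left_mono[OF e1, of "nrm u"] mem by (simp add: diff_mem)
    moreover have "cmod (ip du (v' - v)) \<le> (A2 * norm p) * ((C1 + A1) * norm p)"
      using cauchy_schwarz[of du "v' - v"] mult_mono[OF e4 e5] mem A by (simp add: diff_mem)
    moreover have "cmod (a + b + c) \<le> cmod a + cmod b + cmod c" for a b c
      using norm_triangle_ineq[of "a + b" c] norm_triangle_ineq[of a b] by linarith
    ultimately have "cmod (ip u' v' - ip u v - (ip du v + ip u dv))
        \<le> C2 * (norm p)\<^sup>2 * N1 + nrm u * (C1 * (norm p)\<^sup>2) + (A2 * norm p) * ((C1 + A1) * norm p)"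
      by (smt (verit))
    also have "\<dots> = C * (norm p)\<^sup>2" by (simp add: C_def u_def algebra_simps power2_eq_square)
    finally show "norm ((case (z, w) + p of (x, y) \<Rightarrow> ip (jet y M) (jet x L)) - (case (z, w) of (x, y) \<Rightarrow> ip (jet y M) (jet x L)) - D p)
        \<le> C * (norm p)\<^sup>2"
      by (simp add: hk D_def u_def u'_def du_def v_def v'_def dv_def)
  qed
  moreover have "D (c *s h, 0) = c * D (h, 0)" for c h
    by (simp add: D sum_distrib_left mult.assoc)
  moreover have "D (0, c *s h) = cnj c * D (0, h)" for c h
    by (simp add: D sum_distrib_left mult.assoc)
  ultimately show "\<exists>D. ((\<lambda>(x, y). ip (jet y M) (jet x L)) has_derivative D) (at (z, w)) \<and>
        (\<forall>c h. D (c *s h, 0) = c * D (h, 0)) \<and> (\<forall>c h. D (0, c *s h) = cnj c * D (0, h))" by blast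
qed

text \<open>By Hermitian symmetry \<open>K x\<close> is the conjugate of the section at
  \<open>x\<close>, whose derivatives at \<open>w\<close> are inner products with a jet. As a
  function of \<open>x\<close> the result is the jet itself, to which the derivatives in the first
  variables apply.\<close>

lemma mixed_partial_eq:
  assumes z: "z \<in> \<Omega>" and w: "w \<in> \<Omega>"
  shows "mixed_partial \<alpha> \<beta> K z w = ip (jet w (index_list \<beta>)) (jet z (index_list \<alpha>))"
proof -
  have inner: "multi_power cpartial_bar \<beta> (K x) w = jet w (index_list \<beta>) x ()" if x: "x \<in> \<Omega>" for x
  proof -
    have sx: "sect x \<in> H" by (rule section_mem[OF x])
    have "K x u = cnj (sect x u ())" if u: "u \<in> \<Omega>" for u
      using ip_sect_sect[OF x u] ip_sect_sect[OF u x] ip_cnj[OF sx section_mem[OF u]] sect_apply[OF u] by simp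
    then have "multi_power cpartial_bar \<beta> (K x) w = cnj (ipartial (index_list \<beta>) (\<lambda>u. sect x u ()) w)"
      by (rule multi_power_cpartial_bar_cnj[OF open_domain w hol[OF sx]])
    also have "\<dots> = ip (jet w (index_list \<beta>)) (sect x)"
      using ip_cnj[OF sx jet_mem[OF w]] by (simp add: ip_jet w sx)
    finally show ?thesis by (simp add: ip_sect x jet_mem w)
  qed
  have "mixed_partial \<alpha> \<beta> K z w = ipartial (index_list \<alpha>) (\<lambda>x. multi_power cpartial_bar \<beta> (K x) w) z"
    by (simp add: mixed_partial_def multi_power_cpartial)
  also have "\<dots> = ipartial (index_list \<alpha>) (\<lambda>x. jet w (index_list \<beta>) x ()) z"
    by (rule ipartial_cong[OF open_domain z inner])
  finally show ?thesis by (simp add: ip_jet z w jet_mem)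
qed

end

lemma sesqui_analytic_cong:
  assumes S: "open S" and eq: "\<And>z w. z \<in> S \<Longrightarrow> w \<in> S \<Longrightarrow> F z w = G z w" and F: "sesqui_analytic S F"
  shows "sesqui_analytic S G"
  unfolding sesqui_analytic_def
proof (intro ballI)
  fix z w assume zw: "z \<in> S" "w \<in> S"
  then obtain D where D: "((\<lambda>(x, y). F x y) has_derivative D) (at (z, w))"
    "\<forall>c h. D (c *s h, 0) = c * D (h, 0)" "\<forall>c h. D (0, c *s h) = cnj c * D (0, h)"
    using F unfolding sesqui_analytic_def by blast
  have "((\<lambda>(x, y). G x y) has_derivative D) (at (z, w))"
    by (rule has_derivative_transform_within_open[OF D(1) open_Times[OF S S]]) (use zw eq in auto)
  then show "\<exists>D. ((\<lambda>(x, y). G x y) has_derivative D) (at (z, w)) \<and>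
        (\<forall>c h. D (c *s h, 0) = c * D (h, 0)) \<and> (\<forall>c h. D (0, c *s h) = cnj c * D (0, h))"
    using D by blast
qed

lemma sesqui_analytic_mult:
  assumes F: "sesqui_analytic S F" and G: "sesqui_analytic S G"
  shows "sesqui_analytic S (\<lambda>z w. F z w * G z w)"
  unfolding sesqui_analytic_def
proof (intro ballI)
  fix z w assume zw: "z \<in> S" "w \<in> S"
  obtain D where D: "((\<lambda>(x, y). F x y) has_derivative D) (at (z, w))"
    "\<And>c h. D (c *s h, 0) = c * D (h, 0)" "\<And>c h. D (0, c *s h) = cnj c * D (0, h)"
    using F zw unfolding sesqui_analytic_def by blast
  obtain D' where D': "((\<lambda>(x, y). G x y) has_derivative D') (at (z, w))"
    "\<And>c h. D' (c *s h, 0) = c * D' (h, 0)" "\<And>c h. D' (0, c *s h) = cnj c * D' (0, h)"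
    using G zw unfolding sesqui_analytic_def by blast
  have "((\<lambda>p. (case p of (x, y) \<Rightarrow> F x y) * (case p of (x, y) \<Rightarrow> G x y)) has_derivative
      (\<lambda>p. F z w * D' p + D p * G z w)) (at (z, w))"
    using has_derivative_mult[OF D(1) D'(1)] by simp
  then show "\<exists>D. ((\<lambda>(x, y). F x y * G x y) has_derivative D) (at (z, w)) \<and>
        (\<forall>c h. D (c *s h, 0) = c * D (h, 0)) \<and> (\<forall>c h. D (0, c *s h) = cnj c * D (0, h))"
    by (intro exI[of _ "\<lambda>p. F z w * D' p + D p * G z w"])
      (auto simp: D D' case_prod_beta' algebra_simps)
qed

section \<open>Division to higher order\<close>

definition mono_mult :: "complex ^ 'm::finite \<Rightarrow> ('m \<Rightarrow> nat) \<Rightarrow> (complex ^ 'm \<Rightarrow> 'i \<Rightarrow> complex) \<Rightarrow> (complex ^ 'm \<Rightarrow> 'i \<Rightarrow> complex)" where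
  "mono_mult w \<gamma> f = (\<lambda>z i. monomial_at w \<gamma> z * f z i)"

lemma mono_mult_zero: "mono_mult w (\<lambda>_. 0) f = f"
  by (simp add: mono_mult_def)

lemma mono_mult_Suc: "mono_mult w (\<gamma>(l := Suc (\<gamma> l))) f = mult_shift w l (mono_mult w \<gamma> f)"
  by (simp add: mono_mult_def mult_shift_def monomial_at_Suc mult.assoc)

lemma multi_index_induct [case_names zero Suc]:
  fixes \<gamma> :: "'m::finite \<Rightarrow> nat"
  assumes zero: "P (\<lambda>_. 0)" and Suc: "\<And>\<gamma> l. P \<gamma> \<Longrightarrow> P (\<gamma>(l := Suc (\<gamma> l)))"
  shows "P \<gamma>"
proof (induction "\<Sum>l\<in>UNIV. \<gamma> l" arbitrary: \<gamma>)
  case 0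
  then have "\<gamma> = (\<lambda>_. 0)" by (auto simp: fun_eq_iff)
  then show ?case using zero by simp
next
  case (Suc n)
  then obtain l where l: "\<gamma> l > 0" by (metis gr0I sum.neutral nat.distinct(1))
  have "P (\<gamma>(l := \<gamma> l - 1))" using sum_fun_upd_pred[of \<gamma> l] l Suc.hyps by (intro Suc.hyps(1)) simp
  then have "P ((\<gamma>(l := \<gamma> l - 1))(l := Suc ((\<gamma>(l := \<gamma> l - 1)) l)))" by (rule assms(2))
  moreover have "(\<gamma>(l := \<gamma> l - 1))(l := Suc ((\<gamma>(l := \<gamma> l - 1)) l)) = \<gamma>" using l by (simp add: fun_eq_iff)
  ultimately show ?case by simp
qed

lemma finite_multi_indices: "finite (multi_indices k :: ('m::finite \<Rightarrow> nat) set)"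
proof (rule finite_subset)
  show "multi_indices k \<subseteq> (UNIV :: 'm set) \<rightarrow>\<^sub>E {..k}"
  proof
    fix \<alpha> :: "'m \<Rightarrow> nat" assume "\<alpha> \<in> multi_indices k"
    then have "\<alpha> l \<le> k" for l
      using member_le_sum[of l UNIV \<alpha>] by (simp add: multi_indices_def)
    then show "\<alpha> \<in> UNIV \<rightarrow>\<^sub>E {..k}" by (auto simp: PiE_def)
  qed
qed (auto intro: finite_PiE)

definition multi_indices_of_degree :: "nat \<Rightarrow> ('m::finite \<Rightarrow> nat) set" where
  "multi_indices_of_degree n = {\<gamma>. (\<Sum>l\<in>UNIV. \<gamma> l) = n}"

lemma finite_multi_indices_of_degree: "finite (multi_indices_of_degree n)"
  by (rule finite_subset[OF _ finite_multi_indices[of n]]) (auto simp: multi_indices_of_degree_def multi_indices_def)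

lemma multi_indices_of_degree_zero: "multi_indices_of_degree 0 = {\<lambda>_. 0}"
  by (auto simp: multi_indices_of_degree_def fun_eq_iff)

locale scalar_division_rkhs = scalar_rkhs \<Omega> K H ip + rkhs_mult \<Omega> "UNIV :: unit set" "scalar_kernel K" H ip
  for \<Omega> :: "(complex ^ 'm::finite) set" and K H ip +
  assumes pd: "positive_definite_kernel \<Omega> (UNIV :: unit set) (scalar_kernel K)"
    and division: "w \<in> \<Omega> \<Longrightarrow> \<exists>C\<ge>0. \<forall>f\<in>H. f w () = 0 \<longrightarrow>
        (\<exists>g. (\<forall>l. g l \<in> H \<and> hnorm ip (g l) \<le> C * hnorm ip f) \<and> row w g = f)"
begin

lemma mono_mult_mem: "f \<in> H \<Longrightarrow> mono_mult w \<gamma> f \<in> H"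
  by (induction \<gamma> rule: multi_index_induct) (auto simp: mono_mult_zero mono_mult_Suc mult_shift_mem)

text \<open>The quadratic form of the kernel at the coefficients is the squared norm of the
  combination, and strict positivity forbids that it vanish unless all coefficients do.\<close>

lemma sections_independent:
  assumes S: "finite S" "S \<subseteq> \<Omega>" and zero: "(\<Sum>w\<in>S. fscale (c w) (sect w)) = 0" and w: "w \<in> S"
  shows "c w = 0"
proof (rule ccontr)
  assume "c w \<noteq> 0"
  define y where "y = (\<Sum>w\<in>S. fscale (c w) (sect w))"
  have mem: "z \<in> S \<Longrightarrow> sect z \<in> H" for z using S by (auto intro: section_mem)
  have "ip y y = (\<Sum>z\<in>S. cnj (c z) * (\<Sum>w\<in>S. c w * ip (sect w) (sect z)))"
    unfolding y_def using mem by (simp add: ip_sum_left ip_sum_right ip_scl_left ip_scl_right mems)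
  also have "\<dots> = (\<Sum>z\<in>S. \<Sum>w\<in>S. c w * K z w * cnj (c z))"
    unfolding sum_distrib_left using S by (intro sum.cong refl) (auto simp: ip_sect_sect subset_iff)
  finally have "Re (\<Sum>z\<in>S. \<Sum>w\<in>S. c w * K z w * cnj (c z)) = 0" using zero by (simp add: y_def)
  moreover have "Re (\<Sum>z\<in>S. \<Sum>w\<in>S. c w * K z w * cnj (c z)) > 0"
    using pd[unfolded positive_definite_kernel_def Let_def, rule_format, of S "\<lambda>w _. c w"] S w \<open>c w \<noteq> 0\<close>
    by (auto simp: UNIV_unit scalar_kernel_def mult.commute[of "K _ _"])
  ultimately show False by simp
qed

lemma nonvanishing: assumes w: "w \<in> \<Omega>" obtains f where "f \<in> H" "f w () = 1"
proof -
  have "sect w \<noteq> 0"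
    using sections_independent[of "{w}" "\<lambda>_. 1" w] w by (auto simp: fscale_def)
  then have "ip (sect w) (sect w) \<noteq> 0" using ip_pos[OF section_mem[OF w]] by force
  then have "sect w w () \<noteq> 0" by (simp add: ip_sect w section_mem)
  then show ?thesis using that[of "fscale (1 / sect w w ()) (sect w)"] section_mem[OF w] by (simp add: scl_mem)
qed

lemma ipartial_mono_mult:
  assumes "f \<in> H" "w \<in> \<Omega>" "length L \<le> (\<Sum>l\<in>UNIV. \<gamma> l)"
  shows "ipartial L (\<lambda>z. mono_mult w \<gamma> f z ()) w =
     (if count_list L = \<gamma> then (\<Prod>l\<in>UNIV. fact (\<gamma> l)) * f w () else 0)"
  unfolding mono_mult_def by (rule ipartial_monomial_mult[OF open_domain assms(2) hol[OF assms(1)] assms(3)])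

text \<open>Test against the monomial of index \<delta> times a function with value 1 at
  \<open>w\<close>, where \<delta> has maximal degree among the indices with nonzero coefficient. Of
  the derivatives up to that degree only the one of index \<delta> is nonzero at \<open>w\<close>,
  with a product of factorials as its value.\<close>

lemma jets_independent:
  assumes w: "w \<in> \<Omega>"
    and zero: "\<And>f. f \<in> H \<Longrightarrow> (\<Sum>\<gamma>\<in>multi_indices k. c \<gamma> * ipartial (index_list \<gamma>) (\<lambda>z. f z ()) w) = 0"
    and \<gamma>: "\<gamma> \<in> multi_indices k"
  shows "c \<gamma> = 0"
proof (rule ccontr)
  assume "c \<gamma> \<noteq> 0"
  define S where "S = {\<gamma> \<in> multi_indices k. c \<gamma> \<noteq> 0}"
  have S: "finite S" "S \<noteq> {}" using \<gamma> \<open>c \<gamma> \<noteq> 0\<close> by (auto simp: S_def finite_multi_indices)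
  obtain \<delta> where \<delta>: "\<delta> \<in> S" and max: "\<And>\<alpha>. \<alpha> \<in> S \<Longrightarrow> (\<Sum>l\<in>UNIV. \<alpha> l) \<le> (\<Sum>l\<in>UNIV. \<delta> l)"
  proof -
    let ?deg = "\<lambda>\<alpha>. \<Sum>l\<in>UNIV. \<alpha> l"
    have "Max (?deg ` S) \<in> ?deg ` S" using S by (intro Max_in) auto
    then obtain \<delta> where "\<delta> \<in> S" "?deg \<delta> = Max (?deg ` S)" by force
    then show ?thesis using that[of \<delta>] S by simp
  qed
  obtain f where f: "f \<in> H" "f w () = 1" using nonvanishing[OF w] by blast
  have "(\<Sum>\<gamma>\<in>multi_indices k. c \<gamma> * ipartial (index_list \<gamma>) (\<lambda>z. mono_mult w \<delta> f z ()) w)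
      = (\<Sum>\<gamma>\<in>multi_indices k. if \<gamma> = \<delta> then c \<delta> * (\<Prod>l\<in>UNIV. fact (\<delta> l)) else 0)"
  proof (rule sum.cong[OF refl])
    fix \<alpha> :: "'m \<Rightarrow> nat" assume \<alpha>: "\<alpha> \<in> multi_indices k"
    show "c \<alpha> * ipartial (index_list \<alpha>) (\<lambda>z. mono_mult w \<delta> f z ()) w = (if \<alpha> = \<delta> then c \<delta> * (\<Prod>l\<in>UNIV. fact (\<delta> l)) else 0)"
    proof (cases "c \<alpha> = 0")
      case True
      then show ?thesis using \<delta> by (auto simp: S_def)
    next
      case False
      then have "(\<Sum>l\<in>UNIV. \<alpha> l) \<le> (\<Sum>l\<in>UNIV. \<delta> l)" using max[of \<alpha>] \<alpha> by (simp add: S_def)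
      then show ?thesis using f w by (simp add: ipartial_mono_mult length_index_list count_index_list)
    qed
  qed
  also have "\<dots> = c \<delta> * (\<Prod>l\<in>UNIV. fact (\<delta> l))"
    using \<delta> by (simp add: S_def finite_multi_indices)
  finally have "c \<delta> * (\<Prod>l\<in>UNIV. fact (\<delta> l)) = 0" using zero[OF mono_mult_mem[OF f(1)]] by simp
  then show False using \<delta> by (simp add: S_def)
qed

text \<open>For \<delta> of degree n, the derivative of index \<delta> isolates a nonzero multiple
  of the value of \<open>F \<delta>\<close> at \<open>w\<close>. It vanishes for n \<le> k, so every
  coefficient can be divided once more; the stages 0 to k lead to degree k + 1.\<close>

theorem higher_division:
  assumes w: "w \<in> \<Omega>" and f: "f \<in> H"
    and zero: "\<And>\<alpha>. \<alpha> \<in> multi_indices k \<Longrightarrow> ipartial (index_list \<alpha>) (\<lambda>z. f z ()) w = 0"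
  obtains F where "\<And>\<gamma>. F \<gamma> \<in> H" "f = (\<Sum>\<gamma>\<in>multi_indices_of_degree (Suc k). mono_mult w \<gamma> (F \<gamma>))"
proof -
  have "\<exists>F. (\<forall>\<gamma>. F \<gamma> \<in> H) \<and> f = (\<Sum>\<gamma>\<in>multi_indices_of_degree n. mono_mult w \<gamma> (F \<gamma>))" if "n \<le> Suc k" for n
    using that
  proof (induction n)
    case 0
    show ?case using f by (intro exI[of _ "\<lambda>_. f"]) (simp add: multi_indices_of_degree_zero mono_mult_zero)
  next
    case (Suc n)
    let ?D = "multi_indices_of_degree n :: ('m \<Rightarrow> nat) set"
    obtain F where F: "\<And>\<gamma>. F \<gamma> \<in> H" and feq: "f = (\<Sum>\<gamma>\<in>?D. mono_mult w \<gamma> (F \<gamma>))"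
      using Suc by auto
    have Fw: "F \<delta> w () = 0" if \<delta>: "\<delta> \<in> ?D" for \<delta>
    proof -
      have "0 = ipartial (index_list \<delta>) (\<lambda>z. f z ()) w"
        using zero[of \<delta>] Suc.prems \<delta> by (simp add: multi_indices_of_degree_def multi_indices_def)
      also have "\<dots> = (\<Sum>\<gamma>\<in>?D. ipartial (index_list \<delta>) (\<lambda>z. mono_mult w \<gamma> (F \<gamma>) z ()) w)"
        unfolding feq sum_apply2
        by (rule ipartial_sum[OF open_domain _ w]) (intro hol mono_mult_mem F)
      also have "\<dots> = (\<Sum>\<gamma>\<in>?D. if \<gamma> = \<delta> then (\<Prod>l\<in>UNIV. fact (\<delta> l)) * F \<delta> w () else 0)"
        using \<delta> by (intro sum.cong refl)
          (auto simp: ipartial_mono_mult F w length_index_list count_index_list multi_indices_of_degree_def)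
      also have "\<dots> = (\<Prod>l\<in>UNIV. fact (\<delta> l)) * F \<delta> w ()"
        using \<delta> by (simp add: finite_multi_indices_of_degree)
      finally show ?thesis by simp
    qed
    have "\<forall>\<gamma>. \<exists>g. \<gamma> \<in> ?D \<longrightarrow> (\<forall>l. g l \<in> H) \<and> row w g = F \<gamma>"
      using division[OF w] F Fw by blast
    then obtain G where G: "\<And>\<gamma> l. \<gamma> \<in> ?D \<Longrightarrow> G \<gamma> l \<in> H" and rowG: "\<And>\<gamma>. \<gamma> \<in> ?D \<Longrightarrow> row w (G \<gamma>) = F \<gamma>"
      by metis
    define up where "up = (\<lambda>(\<gamma>, l). \<gamma>(l := Suc (\<gamma> l)) :: 'm \<Rightarrow> nat)"
    \<comment> \<open>Several pairs of a multi-index and a coordinate may raise to the same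
      \<delta>, so their quotients are collected.\<close>
    define F' where "F' \<delta> = (\<Sum>p\<in>{p\<in>?D \<times> UNIV. up p = \<delta>}. G (fst p) (snd p))" for \<delta>
    have "F' \<delta> \<in> H" for \<delta> unfolding F'_def by (intro sum_mem) (auto intro: G)
    moreover have "f = (\<Sum>\<delta>\<in>multi_indices_of_degree (Suc n). mono_mult w \<delta> (F' \<delta>))"
    proof (intro ext)
      fix z i
      have up: "up ` (?D \<times> UNIV) \<subseteq> multi_indices_of_degree (Suc n)"
        using sum_fun_upd_Suc by (auto simp: up_def multi_indices_of_degree_def)
      have "(\<Sum>\<delta>\<in>multi_indices_of_degree (Suc n). mono_mult w \<delta> (F' \<delta>)) z i
         = (\<Sum>\<delta>\<in>multi_indices_of_degree (Suc n). \<Sum>p\<in>{p\<in>?D \<times> UNIV. up p = \<delta>}. monomial_at w (up p) z * G (fst p) (snd p) z i)"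
        unfolding sum_apply2 mono_mult_def F'_def sum_distrib_left by (intro sum.cong refl) auto
      also have "\<dots> = (\<Sum>p\<in>?D \<times> UNIV. monomial_at w (up p) z * G (fst p) (snd p) z i)"
        by (rule sum.group[OF _ finite_multi_indices_of_degree up]) (simp add: finite_multi_indices_of_degree)
      also have "\<dots> = (\<Sum>\<gamma>\<in>?D. \<Sum>l\<in>UNIV. monomial_at w \<gamma> z * ((z $ l - w $ l) * G \<gamma> l z i))"
        unfolding sum.cartesian_product by (intro sum.cong refl) (auto simp: up_def monomial_at_Suc)
      also have "\<dots> = (\<Sum>\<gamma>\<in>?D. monomial_at w \<gamma> z * F \<gamma> z i)"
        by (intro sum.cong refl) (simp add: rowG[symmetric] row_apply sum_distrib_left)
      also have "\<dots> = f z i" unfolding feq sum_apply2 mono_mult_def ..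
      finally show "f z i = (\<Sum>\<delta>\<in>multi_indices_of_degree (Suc n). mono_mult w \<delta> (F' \<delta>)) z i" by simp
    qed
    ultimately show ?case by blast
  qed
  then show ?thesis using that by blast
qed

end

section \<open>The space of jets along the diagonal\<close>

text \<open>Description of a kernel by feature vectors: the functions \<open>R f\<close>, with the
  norm of the quotient of \<open>E\<close> by the kernel of \<open>R\<close>, form the reproducing
  kernel Hilbert space of the matrix of inner products of the vectors
  \<open>\<Phi> z i\<close>.\<close>

locale feature_map = E: hilbert scl E ip
  for scl :: "complex \<Rightarrow> 'v::ab_group_add \<Rightarrow> 'v" and E ip +
  fixes \<Omega> :: "(complex ^ 'm::finite) set" and I :: "'i set" and \<Phi> :: "complex ^ 'm \<Rightarrow> 'i \<Rightarrow> 'v"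
  assumes \<Phi>_mem: "z \<in> \<Omega> \<Longrightarrow> i \<in> I \<Longrightarrow> \<Phi> z i \<in> E"
begin

definition R :: "'v \<Rightarrow> complex ^ 'm \<Rightarrow> 'i \<Rightarrow> complex" where
  "R f = (\<lambda>z i. if z \<in> \<Omega> \<and> i \<in> I then ip f (\<Phi> z i) else 0)"

lemma R_add: "f \<in> E \<Longrightarrow> g \<in> E \<Longrightarrow> R (f + g) = R f + R g"
  and R_diff: "f \<in> E \<Longrightarrow> g \<in> E \<Longrightarrow> R (f - g) = R f - R g"
  and R_scl: "f \<in> E \<Longrightarrow> R (scl c f) = fscale c (R f)"
  and R_zero: "R 0 = 0"
  by (intro ext; simp add: R_def \<Phi>_mem E.ip_add_left E.ip_diff_left E.ip_scl_left)+

text \<open>Realizes the quotient by the kernel of \<open>R\<close> inside \<open>E\<close>: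
  \<open>R\<close> is injective on it, the quotient norm becomes an inherited norm, and completeness
  is that of a closed subspace.\<close>

definition N :: "'v set" where "N = E.orth {f \<in> E. R f = 0}"

lemma N_subspace: "E.closed_subspace N"
  unfolding N_def by (rule E.closed_subspace_orth) auto

sublocale N: hilbert scl N ip
  by (rule E.hilbert_closed_subspace[OF N_subspace])

lemma N_mem: "f \<in> N \<Longrightarrow> f \<in> E"
  by (simp add: N_def E.orth_def)

lemma \<Phi>_in_N: "z \<in> \<Omega> \<Longrightarrow> i \<in> I \<Longrightarrow> \<Phi> z i \<in> N"
proof -
  assume zi: "z \<in> \<Omega>" "i \<in> I"
  have "ip (\<Phi> z i) f = 0" if "f \<in> E" "R f = 0" for f
  proof -
    have "R f z i = 0" using that by simp
    then have "ip f (\<Phi> z i) = 0" using zi by (simp add: R_def)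
    then show ?thesis using E.ip_cnj[OF that(1) \<Phi>_mem[OF zi]] by simp
  qed
  then show ?thesis using zi by (simp add: N_def E.orth_def \<Phi>_mem)
qed

lemma R_inj: assumes "f \<in> N" "g \<in> N" "R f = R g" shows "f = g"
proof -
  have d: "f - g \<in> N" using assms by (intro N.diff_mem)
  have "R (f - g) = 0" using assms by (simp add: R_diff N_mem)
  then have "ip (f - g) (f - g) = 0" using d by (simp add: N_def E.orth_def)
  then show ?thesis using N.ip_pos[OF d] by force
qed

text \<open>The feature vectors lie in \<open>N\<close>, so projecting onto \<open>N\<close>
  preserves the image under \<open>R\<close> and can only decrease the norm.\<close>

lemma N_lift:
  assumes f: "f \<in> E" obtains n where "n \<in> N" "R n = R f" "E.nrm n \<le> E.nrm f"
proof -
  obtain n where n: "n \<in> N" and o: "\<And>s. s \<in> N \<Longrightarrow> ip (f - n) s = 0"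
    using E.projection[OF N_subspace f] by blast
  have nE: "n \<in> E" by (rule N_mem[OF n])
  have "R (f - n) z i = 0" for z i
    using o[OF \<Phi>_in_N] by (simp add: R_def)
  then have "R (f - n) = 0" by (intro ext) simp
  then have eq: "R n = R f" using f nE by (simp add: R_diff)
  have "(E.nrm n)\<^sup>2 \<le> (E.nrm f)\<^sup>2"
    using E.nrm_sq_add[OF E.diff_mem[OF f nE] nE] o[OF n] by simp
  then have "E.nrm n \<le> E.nrm f" by (rule power2_le_imp_le) (simp add: f)
  then show ?thesis using that n eq by blast
qed

definition lift :: "(complex ^ 'm \<Rightarrow> 'i \<Rightarrow> complex) \<Rightarrow> 'v" where
  "lift F = (THE n. n \<in> N \<and> R n = F)"

definition "quotient_ip F G = ip (lift F) (lift G)"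

lemma lift_R: "n \<in> N \<Longrightarrow> lift (R n) = n"
  unfolding lift_def using R_inj by (intro the_equality) auto

lemma range_R: "R ` E = R ` N"
proof
  show "R ` E \<subseteq> R ` N"
  proof
    fix F assume "F \<in> R ` E"
    then obtain f where "f \<in> E" "F = R f" by blast
    then show "F \<in> R ` N" using N_lift by (metis imageI)
  qed
qed (auto intro: N_mem)

lemma hnorm_quotient_ip: "hnorm quotient_ip F = hnorm ip (lift F)"
  by (simp add: hnorm_def quotient_ip_def)

lemma nrm_R_le: assumes "f \<in> E" shows "hnorm quotient_ip (R f) \<le> E.nrm f"
  using N_lift[OF assms] by (metis hnorm_quotient_ip lift_R)

lemma lift_mem: "F \<in> R ` E \<Longrightarrow> lift F \<in> N" and R_lift: "F \<in> R ` E \<Longrightarrow> R (lift F) = F"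
  unfolding range_R using lift_R by auto

lemma lift_add: "F \<in> R ` E \<Longrightarrow> G \<in> R ` E \<Longrightarrow> lift (F + G) = lift F + lift G"
  using lift_R[of "lift F + lift G"] by (simp add: N.add_mem lift_mem R_add N_mem R_lift)

lemma lift_diff: "F \<in> R ` E \<Longrightarrow> G \<in> R ` E \<Longrightarrow> lift (F - G) = lift F - lift G"
  using lift_R[of "lift F - lift G"] by (simp add: N.diff_mem lift_mem R_diff N_mem R_lift)

lemma lift_scl: "F \<in> R ` E \<Longrightarrow> lift (fscale c F) = scl c (lift F)"
  using lift_R[of "scl c (lift F)"] by (simp add: N.scl_mem lift_mem R_scl N_mem R_lift)

theorem hilbert_quotient: "hilbert fscale (R ` E) quotient_ip"
proof
  fix F G J c assume F: "F \<in> R ` E"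
  show "fscale c F \<in> R ` E"
    using R_scl[OF N_mem[OF lift_mem[OF F]], of c] R_lift[OF F] E.scl_mem[OF N_mem[OF lift_mem[OF F]]]
    by (metis imageI)
  show "F \<noteq> 0 \<Longrightarrow> 0 < Re (quotient_ip F F)"
    unfolding quotient_ip_def using R_lift[OF F] R_zero by (intro N.ip_pos lift_mem[OF F]) auto
  assume G: "G \<in> R ` E"
  show "F + G \<in> R ` E"
    using R_add[OF N_mem[OF lift_mem[OF F]] N_mem[OF lift_mem[OF G]]] R_lift[OF F] R_lift[OF G]
      E.add_mem[OF N_mem[OF lift_mem[OF F]] N_mem[OF lift_mem[OF G]]] by (metis imageI)
  show "quotient_ip (fscale c F) G = c * quotient_ip F G"
    by (simp only: quotient_ip_def lift_scl F N.ip_scl_left lift_mem G)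
  show "quotient_ip G F = cnj (quotient_ip F G)"
    unfolding quotient_ip_def by (intro N.ip_cnj lift_mem F G)
  assume J: "J \<in> R ` E"
  show "quotient_ip (F + G) J = quotient_ip F J + quotient_ip G J"
    by (simp only: quotient_ip_def lift_add F G N.ip_add_left lift_mem J)
next
  show "0 \<in> R ` E" using R_zero E.zero_mem by (metis imageI)
next
  fix X :: "nat \<Rightarrow> complex ^ 'm \<Rightarrow> 'i \<Rightarrow> complex"
  assume X: "\<And>n. X n \<in> R ` E"
    and C: "\<And>e. e > 0 \<Longrightarrow> \<exists>N. \<forall>p\<ge>N. \<forall>q\<ge>N. hnorm quotient_ip (X p - X q) < e"
  have "\<exists>s\<in>N. (\<lambda>n. hnorm ip (lift (X n) - s)) \<longlonglongrightarrow> 0"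
  proof (rule N.complete)
    fix e :: real assume "e > 0"
    then show "\<exists>N. \<forall>p\<ge>N. \<forall>q\<ge>N. hnorm ip (lift (X p) - lift (X q)) < e"
      using C[of e] by (simp only: hnorm_quotient_ip lift_diff X)
  qed (rule lift_mem[OF X])
  then obtain s where s: "s \<in> N" "(\<lambda>n. hnorm ip (lift (X n) - s)) \<longlonglongrightarrow> 0" by blast
  have "R s \<in> R ` E" using s N_mem by blast
  moreover have "hnorm quotient_ip (X n - R s) = hnorm ip (lift (X n) - s)" for n
    unfolding hnorm_quotient_ip using lift_diff[OF X \<open>R s \<in> R ` E\<close>] by (simp only: lift_R s)
  ultimately show "\<exists>f\<in>R ` E. (\<lambda>n. hnorm quotient_ip (X n - f)) \<longlonglongrightarrow> 0"
    using s(2) by (intro bexI[of _ "R s"]) simp_all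
qed (simp_all add: fscale_def fun_eq_iff algebra_simps)

text \<open>The multiplication is the composition of the isometry \<open>lift\<close>, the bounded
  map \<open>T\<close> and the contraction \<open>R\<close>.\<close>

lemma R_bounded_operator:
  assumes T: "\<And>f. f \<in> E \<Longrightarrow> T f \<in> E" and RT: "\<And>f. f \<in> E \<Longrightarrow> R (T f) = mult_shift 0 l (R f)"
    and bd: "\<And>f. f \<in> E \<Longrightarrow> E.nrm (T f) \<le> C * E.nrm f"
  shows "bounded_operator (R ` E) quotient_ip (mult_shift 0 l)"
  unfolding bounded_operator_def
proof (intro conjI ballI allI exI)
  fix F assume F: "F \<in> R ` E"
  have eq: "mult_shift 0 l F = R (T (lift F))" using RT[OF N_mem[OF lift_mem[OF F]]] R_lift[OF F] by simp
  show "mult_shift 0 l F \<in> R ` E" unfolding eq by (intro imageI T N_mem lift_mem F)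
  show "hnorm quotient_ip (mult_shift 0 l F) \<le> C * hnorm quotient_ip F"
    unfolding eq hnorm_quotient_ip[of F]
    using nrm_R_le[OF T[OF N_mem[OF lift_mem[OF F]]]] bd[OF N_mem[OF lift_mem[OF F]]] by linarith
qed (auto simp: mult_shift_def fun_eq_iff algebra_simps)

theorem is_rkhs_quotient:
  assumes I: "finite I" and hol: "\<And>f i. f \<in> E \<Longrightarrow> i \<in> I \<Longrightarrow> holomorphic_cn \<Omega> (\<lambda>z. R f z i)"
    and K: "\<And>z w i j. z \<in> \<Omega> \<Longrightarrow> w \<in> \<Omega> \<Longrightarrow> i \<in> I \<Longrightarrow> j \<in> I \<Longrightarrow> K z w i j = ip (\<Phi> w j) (\<Phi> z i)"
  shows "is_rkhs \<Omega> I K (R ` E) quotient_ip"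
  unfolding is_rkhs_def
proof (intro conjI ballI allI impI)
  show "hilbert_function_space (R ` E) quotient_ip"
    by (rule hilbert_function_spaceI[OF hilbert_quotient])
next
  fix F z i assume "F \<in> R ` E" "z \<notin> \<Omega> \<or> i \<notin> I"
  then show "F z i = 0" by (auto simp: R_def)
next
  fix F i assume "F \<in> R ` E" "i \<in> I"
  then show "holomorphic_cn \<Omega> (\<lambda>z. F z i)" using hol by blast
next
  fix w \<eta> assume w: "w \<in> \<Omega>"
  \<comment> \<open>Combinations of feature vectors stay in \<open>N\<close>, so \<open>lift\<close>
    returns them and inner products with the kernel section can be computed in
    \<open>E\<close>.\<close>
  define x where "x = (\<Sum>j\<in>I. scl (\<eta> j) (\<Phi> w j))"
  have x: "x \<in> N" unfolding x_def using w by (intro N.sum_mem N.scl_mem \<Phi>_in_N)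
  have sec: "kernel_section \<Omega> I K w \<eta> = R x"
  proof (intro ext)
    fix z i
    show "kernel_section \<Omega> I K w \<eta> z i = R x z i"
      using w by (auto simp: kernel_section_def R_def x_def E.ip_sum_left E.ip_scl_left E.scl_mem \<Phi>_mem K mult.commute
          intro!: sum.cong)
  qed
  show "kernel_section \<Omega> I K w \<eta> \<in> R ` E" unfolding sec using x N_mem by blast
  fix F assume F: "F \<in> R ` E"
  have "quotient_ip F (R x) = ip (lift F) x" by (simp add: quotient_ip_def lift_R x)
  also have "\<dots> = (\<Sum>j\<in>I. R (lift F) w j * cnj (\<eta> j))"
    unfolding x_def using w N_mem[OF lift_mem[OF F]]
    by (simp add: E.ip_sum_right E.ip_scl_right E.scl_mem \<Phi>_mem R_def mult.commute)
  finally show "quotient_ip F (kernel_section \<Omega> I K w \<eta>) = (\<Sum>i\<in>I. F w i * cnj (\<eta> i))"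
    unfolding sec R_lift[OF F] .
qed

end

section \<open>The jet kernel of two generalized Bergman kernels\<close>

lemma scalar_division_rkhs_of_generalized_bergman:
  assumes "open \<Omega>" and "generalized_bergman_kernel \<Omega> UNIV (scalar_kernel K)"
  obtains H ip where "scalar_division_rkhs \<Omega> K H ip"
proof -
  obtain H ip where H: "is_rkhs \<Omega> UNIV (scalar_kernel K) H ip" and sh: "sharp_on \<Omega> UNIV (scalar_kernel K) H ip"
    and cl: "\<And>w. w \<in> \<Omega> \<Longrightarrow> hclosed (dsum_space H) (dsum_inner ip) (D_mult_adj H ip w ` H)"
    using assms(2) unfolding generalized_bergman_kernel_def by blast
  interpret M: rkhs_mult \<Omega> "UNIV :: unit set" "scalar_kernel K" H ip
    using H sh assms(1) by unfold_locales (auto simp: sharp_on_def)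
  have "scalar_division_rkhs \<Omega> K H ip"
  proof unfold_locales
    show "positive_definite_kernel \<Omega> UNIV (scalar_kernel K)"
      using assms(2) unfolding generalized_bergman_kernel_def by blast
    fix w assume w: "w \<in> \<Omega>"
    have "{f \<in> H. D_mult_adj H ip w f = 0} = range (kernel_section \<Omega> UNIV (scalar_kernel K) w)"
      using sh w unfolding sharp_on_def by blast
    from M.division_if_generalized_bergman[OF this cl[OF w] w]
    show "\<exists>C\<ge>0. \<forall>f\<in>H. f w () = 0 \<longrightarrow> (\<exists>g. (\<forall>l. g l \<in> H \<and> M.nrm (g l) \<le> C * M.nrm f) \<and> M.row w g = f)"
      by (simp add: UNIV_unit)
  qed
  then show ?thesis by (rule that)
qed

locale jet_module =
  A: scalar_division_rkhs \<Omega> K1 H1 ip1 + B: scalar_division_rkhs \<Omega> K2 H2 ip2 +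
  T: tensor fscale H1 ip1 fscale H2 ip2 B
  for \<Omega> :: "(complex ^ 'm::finite) set" and K1 H1 ip1 K2 H2 ip2 B +
  fixes k :: nat
begin

text \<open>Represents the derivative of index \<alpha> in the second variable of f(z, \<zeta>),
  taken at \<zeta> = z. Thus \<open>F.R f\<close> is the jet of \<open>f\<close> along the diagonal,
  and the inner products of these vectors are the entries of \<open>J_res K1 K2\<close>.\<close>

definition \<Phi> :: "complex ^ 'm \<Rightarrow> ('m \<Rightarrow> nat) \<Rightarrow> (complex ^ 'm \<Rightarrow> unit \<Rightarrow> complex) \<Rightarrow> complex ^ 'm \<Rightarrow> unit \<Rightarrow> complex" where
  "\<Phi> z \<alpha> = T.tens (A.sect z) (B.jet z (index_list \<alpha>))"

abbreviation "I \<equiv> multi_indices k :: ('m \<Rightarrow> nat) set"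

lemma \<Phi>_mem: "z \<in> \<Omega> \<Longrightarrow> \<Phi> z \<alpha> \<in> T.E"
  unfolding \<Phi>_def by (intro T.tens_mem A.section_mem B.jet_mem)

sublocale F: feature_map T.sclE T.E T.ipE \<Omega> I \<Phi>
  by unfold_locales (rule \<Phi>_mem)

lemma ip_\<Phi>: "z \<in> \<Omega> \<Longrightarrow> w \<in> \<Omega> \<Longrightarrow> T.ipE (\<Phi> w \<beta>) (\<Phi> z \<alpha>) = J_res K1 K2 z w \<alpha> \<beta>"
  unfolding \<Phi>_def
  by (simp add: T.ip_tens A.section_mem B.jet_mem A.ip_sect_sect B.mixed_partial_eq J_res_def)

lemma jet_Nil: "z \<in> \<Omega> \<Longrightarrow> A.jet z [] = A.sect z"
  by (rule A.eq_if_ip_eq) (auto simp: A.jet_mem A.section_mem A.ip_jet A.ip_sect)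

lemma \<Phi>_locally_bounded:
  assumes z: "z \<in> \<Omega>"
  obtains r C where "r > 0" "C > 0" "ball z r \<subseteq> \<Omega>" "\<And>u. u \<in> ball z r \<Longrightarrow> T.E.nrm (\<Phi> u \<alpha>) \<le> C"
proof -
  obtain r1 C1 where 1: "r1 > 0" "C1 \<ge> 0" "cball z r1 \<subseteq> \<Omega>" "\<And>u. u \<in> cball z r1 \<Longrightarrow> A.nrm (A.jet u []) \<le> C1"
    using A.jet_locally_bounded[OF z, of "[]"] by blast
  obtain r2 C2 where 2: "r2 > 0" "C2 \<ge> 0" "cball z r2 \<subseteq> \<Omega>"
    "\<And>u. u \<in> cball z r2 \<Longrightarrow> B.nrm (B.jet u (index_list \<alpha>)) \<le> C2"
    using B.jet_locally_bounded[OF z, of "index_list \<alpha>"] by blast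
  \<comment> \<open>The 1 makes the bound positive, since it serves as a denominator later.\<close>
  have "T.E.nrm (\<Phi> u \<alpha>) \<le> C1 * C2 + 1" if u: "u \<in> ball z (min r1 r2)" for u
  proof -
    have u': "u \<in> cball z r1" "u \<in> cball z r2" using u by auto
    then have "u \<in> \<Omega>" using 1 by blast
    then have "T.E.nrm (\<Phi> u \<alpha>) = A.nrm (A.jet u []) * B.nrm (B.jet u (index_list \<alpha>))"
      unfolding \<Phi>_def jet_Nil[OF \<open>u \<in> \<Omega>\<close>] by (intro T.nrm_tens A.section_mem B.jet_mem)
    also have "\<dots> \<le> C1 * C2" using 1(4)[OF u'(1)] 2(4)[OF u'(2)] 1(2) \<open>u \<in> \<Omega>\<close>
      by (intro mult_mono) (auto simp: B.jet_mem)
    finally show ?thesis by simp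
  qed
  moreover have "ball z (min r1 r2) \<subseteq> \<Omega>" using 1(3) by auto
  ultimately show ?thesis using that[of "min r1 r2" "C1 * C2 + 1"] 1 2 by (simp add: add_nonneg_pos)
qed

text \<open>For a finite sum of elementary tensors the image is an explicit sum of products of
  \<open>f a\<close> with a derivative of \<open>a\<close>. By the Cauchy-Schwarz inequality and the
  local bound on the norms of \<Phi>, approximation in \<open>E\<close> becomes locally uniform
  approximation of the images.\<close>

lemma holomorphic_R: assumes f: "f \<in> T.E" and \<alpha>: "\<alpha> \<in> I" shows "holomorphic_cn \<Omega> (\<lambda>z. F.R f z \<alpha>)"
proof (rule holomorphic_cn_limit)
  fix z assume z: "z \<in> \<Omega>"
  obtain r C where "r > 0" "C > 0" "ball z r \<subseteq> \<Omega>" "\<And>u. u \<in> ball z r \<Longrightarrow> T.E.nrm (\<Phi> u \<alpha>) \<le> C"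
    by (rule \<Phi>_locally_bounded[OF z, of \<alpha>]) (rule that)
  note r = this(1,3) and C = this(2,4)
  show "\<exists>r>0. \<forall>e>0. \<exists>g. holomorphic_cn (ball z r) g \<and> (\<forall>u\<in>ball z r. cmod (F.R f u \<alpha> - g u) \<le> e)"
  proof (intro exI[of _ r] conjI allI impI r)
    fix e :: real assume e: "e > 0"
    obtain S where S: "finite S" "S \<subseteq> B" and app: "T.E.nrm (f - (\<Sum>a\<in>S. T.tens (f a) a)) \<le> e / C"
      using T.finite_tens_approx[OF f, of "e / C"] e C(1) by auto
    define t where "t = (\<Sum>a\<in>S. T.tens (f a) a)"
    have fa: "f a \<in> H1" "a \<in> H2" if "a \<in> S" for a
      using that S T.B_mem A.l2_memD(1)[OF f] by auto
    have t: "t \<in> T.E" unfolding t_def by (intro T.E.sum_mem T.tens_mem fa)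
    define g where "g u = (\<Sum>a\<in>S. f a u () * ipartial (index_list \<alpha>) (\<lambda>v. a v ()) u)" for u
    have "holomorphic_cn \<Omega> g"
      unfolding g_def by (intro holomorphic_cn_sum holomorphic_cn_mult holomorphic_ipartial A.hol B.hol fa A.open_domain)
    then have "holomorphic_cn (ball z r) g" using r by (auto intro: holomorphic_cn_subset)
    moreover have "cmod (F.R f u \<alpha> - g u) \<le> e" if u: "u \<in> ball z r" for u
    proof -
      have u\<Omega>: "u \<in> \<Omega>" using u r by blast
      have "T.ipE t (\<Phi> u \<alpha>) = (\<Sum>a\<in>S. T.ipE (T.tens (f a) a) (\<Phi> u \<alpha>))"
        unfolding t_def by (rule T.E.ip_sum_left[OF _ \<Phi>_mem[OF u\<Omega>]]) (intro T.tens_mem fa)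
      also have "\<dots> = g u"
        unfolding g_def \<Phi>_def using u\<Omega>
        by (intro sum.cong refl) (simp add: T.ip_tens fa A.section_mem B.jet_mem A.ip_sect B.ip_jet)
      finally have "F.R f u \<alpha> - g u = T.ipE (f - t) (\<Phi> u \<alpha>)"
        using u\<Omega> \<alpha> by (simp add: F.R_def T.E.ip_diff_left f t \<Phi>_mem)
      then have "cmod (F.R f u \<alpha> - g u) \<le> T.E.nrm (f - t) * T.E.nrm (\<Phi> u \<alpha>)"
        by (simp only:) (intro T.E.cauchy_schwarz T.E.diff_mem f t \<Phi>_mem u\<Omega>)
      also have "\<dots> \<le> (e / C) * C"
        using app C(2)[OF u] e C(1) by (intro mult_mono) (auto simp: t_def[symmetric] \<Phi>_mem u\<Omega>)
      also have "\<dots> = e" using C by simp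
      finally show ?thesis .
    qed
    ultimately show "\<exists>g. holomorphic_cn (ball z r) g \<and> (\<forall>u\<in>ball z r. cmod (F.R f u \<alpha> - g u) \<le> e)" by blast
  qed
qed

section \<open>Coordinate multiplications on the tensor product\<close>

definition mult_first :: "complex ^ 'm \<Rightarrow> 'm \<Rightarrow> ((complex ^ 'm \<Rightarrow> unit \<Rightarrow> complex) \<Rightarrow> complex ^ 'm \<Rightarrow> unit \<Rightarrow> complex)
    \<Rightarrow> ((complex ^ 'm \<Rightarrow> unit \<Rightarrow> complex) \<Rightarrow> complex ^ 'm \<Rightarrow> unit \<Rightarrow> complex)" where
  "mult_first w l f = (\<lambda>a. mult_shift w l (f a))"

lemma mult_shift_zero: "mult_shift w l 0 = 0"
  by (intro ext) (simp add: mult_shift_def)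

lemma mult_first_bounded:
  "\<exists>C\<ge>0. \<forall>f\<in>T.E. mult_first w l f \<in> T.E \<and> T.E.nrm (mult_first w l f) \<le> C * T.E.nrm f"
proof -
  obtain C where C: "C \<ge> 0" "\<And>f. f \<in> H1 \<Longrightarrow> A.nrm (mult_shift w l f) \<le> C * A.nrm f"
    using A.mult_shift_bound by blast
  have "mult_first w l f \<in> T.E \<and> T.E.nrm (mult_first w l f) \<le> C * T.E.nrm f" if f: "f \<in> T.E" for f
  proof -
    have fa: "a \<in> B \<Longrightarrow> f a \<in> H1" and fo: "a \<notin> B \<Longrightarrow> f a = 0" for a using A.l2_memD[OF f] by auto
    have bd: "(\<Sum>a\<in>S. (A.nrm (mult_first w l f a))\<^sup>2) \<le> (C * T.E.nrm f)\<^sup>2" if S: "finite S" "S \<subseteq> B" for S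
    proof -
      have "(\<Sum>a\<in>S. (A.nrm (mult_first w l f a))\<^sup>2) \<le> (\<Sum>a\<in>S. (C * A.nrm (f a))\<^sup>2)"
        unfolding mult_first_def using S C fa by (intro sum_mono power_mono C A.nrm_ge0 A.mult_shift_mem) auto
      also have "\<dots> = C\<^sup>2 * (\<Sum>a\<in>S. (A.nrm (f a))\<^sup>2)" by (simp add: power_mult_distrib sum_distrib_left)
      also have "\<dots> \<le> C\<^sup>2 * (T.E.nrm f)\<^sup>2"
        by (intro mult_left_mono A.finite_sum_le_l2_nrm f S) simp
      finally show ?thesis by (simp add: power_mult_distrib)
    qed
    have "C * T.E.nrm f \<ge> 0" using C(1) f by simp
    then show ?thesis
      using A.l2_mem_bounded[of B "mult_first w l f", OF _ _ bd]
      by (simp add: mult_first_def A.mult_shift_mem fa fo mult_shift_zero)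
  qed
  then show ?thesis using C(1) by blast
qed

lemma mult_first_mem: "f \<in> T.E \<Longrightarrow> mult_first w l f \<in> T.E"
  using mult_first_bounded by blast

lemma ip_mult_first:
  assumes f: "f \<in> T.E" and g: "g \<in> H2" and z: "z \<in> \<Omega>"
  shows "T.ipE (mult_first w l f) (T.tens (A.sect z) g) = (z $ l - w $ l) * T.ipE f (T.tens (A.sect z) g)"
proof -
  have fa: "a \<in> B \<Longrightarrow> f a \<in> H1" for a using A.l2_memD[OF f] by auto
  have "T.ipE (mult_first w l f) (T.tens (A.sect z) g)
     = infsum (\<lambda>a. ip1 (mult_first w l f a) (A.sect z) * cnj (ip2 g a)) B"
    by (intro T.ip_tens_right mult_first_mem f g A.section_mem z)
  also have "\<dots> = infsum (\<lambda>a. (z $ l - w $ l) * (ip1 (f a) (A.sect z) * cnj (ip2 g a))) B"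
    by (intro infsum_cong) (simp add: mult_first_def A.ip_sect z fa A.mult_shift_mem, simp add: mult_shift_def)
  also have "\<dots> = (z $ l - w $ l) * T.ipE f (T.tens (A.sect z) g)"
    unfolding T.ip_tens_right[OF f A.section_mem[OF z] g] by (rule infsum_cmult_right')
  finally show ?thesis .
qed

text \<open>The derivatives in \<Phi> fall on the second variable, so a factor in the first variable
  passes through as a scalar; a factor in the second would mix the entries of the jet.\<close>

lemma R_mult_first: "f \<in> T.E \<Longrightarrow> F.R (mult_first w l f) z \<alpha> = (z $ l - w $ l) * F.R f z \<alpha>"
  by (simp add: F.R_def \<Phi>_def ip_mult_first B.jet_mem)

section \<open>Slices in the first variable and division in the quotient\<close>

lemma coordinate:
  assumes f: "f \<in> T.E" and a: "a \<in> B" and w: "w \<in> \<Omega>"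
  shows "f a w () = T.ipE f (T.tens (A.sect w) a)"
proof -
  have "T.ipE f (T.tens (A.sect w) a) = infsum (\<lambda>b. ip1 (f b) (A.sect w) * cnj (ip2 a b)) B"
    by (intro T.ip_tens_right f A.section_mem w T.B_mem a)
  also have "\<dots> = infsum (\<lambda>b. ip1 (f b) (A.sect w) * cnj (ip2 a b)) {a}"
    using a by (intro infsum_cong_neutral) (auto simp: T.ip_B)
  finally show ?thesis using a A.l2_memD(1)[OF f a] by (simp add: T.ip_B A.ip_sect w)
qed

text \<open>The vector \<open>p\<close> is f(w, \<zeta>) as a function of \<zeta>. The pairing of
  \<open>f\<close> with the tensor of \<open>A.sect w\<close> and \<open>g\<close> is antilinear in
  \<open>g\<close>, hence the conjugates in the application of Riesz.\<close>

lemma slice_exists: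
  assumes f: "f \<in> T.E" and w: "w \<in> \<Omega>"
  obtains p where "p \<in> H2" "\<And>g. g \<in> H2 \<Longrightarrow> T.ipE f (T.tens (A.sect w) g) = ip2 p g"
proof -
  have s: "A.sect w \<in> H1" by (rule A.section_mem[OF w])
  obtain p where p: "p \<in> H2" "\<And>g. g \<in> H2 \<Longrightarrow> cnj (T.ipE f (T.tens (A.sect w) g)) = ip2 g p"
  proof (rule B.riesz[of "\<lambda>g. cnj (T.ipE f (T.tens (A.sect w) g))" "T.E.nrm f * A.nrm (A.sect w)"])
    fix g assume g: "g \<in> H2"
    show "cmod (cnj (T.ipE f (T.tens (A.sect w) g))) \<le> T.E.nrm f * A.nrm (A.sect w) * B.nrm g"
      using T.E.cauchy_schwarz[OF f T.tens_mem[OF s g]] by (simp add: T.nrm_tens s g mult.assoc)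
  next
    fix g h assume "g \<in> H2" "h \<in> H2"
    then show "cnj (T.ipE f (T.tens (A.sect w) (g + h))) = cnj (T.ipE f (T.tens (A.sect w) g)) + cnj (T.ipE f (T.tens (A.sect w) h))"
      by (simp only: T.tens_add_right T.E.ip_add_right T.tens_mem s f complex_cnj_add)
  next
    fix c g assume "g \<in> H2"
    then show "cnj (T.ipE f (T.tens (A.sect w) (fscale c g))) = c * cnj (T.ipE f (T.tens (A.sect w) g))"
      by (simp only: T.tens_scl_right T.E.ip_scl_right T.tens_mem s f complex_cnj_mult complex_cnj_cnj)
  qed blast
  show ?thesis
  proof (rule that[OF p(1)])
    fix g assume g: "g \<in> H2"
    show "T.ipE f (T.tens (A.sect w) g) = ip2 p g"
      using p(2)[OF g] B.ip_cnj[OF g p(1)] by (metis complex_cnj_cnj)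
  qed
qed

text \<open>The slices in the first variable of the algebraic tensors. Multiplication by the difference of
  the two variables stays within this class.\<close>

inductive alg_slices :: "(complex ^ 'm \<Rightarrow> complex ^ 'm \<Rightarrow> unit \<Rightarrow> complex) \<Rightarrow> bool" where
  elementary: "h \<in> H1 \<Longrightarrow> f \<in> H2 \<Longrightarrow> alg_slices (\<lambda>z. fscale (h z ()) f)"
| plus: "alg_slices \<phi> \<Longrightarrow> alg_slices \<psi> \<Longrightarrow> alg_slices (\<lambda>z. \<phi> z + \<psi> z)"

lemma alg_slices_mult:
  assumes "alg_slices \<phi>" shows "alg_slices (\<lambda>z. mult_shift z l (\<phi> z))"
  using assms
proof induction
  case (elementary h f)
  \<comment> \<open>The factor \<zeta>_l - z_l splits: \<zeta>_l is absorbed by the function in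
    \<open>H2\<close> and -z_l by the one in \<open>H1\<close>, as both spaces admit their
    multiplication operators.\<close>
  have "(\<lambda>z. mult_shift z l (fscale (h z ()) f))
      = (\<lambda>z. fscale (h z ()) (mult_shift 0 l f) + fscale (fscale (-1) (mult_shift 0 l h) z ()) f)"
    by (intro ext) (simp add: mult_shift_def algebra_simps)
  then show ?case
    using elementary alg_slices.plus[OF alg_slices.elementary[of h "mult_shift 0 l f"]
        alg_slices.elementary[of "fscale (-1) (mult_shift 0 l h)" f]]
    by (simp only: A.scl_mem A.mult_shift_mem B.mult_shift_mem)
next
  case (plus \<phi> \<psi>)
  then show ?case by (simp only: B.mult_shift_add alg_slices.plus)
qed

lemma alg_slices_monomial:
  assumes h: "h \<in> H1" and f: "f \<in> H2"
  shows "alg_slices (\<lambda>z. fscale (h z ()) (mono_mult z \<gamma> f))"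
proof (induction \<gamma> rule: multi_index_induct)
  case zero
  then show ?case using alg_slices.elementary[OF h f] by (simp only: mono_mult_zero)
next
  case (Suc \<gamma> l)
  from alg_slices_mult[OF this, of l] show ?case by (simp only: mono_mult_Suc B.mult_shift_fscale)
qed

lemma alg_slices_sum:
  "(\<And>\<gamma>. \<gamma> \<in> S \<Longrightarrow> alg_slices (\<phi> \<gamma>)) \<Longrightarrow> alg_slices (\<lambda>z. \<Sum>\<gamma>\<in>S. \<phi> \<gamma> z)"
proof (induction S rule: infinite_finite_induct)
  case (insert \<gamma> S)
  have "(\<lambda>z. \<Sum>\<gamma>\<in>insert \<gamma> S. \<phi> \<gamma> z) = (\<lambda>z. \<phi> \<gamma> z + (\<Sum>\<gamma>\<in>S. \<phi> \<gamma> z))"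
    by (simp only: sum.insert insert.hyps if_False not_False_eq_True)
  moreover have "alg_slices (\<lambda>z. \<phi> \<gamma> z + (\<Sum>\<gamma>\<in>S. \<phi> \<gamma> z))"
    by (intro alg_slices.plus insert.IH insert.prems) auto
  ultimately show ?case by (simp only:)
qed (use alg_slices.elementary[of 0 0] in \<open>simp_all add: B.scl_zero_right\<close>)

text \<open>A family of functions in \<open>H2\<close> need not be the slices of any tensor;
  induction over the construction of the class supplies one.\<close>

lemma alg_slices_realize:
  assumes "alg_slices \<phi>"
  shows "\<exists>u\<in>T.E. \<forall>z\<in>\<Omega>. \<phi> z \<in> H2 \<and> (\<forall>g\<in>H2. T.ipE u (T.tens (A.sect z) g) = ip2 (\<phi> z) g)"
  using assms
proof induction
  case (elementary h f)
  then show ?case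
    by (intro bexI[of _ "T.tens h f"] ballI conjI)
      (simp_all only: T.tens_mem B.scl_mem T.ip_tens A.section_mem A.ip_sect B.ip_scl_left)
next
  case (plus \<phi> \<psi>)
  then obtain u v where u: "u \<in> T.E" "\<forall>z\<in>\<Omega>. \<phi> z \<in> H2 \<and> (\<forall>g\<in>H2. T.ipE u (T.tens (A.sect z) g) = ip2 (\<phi> z) g)"
    and v: "v \<in> T.E" "\<forall>z\<in>\<Omega>. \<psi> z \<in> H2 \<and> (\<forall>g\<in>H2. T.ipE v (T.tens (A.sect z) g) = ip2 (\<psi> z) g)"
    by blast
  show ?case
  proof (intro bexI[of _ "u + v"] ballI conjI)
    fix z assume z: "z \<in> \<Omega>"
    show "\<phi> z + \<psi> z \<in> H2" using u v z by (intro B.add_mem) auto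
    fix g assume g: "g \<in> H2"
    have "T.ipE (u + v) (T.tens (A.sect z) g) = ip2 (\<phi> z) g + ip2 (\<psi> z) g"
      using u v z g by (simp only: T.E.ip_add_left T.tens_mem A.section_mem)
    also have "\<dots> = ip2 (\<phi> z + \<psi> z) g" using u v z g B.ip_add_left by auto
    finally show "T.ipE (u + v) (T.tens (A.sect z) g) = ip2 (\<phi> z + \<psi> z) g" .
  qed (intro T.E.add_mem u v)
qed

lemma R_eq_jet:
  assumes "f \<in> T.E" "z \<in> \<Omega>" "p \<in> H2" "\<And>g. g \<in> H2 \<Longrightarrow> T.ipE f (T.tens (A.sect z) g) = ip2 p g" "\<alpha> \<in> I"
  shows "F.R f z \<alpha> = ipartial (index_list \<alpha>) (\<lambda>v. p v ()) z"
  using assms by (simp add: F.R_def \<Phi>_def B.jet_mem B.ip_jet)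

theorem division_in_quotient:
  assumes w: "w \<in> \<Omega>" and f: "f \<in> T.E" and zero: "\<And>\<alpha>. \<alpha> \<in> I \<Longrightarrow> F.R f w \<alpha> = 0"
  shows "\<exists>g. (\<forall>l. g l \<in> T.E) \<and> (\<forall>z \<alpha>. F.R f z \<alpha> = (\<Sum>l\<in>UNIV. (z $ l - w $ l) * F.R (g l) z \<alpha>))"
proof -
  obtain p where p: "p \<in> H2" and fp: "\<And>g. g \<in> H2 \<Longrightarrow> T.ipE f (T.tens (A.sect w) g) = ip2 p g"
    using slice_exists[OF f w] by blast
  have "ipartial (index_list \<alpha>) (\<lambda>z. p z ()) w = 0" if "\<alpha> \<in> I" for \<alpha>
    using R_eq_jet[OF f w p fp that] zero[OF that] by simp
  then obtain G where G: "\<And>\<gamma>. G \<gamma> \<in> H2" and pG: "p = (\<Sum>\<gamma>\<in>multi_indices_of_degree (Suc k). mono_mult w \<gamma> (G \<gamma>))"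
    using B.higher_division[OF w p] by blast
  obtain h where h: "h \<in> H1" "h w () = 1" using A.nonvanishing[OF w] by blast
  \<comment> \<open>At z = w the factor \<open>h\<close> is 1 and the monomials are those of the
    division, so the slice is \<open>p\<close>. At every other point the monomials are centred at
    \<open>z\<close>, so each slice vanishes to order k + 1 at its own point.\<close>
  define \<phi> where "\<phi> z = (\<Sum>\<gamma>\<in>multi_indices_of_degree (Suc k). fscale (h z ()) (mono_mult z \<gamma> (G \<gamma>)))" for z
  have "alg_slices \<phi>" unfolding \<phi>_def by (intro alg_slices_sum alg_slices_monomial h G)
  then obtain u where u: "u \<in> T.E" and \<phi>: "\<And>z. z \<in> \<Omega> \<Longrightarrow> \<phi> z \<in> H2"
    and u\<phi>: "\<And>z g. z \<in> \<Omega> \<Longrightarrow> g \<in> H2 \<Longrightarrow> T.ipE u (T.tens (A.sect z) g) = ip2 (\<phi> z) g"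
    using alg_slices_realize by blast
  have \<phi>w: "\<phi> w = p" unfolding \<phi>_def pG h by (simp only: A.scl_one)
  have Ru: "F.R u z \<alpha> = 0" for z \<alpha>
  proof (cases "z \<in> \<Omega> \<and> \<alpha> \<in> I")
    case True
    then have z: "z \<in> \<Omega>" and \<alpha>: "\<alpha> \<in> I" by auto
    have "F.R u z \<alpha> = ip2 (\<phi> z) (B.jet z (index_list \<alpha>))"
      using z \<alpha> by (simp add: F.R_def \<Phi>_def u\<phi> B.jet_mem)
    also have "\<dots> = (\<Sum>\<gamma>\<in>multi_indices_of_degree (Suc k). h z () * ip2 (mono_mult z \<gamma> (G \<gamma>)) (B.jet z (index_list \<alpha>)))"
      unfolding \<phi>_def by (simp only: B.ip_sum_left B.ip_scl_left B.scl_mem B.mono_mult_mem G B.jet_mem z)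
    also have "\<dots> = 0"
    proof (intro sum.neutral ballI)
      fix \<gamma> :: "'m \<Rightarrow> nat" assume \<gamma>: "\<gamma> \<in> multi_indices_of_degree (Suc k)"
      \<comment> \<open>At most k derivatives meet a monomial of degree k + 1.\<close>
      have "count_list (index_list \<alpha>) \<noteq> \<gamma>" "length (index_list \<alpha>) \<le> (\<Sum>l\<in>UNIV. \<gamma> l)"
        using \<alpha> \<gamma> by (auto simp: count_index_list length_index_list multi_indices_def multi_indices_of_degree_def)
      then show "h z () * ip2 (mono_mult z \<gamma> (G \<gamma>)) (B.jet z (index_list \<alpha>)) = 0"
        by (simp add: B.ip_jet z B.mono_mult_mem G B.ipartial_mono_mult)
    qed
    finally show ?thesis .
  qed (auto simp: F.R_def)
  define d where "d = f - u"
  have d: "d \<in> T.E" unfolding d_def by (intro T.E.diff_mem f u)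
  have dz: "d a w () = 0" if a: "a \<in> B" for a
  proof -
    have "d a w () = T.ipE f (T.tens (A.sect w) a) - T.ipE u (T.tens (A.sect w) a)"
      unfolding coordinate[OF d a w] unfolding d_def
      by (intro T.E.ip_diff_left f u T.tens_mem A.section_mem w T.B_mem a)
    also have "\<dots> = 0" using fp[OF T.B_mem[OF a]] u\<phi>[OF w T.B_mem[OF a]] \<phi>w by simp
    finally show ?thesis .
  qed
  \<comment> \<open>The constant is fixed before the basis vector, so the quotients of the
    coordinates of \<open>d\<close> are square summable along with those coordinates.\<close>
  obtain C where C: "C \<ge> 0" and div: "\<And>f. f \<in> H1 \<Longrightarrow> f w () = 0 \<Longrightarrow>
      \<exists>g. (\<forall>l. g l \<in> H1 \<and> A.nrm (g l) \<le> C * A.nrm f) \<and> A.row w g = f"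
    using A.division[OF w] by blast
  have "\<forall>a. \<exists>g. a \<in> B \<longrightarrow> (\<forall>l. g l \<in> H1 \<and> A.nrm (g l) \<le> C * A.nrm (d a)) \<and> A.row w g = d a"
    using div dz A.l2_memD(1)[OF d] by blast
  then obtain q where q: "\<And>a l. a \<in> B \<Longrightarrow> q a l \<in> H1" "\<And>a l. a \<in> B \<Longrightarrow> A.nrm (q a l) \<le> C * A.nrm (d a)"
    and rowq: "\<And>a. a \<in> B \<Longrightarrow> A.row w (q a) = d a" by metis
  define g where "g l = (\<lambda>a. if a \<in> B then q a l else 0)" for l
  have g: "g l \<in> T.E" for l
  proof (rule A.l2_mem_bounded(1))
    fix S assume S: "finite S" "S \<subseteq> B"
    have "(\<Sum>a\<in>S. (A.nrm (g l a))\<^sup>2) \<le> (\<Sum>a\<in>S. (C * A.nrm (d a))\<^sup>2)"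
      using S q by (intro sum_mono power_mono) (auto simp: g_def subset_iff intro: A.nrm_ge0)
    also have "\<dots> = C\<^sup>2 * (\<Sum>a\<in>S. (A.nrm (d a))\<^sup>2)" by (simp add: power_mult_distrib sum_distrib_left)
    also have "\<dots> \<le> C\<^sup>2 * (T.E.nrm d)\<^sup>2" by (intro mult_left_mono A.finite_sum_le_l2_nrm d S) simp
    finally show "(\<Sum>a\<in>S. (A.nrm (g l a))\<^sup>2) \<le> (C * T.E.nrm d)\<^sup>2" by (simp add: power_mult_distrib)
  qed (use C d q in \<open>auto simp: g_def\<close>)
  have dsum: "d = (\<Sum>l\<in>UNIV. mult_first w l (g l))"
  proof
    fix a
    have "(\<Sum>l\<in>UNIV. mult_first w l (g l)) a = (\<Sum>l\<in>UNIV. mult_shift w l (g l a))"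
      by (simp only: sum_apply1 mult_first_def)
    also have "\<dots> = d a"
    proof (cases "a \<in> B")
      case True
      then show ?thesis using rowq[OF True] by (simp add: g_def A.row_def)
    next
      case False
      then show ?thesis using A.l2_memD(3)[OF d False] by (simp add: g_def mult_shift_zero)
    qed
    finally show "d a = (\<Sum>l\<in>UNIV. mult_first w l (g l)) a" by simp
  qed
  have "F.R f z \<alpha> = (\<Sum>l\<in>UNIV. (z $ l - w $ l) * F.R (g l) z \<alpha>)" for z \<alpha>
  proof -
    have "F.R d z \<alpha> = (\<Sum>l\<in>UNIV. F.R (mult_first w l (g l)) z \<alpha>)"
      unfolding dsum F.R_def
      by (cases "z \<in> \<Omega> \<and> \<alpha> \<in> I") (auto simp: T.E.ip_sum_left mult_first_mem g \<Phi>_mem)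
    moreover have "F.R d z \<alpha> = F.R f z \<alpha>" unfolding d_def F.R_diff[OF f u] by (simp add: Ru)
    ultimately show ?thesis by (simp add: R_mult_first g)
  qed
  then show ?thesis using g by blast
qed

text \<open>The quadratic form is the squared norm of the combination \<open>x\<close> of feature
  vectors. If \<open>x\<close> is zero, pairing it with the tensors of \<open>h\<close> and
  \<open>g\<close> separates the points by varying \<open>h\<close>, through the independence of the
  kernel sections of \<open>K1\<close>, and then the multi-indices at each point by varying
  \<open>g\<close>, through the independence of the jets of \<open>K2\<close>.\<close>

lemma positive_definite_J: "positive_definite_kernel \<Omega> I (J_res K1 K2)"
  unfolding positive_definite_kernel_def Let_def
proof (intro allI impI)
  fix S :: "(complex ^ 'm) set" and \<eta> :: "complex ^ 'm \<Rightarrow> ('m \<Rightarrow> nat) \<Rightarrow> complex"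
  assume *: "finite S \<and> S \<subseteq> \<Omega> \<and> (\<exists>z\<in>S. \<exists>i\<in>I. \<eta> z i \<noteq> 0)"
  then have S: "finite S" "S \<subseteq> \<Omega>" by auto
  define x where "x = (\<Sum>w\<in>S. \<Sum>j\<in>I. T.sclE (\<eta> w j) (\<Phi> w j))"
  have \<Phi>S: "w \<in> S \<Longrightarrow> \<Phi> w j \<in> T.E" for w j using S \<Phi>_mem by blast
  have x: "x \<in> T.E" unfolding x_def by (intro T.E.sum_mem T.E.scl_mem \<Phi>S)
  have ipx: "T.ipE x y = (\<Sum>w\<in>S. \<Sum>j\<in>I. \<eta> w j * T.ipE (\<Phi> w j) y)" if "y \<in> T.E" for y
    unfolding x_def using that by (simp add: T.E.ip_sum_left T.E.ip_scl_left T.E.sum_mem T.E.scl_mem \<Phi>S)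
  have "T.ipE x x = (\<Sum>z\<in>S. \<Sum>i\<in>I. cnj (\<eta> z i) * T.ipE x (\<Phi> z i))"
    by (subst (2) x_def) (simp add: T.E.ip_sum_right T.E.ip_scl_right T.E.sum_mem T.E.scl_mem \<Phi>S x)
  also have "\<dots> = (\<Sum>z\<in>S. \<Sum>i\<in>I. \<Sum>w\<in>S. (\<Sum>j\<in>I. J_res K1 K2 z w i j * \<eta> w j) * cnj (\<eta> z i))"
  proof (intro sum.cong refl)
    fix z i assume z: "z \<in> S"
    have "T.ipE x (\<Phi> z i) = (\<Sum>w\<in>S. \<Sum>j\<in>I. J_res K1 K2 z w i j * \<eta> w j)"
      unfolding ipx[OF \<Phi>S[OF z]] using z S by (intro sum.cong refl) (auto simp: ip_\<Phi> subset_iff)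
    then show "cnj (\<eta> z i) * T.ipE x (\<Phi> z i) = (\<Sum>w\<in>S. (\<Sum>j\<in>I. J_res K1 K2 z w i j * \<eta> w j) * cnj (\<eta> z i))"
      by (simp add: sum_distrib_left mult.commute)
  qed
  also have "\<dots> = (\<Sum>z\<in>S. \<Sum>w\<in>S. \<Sum>i\<in>I. (\<Sum>j\<in>I. J_res K1 K2 z w i j * \<eta> w j) * cnj (\<eta> z i))"
    by (intro sum.cong[OF refl] sum.swap)
  finally have s: "(\<Sum>z\<in>S. \<Sum>w\<in>S. \<Sum>i\<in>I. (\<Sum>j\<in>I. J_res K1 K2 z w i j * \<eta> w j) * cnj (\<eta> z i)) = T.ipE x x" ..
  have "x \<noteq> 0"
  proof
    assume x0: "x = 0"
    have "\<eta> w i = 0" if w: "w \<in> S" and i: "i \<in> I" for w i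
    proof -
      have w\<Omega>: "w \<in> \<Omega>" using w S by blast
      have "(\<Sum>j\<in>I. cnj (\<eta> w j) * ipartial (index_list j) (\<lambda>z. g z ()) w) = 0" if g: "g \<in> H2" for g
      proof -
        \<comment> \<open>For fixed \<open>g\<close>, the pairing of \<open>x\<close> with the
          tensor of \<open>h\<close> and \<open>g\<close> equals the inner product with
          \<open>h\<close> of the combination of sections of \<open>K1\<close> with these
          coefficients; each \<open>c v\<close> therefore vanishes.\<close>
        define c where "c v = (\<Sum>j\<in>I. \<eta> v j * ip2 (B.jet v (index_list j)) g)" for v
        have sS: "v \<in> S \<Longrightarrow> A.sect v \<in> H1" "v \<in> S \<Longrightarrow> B.jet v L \<in> H2" for v L
          using S A.section_mem B.jet_mem by blast+
        have "(\<Sum>v\<in>S. fscale (c v) (A.sect v)) = 0"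
        proof (rule A.eq_if_ip_eq)
          fix h assume h: "h \<in> H1"
          have "ip1 (\<Sum>v\<in>S. fscale (c v) (A.sect v)) h = (\<Sum>v\<in>S. c v * ip1 (A.sect v) h)"
            by (subst A.ip_sum_left) (intro A.scl_mem sS h sum.cong refl A.ip_scl_left; assumption)+
          also have "\<dots> = T.ipE x (T.tens h g)"
            unfolding ipx[OF T.tens_mem[OF h g]] c_def \<Phi>_def
            by (intro sum.cong refl) (simp add: T.ip_tens sS h g sum_distrib_left mult_ac)
          also have "\<dots> = 0" by (simp only: x0 T.E.ip_zero_left T.tens_mem h g)
          finally have 0: "ip1 (\<Sum>v\<in>S. fscale (c v) (A.sect v)) h = 0" .
          have "(\<Sum>v\<in>S. fscale (c v) (A.sect v)) \<in> H1" by (intro A.sum_mem A.scl_mem sS)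
          from A.ip_cnj[OF this h] 0
          show "ip1 h (\<Sum>v\<in>S. fscale (c v) (A.sect v)) = ip1 h 0" by (simp only: A.ip_zero_right h complex_cnj_zero)
        qed (intro A.sum_mem A.scl_mem sS A.zero_mem; assumption)+
        from A.sections_independent[OF S this w] have "cnj (c w) = 0" by simp
        moreover have "cnj (ip2 (B.jet w L) g) = ipartial L (\<lambda>z. g z ()) w" for L
          using B.ip_cnj[OF B.jet_mem[OF w\<Omega>] g] B.ip_jet[OF w\<Omega> g] by simp
        ultimately show ?thesis by (simp add: c_def)
      qed
      then have "cnj (\<eta> w i) = 0"
        by (rule B.jets_independent[where k = k and c = "\<lambda>j. cnj (\<eta> w j)", OF w\<Omega> _ i])
      then show ?thesis by simp
    qed
    then show False using * by blast
  qed
  then have "Re (T.ipE x x) > 0" by (rule T.E.ip_pos[OF x])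
  moreover have "Im (T.ipE x x) = 0" using T.E.ip_self[OF x] by simp
  ultimately show "Im (\<Sum>z\<in>S. \<Sum>w\<in>S. \<Sum>i\<in>I. (\<Sum>j\<in>I. J_res K1 K2 z w i j * \<eta> w j) * cnj (\<eta> z i)) = 0 \<and>
      0 < Re (\<Sum>z\<in>S. \<Sum>w\<in>S. \<Sum>i\<in>I. (\<Sum>j\<in>I. J_res K1 K2 z w i j * \<eta> w j) * cnj (\<eta> z i))"
    unfolding s by simp
qed

theorem generalized_bergman_J:
  assumes "sesqui_analytic \<Omega> K1"
  shows "generalized_bergman_kernel \<Omega> I (J_res K1 K2)"
  unfolding generalized_bergman_kernel_def
proof (intro conjI ballI)
  fix \<alpha> \<beta>
  have "sesqui_analytic \<Omega> (mixed_partial \<alpha> \<beta> K2)"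
    by (rule sesqui_analytic_cong[OF A.open_domain B.mixed_partial_eq[symmetric] B.sesqui_analytic_ip_jet])
  then show "sesqui_analytic \<Omega> (\<lambda>z w. J_res K1 K2 z w \<alpha> \<beta>)"
    unfolding J_res_def by (rule sesqui_analytic_mult[OF assms])
next
  show "positive_definite_kernel \<Omega> I (J_res K1 K2)" by (rule positive_definite_J)
next
  have rk: "is_rkhs \<Omega> I (J_res K1 K2) (F.R ` T.E) F.quotient_ip"
    by (rule F.is_rkhs_quotient[OF finite_multi_indices holomorphic_R]) (auto simp: ip_\<Phi>)
  have mult: "bounded_operator (F.R ` T.E) F.quotient_ip (mult_shift 0 l)" for l
  proof -
    obtain C where C: "\<And>f. f \<in> T.E \<Longrightarrow> T.E.nrm (mult_first 0 l f) \<le> C * T.E.nrm f"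
      using mult_first_bounded[of 0 l] by blast
    show ?thesis
    proof (rule F.R_bounded_operator[OF mult_first_mem _ C])
      fix f assume "f \<in> T.E"
      then show "F.R (mult_first 0 l f) = mult_shift 0 l (F.R f)"
        by (intro ext) (simp add: R_mult_first mult_shift_def)
    qed
  qed
  interpret Q: rkhs_mult \<Omega> I "J_res K1 K2" "F.R ` T.E" F.quotient_ip
    by unfold_locales (rule A.open_domain rk mult)+
  have div: "\<exists>g. (\<forall>l. g l \<in> F.R ` T.E) \<and> Q.row w g = f"
    if w: "w \<in> \<Omega>" and f: "f \<in> F.R ` T.E" and z: "\<And>i. i \<in> I \<Longrightarrow> f w i = 0" for w f
  proof -
    obtain e where e: "e \<in> T.E" "f = F.R e" using f by blast
    have "F.R e w \<alpha> = 0" if "\<alpha> \<in> I" for \<alpha> using z[OF that] e(2) by simp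
    then have "\<exists>g. (\<forall>l. g l \<in> T.E) \<and> (\<forall>z \<alpha>. F.R e z \<alpha> = (\<Sum>l\<in>UNIV. (z $ l - w $ l) * F.R (g l) z \<alpha>))"
      by (rule division_in_quotient[OF w e(1)])
    then obtain g where "\<forall>l. g l \<in> T.E" and "\<forall>z \<alpha>. F.R e z \<alpha> = (\<Sum>l\<in>UNIV. (z $ l - w $ l) * F.R (g l) z \<alpha>)"
      by (elim exE conjE)
    note g = this(1)[rule_format] and eg = this(2)[rule_format]
    have "Q.row w (\<lambda>l. F.R (g l)) = f"
      by (intro ext) (simp only: Q.row_apply e eg)
    then show ?thesis using g by (intro exI[of _ "\<lambda>l. F.R (g l)"]) simp
  qed
  show "\<exists>H ip. is_rkhs \<Omega> I (J_res K1 K2) H ip \<and> sharp_on \<Omega> I (J_res K1 K2) H ip \<and>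
        (\<forall>w\<in>\<Omega>. hclosed (dsum_space H) (dsum_inner ip) (D_mult_adj H ip w ` H))"
  proof (intro exI conjI ballI)
    show "is_rkhs \<Omega> I (J_res K1 K2) (F.R ` T.E) F.quotient_ip" by (rule rk)
    show "sharp_on \<Omega> I (J_res K1 K2) (F.R ` T.E) F.quotient_ip"
      unfolding sharp_on_def
      by (intro conjI allI ballI mult Q.generalized_bergman_if_division(1) finite_multi_indices div)
    fix w assume w: "w \<in> \<Omega>"
    show "hclosed (dsum_space (F.R ` T.E)) (dsum_inner F.quotient_ip)
        (D_mult_adj (F.R ` T.E) F.quotient_ip w ` (F.R ` T.E))"
      by (intro Q.generalized_bergman_if_division(2) w finite_multi_indices div)
  qed
qed

end

theorem theorem4p19:
  fixes \<Omega> :: "(complex ^ 'm::finite) set"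
    and K1 K2 :: "complex ^ 'm \<Rightarrow> complex ^ 'm \<Rightarrow> complex"
    and k :: nat
  assumes "open \<Omega>" and "connected \<Omega>" and "\<Omega> \<noteq> {}" and "bounded \<Omega>"
    and "generalized_bergman_kernel \<Omega> UNIV (scalar_kernel K1)"
    and "generalized_bergman_kernel \<Omega> UNIV (scalar_kernel K2)"
  shows "generalized_bergman_kernel \<Omega> (multi_indices k) (J_res K1 K2)"
proof -
  obtain H1 ip1 where 1: "scalar_division_rkhs \<Omega> K1 H1 ip1"
    using scalar_division_rkhs_of_generalized_bergman[OF assms(1,5)] by blast
  obtain H2 ip2 where 2: "scalar_division_rkhs \<Omega> K2 H2 ip2"
    using scalar_division_rkhs_of_generalized_bergman[OF assms(1,6)] by blast
  interpret A: scalar_division_rkhs \<Omega> K1 H1 ip1 by (rule 1)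
  interpret B: scalar_division_rkhs \<Omega> K2 H2 ip2 by (rule 2)
  obtain B where "B.orthonormal_basis B" using B.orthonormal_basis_exists by blast
  then interpret J: jet_module \<Omega> K1 H1 ip1 K2 H2 ip2 B k by unfold_locales
  have "sesqui_analytic \<Omega> K1"
    using assms(5) by (simp add: generalized_bergman_kernel_def scalar_kernel_def)
  then show ?thesis by (rule J.generalized_bergman_J)
qed

end
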